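(* Let $n\ge2$ and let $\gamma_0\in\dot C^\infty(\mathbb{R};\mathbb{R}^n)$ with $\inf_{\mathbb{R}}|\partial_x\gamma_0|>0$. Suppose that $$E[\gamma_0]<8.$$ Then the elastic flow $\gamma:[0,\infty)\times\mathbb{R}\to\mathbb{R}^n$, $\partial_t\gamma=-\nabla_s^2\kappa-\frac12|\kappa|^2\kappa+\kappa$, starting from $\gamma_0$ satisfies $$\lim_{t\to\infty}\sup_{\mathbb{R}}|\partial_s\gamma(t,\cdot)-e_1|=0,\qquad\lim_{t\to\infty}\sup_{\mathbb{R}}|\partial_s^m\kappa(t,\cdot)|=0$$ for all $m\in\mathbb{N}_0$. In particular, after reparametrization by arclength and translation, the solution locally smoothly converges to a horizontal line: for every family of base points $\{s_t\}_{t\ge0}\subset\mathbb{R}$, the curves $\tilde\gamma(t,\cdot+s_t)-\tilde\gamma(t,s_t)$ converge, as $t\to\infty$, to $s\mapsto se_1$ in $C^m_{\mathrm{loc}}(\mathbb{R})$ for all $m\in\mathbb{N}_0$.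
   Context: $\{e_j\}_{j=1}^n$ is the canonical basis of $\mathbb{R}^n$ and $\mathbb{N}_0=\{0,1,2,\dots\}$. For an immersed curve $\gamma$ (or each curve $\gamma(t,\cdot)$ of a family), $\partial_s=|\partial_x\gamma|^{-1}\partial_x$, $ds=|\partial_x\gamma|\,dx$, $\kappa=\partial_s^2\gamma$, and $\nabla_sf=\partial_sf-\langle\partial_sf,\partial_s\gamma\rangle\partial_s\gamma$. The energy is $$E[\gamma]=\int_\gamma\Big(\tfrac12|\kappa|^2+\tfrac12|\partial_s\gamma-e_1|^2\Big)ds.$$ $\dot C^\infty(\mathbb{R};\mathbb{R}^n)$ is the space of smooth maps $u:\mathbb{R}\to\mathbb{R}^n$ all of whose derivatives of order $\ge1$ are bounded on $\mathbb{R}$. $C^\infty([0,T']\times\mathbb{R})$ denotes the maps all of whose derivatives $\partial_t^\alpha\partial_x^\beta u$, $\alpha,\beta\in\mathbb{N}_0$, are bounded on $[0,T']\times\mathbb{R}$. The elastic flow starting from $\gamma_0$ (with $E[\gamma_0]<\infty$) is the unique smooth global-in-time solution with $\gamma-\gamma_0\in C^\infty([0,T']\times\mathbb{R})$ and $\inf_{[0,T']\times\mathbb{R}}|\partial_x\gamma|>0$ for every $T'\in(0,\infty)$. Canonical reparametrization: $\tilde\gamma(t,s)=\gamma(t,\Phi_t(s))$, where $\Phi_t:\mathbb{R}\to\mathbb{R}$ is the inverse of $x\mapsto\int_0^x|\partial_x\gamma(t,x')|\,dx'$. *)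

theory Defs
  imports "HOL-Analysis.Analysis"
begin

definition vderiv :: "(real \<Rightarrow> 'a::real_normed_vector) \<Rightarrow> real \<Rightarrow> 'a" where
  "vderiv f x = vector_derivative f (at x)"

definition C_k :: "nat \<Rightarrow> (real \<Rightarrow> 'a::real_normed_vector) \<Rightarrow> bool" where
  "C_k k f \<longleftrightarrow>
     (\<forall>j<k. (vderiv ^^ j) f differentiable_on UNIV) \<and> continuous_on UNIV ((vderiv ^^ k) f)"

text \<open>The space \<open>\<dot>C\<^sup>\<infinity>(\<real>)\<close>: the function itself may be unbounded.\<close>

definition homogeneous_C_inf :: "(real \<Rightarrow> 'a::real_normed_vector) \<Rightarrow> bool" where
  "homogeneous_C_inf f \<longleftrightarrow> (\<forall>k. C_k k f) \<and> (\<forall>k\<ge>1. bounded (range ((vderiv ^^ k) f)))"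

definition C_k_loc_tendsto ::
    "nat \<Rightarrow> ('b \<Rightarrow> real \<Rightarrow> 'a::real_normed_vector) \<Rightarrow> (real \<Rightarrow> 'a) \<Rightarrow> 'b filter \<Rightarrow> bool" where
  "C_k_loc_tendsto k F f net \<longleftrightarrow>
     C_k k f \<and> (\<forall>\<^sub>F t in net. C_k k (F t)) \<and>
     (\<forall>K j. compact K \<longrightarrow> j \<le> k \<longrightarrow>
        uniform_limit K (\<lambda>t. (vderiv ^^ j) (F t)) ((vderiv ^^ j) f) net)"


text \<open>
  Families \<open>u t x\<close> with \<open>t\<close> in a time interval \<open>I\<close> and \<open>x \<in> \<real>\<close>. Time derivatives are taken
  within \<open>I\<close>, so they are one-sided at the end points of \<open>I\<close> that belong to it.
\<close>

definition partial_t :: "real set \<Rightarrow> (real \<Rightarrow> real \<Rightarrow> 'a::real_normed_vector) \<Rightarrow> real \<Rightarrow> real \<Rightarrow> 'a" where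
  "partial_t I u t x = vector_derivative (\<lambda>\<tau>. u \<tau> x) (at t within I)"

definition partial_x :: "(real \<Rightarrow> real \<Rightarrow> 'a::real_normed_vector) \<Rightarrow> real \<Rightarrow> real \<Rightarrow> 'a" where
  "partial_x u t x = vderiv (u t) x"

definition partial_tx ::
    "real set \<Rightarrow> nat \<Rightarrow> nat \<Rightarrow> (real \<Rightarrow> real \<Rightarrow> 'a::real_normed_vector) \<Rightarrow> real \<Rightarrow> real \<Rightarrow> 'a" where
  "partial_tx I \<alpha> \<beta> u = (partial_t I ^^ \<alpha>) ((partial_x ^^ \<beta>) u)"

text \<open>
  Total differentiability of every \<open>\<partial>\<^sub>t\<^sup>\<alpha> \<partial>\<^sub>x\<^sup>\<beta> u\<close> makes all of these iterated partial
  derivatives exist and be jointly continuous up to the boundary of \<open>I \<times> \<real>\<close>.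
\<close>

definition smooth_family :: "real set \<Rightarrow> (real \<Rightarrow> real \<Rightarrow> 'a::real_normed_vector) \<Rightarrow> bool" where
  "smooth_family I u \<longleftrightarrow>
     (\<forall>\<alpha> \<beta>. (\<lambda>(t, x). partial_tx I \<alpha> \<beta> u t x) differentiable_on (I \<times> UNIV))"

definition C_inf_bounded :: "real set \<Rightarrow> (real \<Rightarrow> real \<Rightarrow> 'a::real_normed_vector) \<Rightarrow> bool" where
  "C_inf_bounded I u \<longleftrightarrow>
     smooth_family I u \<and>
     (\<forall>\<alpha> \<beta>. bounded ((\<lambda>(t, x). partial_tx I \<alpha> \<beta> u t x) ` (I \<times> UNIV)))"


definition arc_deriv ::
    "(real \<Rightarrow> 'a::real_normed_vector) \<Rightarrow> (real \<Rightarrow> 'b::real_normed_vector) \<Rightarrow> real \<Rightarrow> 'b" where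
  "arc_deriv \<gamma> f x = (1 / norm (vderiv \<gamma> x)) *\<^sub>R vderiv f x"

definition tangent :: "(real \<Rightarrow> 'a::real_normed_vector) \<Rightarrow> real \<Rightarrow> 'a" where
  "tangent \<gamma> = arc_deriv \<gamma> \<gamma>"

definition curvature :: "(real \<Rightarrow> 'a::real_normed_vector) \<Rightarrow> real \<Rightarrow> 'a" where
  "curvature \<gamma> = (arc_deriv \<gamma> ^^ 2) \<gamma>"

definition normal_deriv :: "(real \<Rightarrow> 'a::real_inner) \<Rightarrow> (real \<Rightarrow> 'a) \<Rightarrow> real \<Rightarrow> 'a" where
  "normal_deriv \<gamma> f x = arc_deriv \<gamma> f x - (arc_deriv \<gamma> f x \<bullet> tangent \<gamma> x) *\<^sub>R tangent \<gamma> x"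

definition energy :: "'a::real_inner \<Rightarrow> (real \<Rightarrow> 'a) \<Rightarrow> ennreal" where
  "energy e \<gamma> =
     (\<integral>\<^sup>+ x. ennreal ((1/2 * (norm (curvature \<gamma> x))\<^sup>2 + 1/2 * (norm (tangent \<gamma> x - e))\<^sup>2)
                    * norm (vderiv \<gamma> x)) \<partial>lborel)"

definition elastic_flow :: "(real \<Rightarrow> 'a::real_inner) \<Rightarrow> (real \<Rightarrow> real \<Rightarrow> 'a) \<Rightarrow> bool" where
  "elastic_flow \<gamma>\<^sub>0 \<gamma> \<longleftrightarrow>
     smooth_family {0..} \<gamma> \<and>
     \<gamma> 0 = \<gamma>\<^sub>0 \<and>
     (\<forall>t\<ge>0. \<forall>x. partial_t {0..} \<gamma> t x =
        - (normal_deriv (\<gamma> t) ^^ 2) (curvature (\<gamma> t)) x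
        - (1/2 * (norm (curvature (\<gamma> t) x))\<^sup>2) *\<^sub>R curvature (\<gamma> t) x
        + curvature (\<gamma> t) x) \<and>
     (\<forall>T>0. C_inf_bounded {0..T} (\<lambda>t x. \<gamma> t x - \<gamma>\<^sub>0 x)) \<and>
     (\<forall>T>0. 0 < (INF (t, x)\<in>{0..T} \<times> UNIV. norm (partial_x \<gamma> t x)))"

definition arclength :: "(real \<Rightarrow> 'a::real_normed_vector) \<Rightarrow> real \<Rightarrow> real" where
  "arclength \<gamma> x = (LBINT y=ereal 0..ereal x. norm (vderiv \<gamma> y))"

definition canonical_reparam :: "(real \<Rightarrow> 'a::real_normed_vector) \<Rightarrow> real \<Rightarrow> 'a" where
  "canonical_reparam \<gamma> s = \<gamma> (inv (arclength \<gamma>) s)"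

end

theory Submission
  imports Defs
begin

text \<open>
  Let \<open>T\<close> be the unit tangent, \<open>\<kappa>\<close> the curvature vector, \<open>V = \<partial>\<^sub>t\<gamma>\<close> the normal velocity and
  \<open>e\<close> the direction of the limit line. The flow is the gradient flow of the energy with respect to arclength,
  so the energy decreases and \<open>V\<close> is square integrable in space and time. The proof bounds all derivatives
  of the curvature, deduces that \<open>V\<close> tends to zero, and shows that a curve of energy below \<open>8\<close> on which \<open>V\<close>
  is small is almost the line.

  \<^bold>\<open>Bounds.\<close> With \<open>N\<^sub>m = \<nabla>\<^sub>s\<^sup>m \<kappa>\<close>, commuting derivatives gives
  \<open>\<nabla>\<^sub>t N\<^sub>m = - N\<^sub>m\<^sub>+\<^sub>4 + N\<^sub>m\<^sub>+\<^sub>2 + P\<close>, where every monomial of \<open>P\<close> has at least three curvature factors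
  and scaling weight at most \<open>m + 5\<close> (\<open>evolution_N\<close>). Let \<open>F\<^sub>m\<close> be the integral of \<open>\<bar>N\<^sub>m\<bar>\<^sup>2\<close> along the curve.
  Interpolation between \<open>F\<^sub>0\<close>, which the energy controls, and \<open>F\<^sub>m\<^sub>+\<^sub>2\<close> absorbs \<open>P\<close>, because its weight is
  subcritical; this gives \<open>F\<^sub>m' \<le> C - F\<^sub>m\<^sub>+\<^sub>2\<close> with \<open>C\<close> independent of time (\<open>F_lim_damped\<close>), and hence uniform bounds
  (\<open>N_uniform_bound\<close>). Derivatives of the initial curvature are bounded but need not be square integrable,
  so the argument starts at positive times, after a time-weighted estimate has shown that all \<open>F\<^sub>m\<close> are finite
  (\<open>F_bounded_positive_time\<close>). Integrals over the whole line are limits of integrals with the cut-off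
  \<open>1 - (x/R)\<^sup>2\<close> on \<open>[-R, R]\<close>; the boundary terms vanish as \<open>R\<close> grows as soon as one factor is square integrable.

  \<^bold>\<open>Velocity.\<close> The integral of \<open>\<bar>V\<bar>\<^sup>2\<close> is integrable in time and Lipschitz in time, so it tends to zero
  (\<open>velocity_tends_to_zero\<close>). The vector \<open>W = \<nabla>\<^sub>s\<kappa> + \<bar>\<kappa>\<bar>\<^sup>2/2 T - (T - e)\<close> satisfies \<open>\<partial>\<^sub>sW = - V\<close>, and therefore it
  tends to zero uniformly (\<open>W_tends_to_zero\<close>).

  \<^bold>\<open>Rigidity.\<close> Put \<open>u = \<langle>T, e\<rangle>\<close> and \<open>v = 1 - u\<close>. If \<open>W\<close> were zero there would be two first integrals:
  \<open>\<bar>\<kappa>\<bar>\<^sup>2 = 2v\<close>, which is \<open>\<langle>W, T\<rangle> = 0\<close>, and \<open>\<bar>\<kappa>\<bar>\<^sup>2 (1 - u\<^sup>2) = \<langle>\<kappa>, e\<rangle>\<^sup>2\<close>, which says that \<open>\<kappa>\<close>, \<open>T\<close>, \<open>e\<close> are coplanar and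
  follows from \<open>\<partial>\<^sub>s (\<kappa> \<and> T \<and> e) = W \<and> T \<and> e\<close>. At a maximum of \<open>v\<close> the product \<open>\<langle>\<kappa>, e\<rangle>\<close> vanishes, so that
  \<open>2v \<cdot> v (2 - v) = 0\<close>: either \<open>v = 0\<close> and the curve is the line, or \<open>v = 2\<close>, as for the loop of the borderline elastica.
  The second case costs energy \<open>8\<close>: the energy bounds the integral of \<open>\<bar>\<kappa>\<bar> \<bar>T - e\<bar>\<close>, which is at least the total variation
  of \<open>4 \<surd>((1 + u)/2)\<close>, and that function would have to descend from \<open>4\<close> to \<open>0\<close> and return (\<open>angle_bound\<close>).
  All these relations hold up to errors that tend to zero with \<open>W\<close>, which yields \<open>v \<rightarrow> 0\<close> uniformly
  (\<open>tangent_tends_to_e\<close>). Interpolation with the bounded higher derivatives makes every derivative of \<open>\<kappa>\<close> tend to zero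
  (\<open>unif_zero_D\<close>), and arclength parametrization turns this into local smooth convergence.
\<close>

section \<open>Families with locally bounded derivatives\<close>

abbreviation Dt :: "(real \<Rightarrow> real \<Rightarrow> 'a::real_normed_vector) \<Rightarrow> real \<Rightarrow> real \<Rightarrow> 'a" where
  "Dt \<equiv> partial_t {0..}"

abbreviation Dx :: "(real \<Rightarrow> real \<Rightarrow> 'a::real_normed_vector) \<Rightarrow> real \<Rightarrow> real \<Rightarrow> 'a" where
  "Dx \<equiv> partial_x"

text \<open>
  Bounds hold on each strip \<open>[0, T] \<times> \<real>\<close> separately. This is what membership in \<open>C\<^sup>\<infinity>([0, T] \<times> \<real>)\<close> for every \<open>T\<close> provides,
  and nothing uniform in time is known before the curvature estimates.
\<close>

definition locally_bounded_cont :: "(real \<Rightarrow> real \<Rightarrow> 'a::real_normed_vector) \<Rightarrow> bool" where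
  "locally_bounded_cont u \<longleftrightarrow> continuous_on ({0..} \<times> UNIV) (\<lambda>(t, x). u t x) \<and>
     (\<forall>T. \<exists>B. \<forall>t\<in>{0..T}. \<forall>x. norm (u t x) \<le> B)"

definition has_partials :: "(real \<Rightarrow> real \<Rightarrow> 'a::real_normed_vector) \<Rightarrow> (real \<Rightarrow> real \<Rightarrow> 'a) \<Rightarrow> (real \<Rightarrow> real \<Rightarrow> 'a) \<Rightarrow> bool" where
  "has_partials u ut ux \<longleftrightarrow> (\<forall>t\<ge>0. \<forall>x.
       ((\<lambda>\<tau>. u \<tau> x) has_vector_derivative ut t x) (at t within {0..}) \<and>
       (u t has_vector_derivative ux t x) (at x))"

text \<open>
  The partial derivatives are existentially quantified, and not given by derivative operators, because only their values
  at \<open>t \<ge> 0\<close> are meaningful; closure under sums and products is then an induction on the number of derivatives.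
\<close>

fun Ck_bounded :: "nat \<Rightarrow> (real \<Rightarrow> real \<Rightarrow> 'a::real_normed_vector) \<Rightarrow> bool" where
  "Ck_bounded 0 u \<longleftrightarrow> locally_bounded_cont u"
| "Ck_bounded (Suc k) u \<longleftrightarrow> locally_bounded_cont u \<and> (\<exists>ut ux. has_partials u ut ux \<and> Ck_bounded k ut \<and> Ck_bounded k ux)"

definition bsmooth :: "(real \<Rightarrow> real \<Rightarrow> 'a::real_normed_vector) \<Rightarrow> bool" where
  "bsmooth u \<longleftrightarrow> (\<forall>k. Ck_bounded k u)"

lemma within_nonneg_not_bot [simp]: "t \<ge> 0 \<Longrightarrow> at t within {0::real..} \<noteq> bot"
proof -
  assume "t \<ge> 0"
  then have "t islimpt {t<..<t+1}" by (simp add: islimpt_greaterThanLessThan1)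
  moreover have "{t<..<t+1} \<subseteq> {0..}" using \<open>t \<ge> 0\<close> by auto
  ultimately show ?thesis unfolding trivial_limit_within using islimpt_subset by blast
qed

lemma Dt_eqI: "t \<ge> 0 \<Longrightarrow> ((\<lambda>\<tau>. u \<tau> x) has_vector_derivative d) (at t within {0..}) \<Longrightarrow> Dt u t x = d"
  unfolding partial_t_def by (rule vector_derivative_within) auto

lemma Dx_eqI: "(u t has_vector_derivative d) (at x) \<Longrightarrow> Dx u t x = d"
  unfolding partial_x_def vderiv_def by (rule vector_derivative_at)

lemma locally_bounded_cont_cong:
  assumes "\<And>t x. t \<ge> 0 \<Longrightarrow> u t x = v t x" "locally_bounded_cont u"
  shows "locally_bounded_cont v"
proof -
  have "continuous_on ({0..} \<times> UNIV) (\<lambda>(t, x). v t x) = continuous_on ({0..} \<times> UNIV) (\<lambda>(t, x). u t x)"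
    by (rule continuous_on_cong) (use assms(1) in auto)
  then show ?thesis using assms unfolding locally_bounded_cont_def by simp
qed

lemma has_vector_derivative_cong_nonneg:
  assumes "\<And>t x. t \<ge> 0 \<Longrightarrow> u t x = v t x" "t \<ge> 0"
    and "((\<lambda>\<tau>. u \<tau> x) has_vector_derivative d) (at t within {0..})"
  shows "((\<lambda>\<tau>. v \<tau> x) has_vector_derivative d) (at t within {0..})"
  by (rule has_vector_derivative_transform[OF _ _ assms(3)]) (use assms in auto)

lemma has_partials_cong:
  assumes "\<And>t x. t \<ge> 0 \<Longrightarrow> u t x = v t x" "has_partials u ut ux"
  shows "has_partials v ut ux"
proof -
  have e: "v t = u t" if "t \<ge> 0" for t using assms(1)[OF that] by auto
  show ?thesis unfolding has_partials_def
  proof (intro allI impI conjI)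
    fix t x :: real assume t: "t \<ge> 0"
    show "((\<lambda>\<tau>. v \<tau> x) has_vector_derivative ut t x) (at t within {0..})"
      by (rule has_vector_derivative_cong_nonneg[OF assms(1) t]) (use assms(2) t in \<open>auto simp: has_partials_def\<close>)
    show "(v t has_vector_derivative ux t x) (at x)"
      unfolding e[OF t] using assms(2) t by (simp add: has_partials_def)
  qed
qed

lemma has_partials_t: "has_partials u ut ux \<Longrightarrow> t \<ge> 0 \<Longrightarrow>
    ((\<lambda>\<tau>. u \<tau> x) has_vector_derivative ut t x) (at t within {0..})"
  and has_partials_x: "has_partials u ut ux \<Longrightarrow> t \<ge> 0 \<Longrightarrow> (u t has_vector_derivative ux t x) (at x)"
  by (simp_all add: has_partials_def)

lemma Ck_bounded_imp_locally_bounded_cont: "Ck_bounded k u \<Longrightarrow> locally_bounded_cont u"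
  by (cases k) simp_all

lemma Ck_bounded_Suc_D: "Ck_bounded (Suc k) u \<Longrightarrow> Ck_bounded k u"
proof (induction k arbitrary: u)
  case 0 then show ?case by (simp add: Ck_bounded_imp_locally_bounded_cont)
next
  case (Suc k)
  from Suc.prems obtain ut ux where h: "has_partials u ut ux" "Ck_bounded (Suc k) ut" "Ck_bounded (Suc k) ux" "locally_bounded_cont u"
    unfolding Ck_bounded.simps(2)[of "Suc k"] by blast
  show ?case unfolding Ck_bounded.simps(2) using h Suc.IH by blast
qed

lemma Ck_bounded_cong:
  assumes eq: "\<And>t x. t \<ge> 0 \<Longrightarrow> u t x = v t x" and u: "Ck_bounded k u"
  shows "Ck_bounded k v"
  using u locally_bounded_cont_cong[of u v] has_partials_cong[of u v] eq by (cases k) auto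

lemma bsmooth_cong:
  assumes "\<And>t x. t \<ge> 0 \<Longrightarrow> u t x = v t x" "bsmooth u" shows "bsmooth v"
  using assms Ck_bounded_cong unfolding bsmooth_def by blast

lemma locally_bounded_cont_bilinear:
  assumes "bounded_bilinear pr" "locally_bounded_cont u" "locally_bounded_cont v"
  shows "locally_bounded_cont (\<lambda>t x. pr (u t x) (v t x))"
proof -
  interpret bounded_bilinear pr by fact
  obtain K where K: "\<And>a b. norm (pr a b) \<le> norm a * norm b * K" "K \<ge> 0" using nonneg_bounded by blast
  have "continuous_on ({0..} \<times> UNIV) (\<lambda>z. pr ((\<lambda>(t,x). u t x) z) ((\<lambda>(t,x). v t x) z))"
    by (intro continuous_on) (use assms in \<open>auto simp: locally_bounded_cont_def\<close>)
  then have c: "continuous_on ({0..} \<times> UNIV) (\<lambda>(t,x). pr (u t x) (v t x))"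
    by (simp add: case_prod_beta)
  have "\<exists>B. \<forall>t\<in>{0..T}. \<forall>x. norm (pr (u t x) (v t x)) \<le> B" for T
  proof -
    obtain A B where A: "\<forall>t\<in>{0..T}. \<forall>x. norm (u t x) \<le> A" and B: "\<forall>t\<in>{0..T}. \<forall>x. norm (v t x) \<le> B"
      using assms unfolding locally_bounded_cont_def by meson
    have "norm (pr (u t x) (v t x)) \<le> A * B * K" if "t \<in> {0..T}" for t x
    proof -
      have "norm (u t x) * norm (v t x) \<le> A * B"
        by (intro mult_mono) (use A B that in \<open>auto intro: order_trans[OF norm_ge_zero[of "u t x"]]\<close>)
      then show ?thesis using K by (meson mult_right_mono order_trans)
    qed
    then show ?thesis by blast
  qed
  with c show ?thesis unfolding locally_bounded_cont_def by blast
qed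

lemma locally_bounded_cont_add:
  assumes "locally_bounded_cont u" "locally_bounded_cont v"
  shows "locally_bounded_cont (\<lambda>t x. u t x + v t x)"
proof -
  have "continuous_on ({0..} \<times> UNIV) (\<lambda>z. ((\<lambda>(t,x). u t x) z) + ((\<lambda>(t,x). v t x) z))"
    by (intro continuous_on_add) (use assms in \<open>auto simp: locally_bounded_cont_def\<close>)
  then have c: "continuous_on ({0..} \<times> UNIV) (\<lambda>(t,x). u t x + v t x)"
    by (simp add: case_prod_beta)
  have "\<exists>B. \<forall>t\<in>{0..T}. \<forall>x. norm (u t x + v t x) \<le> B" for T
  proof -
    obtain A B where "\<forall>t\<in>{0..T}. \<forall>x. norm (u t x) \<le> A" and "\<forall>t\<in>{0..T}. \<forall>x. norm (v t x) \<le> B"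
      using assms unfolding locally_bounded_cont_def by meson
    then show ?thesis by (intro exI[of _ "A + B"]) (meson norm_triangle_le add_mono)
  qed
  with c show ?thesis unfolding locally_bounded_cont_def by blast
qed

lemma Ck_bounded_add: "Ck_bounded k u \<Longrightarrow> Ck_bounded k v \<Longrightarrow> Ck_bounded k (\<lambda>t x. u t x + v t x)"
proof (induction k arbitrary: u v)
  case 0 then show ?case by (simp add: locally_bounded_cont_add)
next
  case (Suc k)
  from Suc.prems(1) obtain ut ux where h: "has_partials u ut ux" "Ck_bounded k ut" "Ck_bounded k ux" "locally_bounded_cont u"
    by auto
  from Suc.prems(2) obtain vt vx where g: "has_partials v vt vx" "Ck_bounded k vt" "Ck_bounded k vx" "locally_bounded_cont v"
    by auto
  have "has_partials (\<lambda>t x. u t x + v t x) (\<lambda>t x. ut t x + vt t x) (\<lambda>t x. ux t x + vx t x)"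
    using h(1) g(1) unfolding has_partials_def by (auto intro: has_vector_derivative_add)
  with h g show ?case by (auto intro!: exI Suc.IH locally_bounded_cont_add)
qed

lemma Ck_bounded_bilinear:
  assumes "bounded_bilinear pr"
  shows "Ck_bounded k u \<Longrightarrow> Ck_bounded k v \<Longrightarrow> Ck_bounded k (\<lambda>t x. pr (u t x) (v t x))"
proof (induction k arbitrary: u v)
  case 0 then show ?case using assms by (simp add: locally_bounded_cont_bilinear)
next
  case (Suc k)
  from Suc.prems(1) obtain ut ux where h: "has_partials u ut ux" "Ck_bounded k ut" "Ck_bounded k ux" "locally_bounded_cont u"
    by auto
  from Suc.prems(2) obtain vt vx where g: "has_partials v vt vx" "Ck_bounded k vt" "Ck_bounded k vx" "locally_bounded_cont v"
    by auto
  have k: "Ck_bounded k u" "Ck_bounded k v" using Suc.prems Ck_bounded_Suc_D by auto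
  have p: "has_partials (\<lambda>t x. pr (u t x) (v t x)) (\<lambda>t x. pr (u t x) (vt t x) + pr (ut t x) (v t x))
      (\<lambda>t x. pr (u t x) (vx t x) + pr (ux t x) (v t x))"
    using h(1) g(1) unfolding has_partials_def by (auto intro: bounded_bilinear.has_vector_derivative[OF assms])
  have "Ck_bounded k (\<lambda>t x. pr (u t x) (vt t x) + pr (ut t x) (v t x))" "Ck_bounded k (\<lambda>t x. pr (u t x) (vx t x) + pr (ux t x) (v t x))"
    by (intro Ck_bounded_add Suc.IH h g k)+
  with p h g show ?case using locally_bounded_cont_bilinear[OF assms] by auto
qed

lemma Ck_bounded_const: "Ck_bounded k (\<lambda>t x. c)"
proof (induction k arbitrary: c)
  case 0 then show ?case by (auto simp: locally_bounded_cont_def Ck_bounded.simps(1))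
next
  case (Suc k)
  have "has_partials (\<lambda>t x. c) (\<lambda>t x. 0) (\<lambda>t x. 0)" by (auto simp: has_partials_def)
  then show ?case using Suc by (auto simp: locally_bounded_cont_def)
qed

lemma bsmooth_const [simp, intro]: "bsmooth (\<lambda>t x. c)"
  by (simp add: bsmooth_def Ck_bounded_const)

lemma bsmooth_add [intro]: "bsmooth u \<Longrightarrow> bsmooth v \<Longrightarrow> bsmooth (\<lambda>t x. u t x + v t x)"
  by (simp add: bsmooth_def Ck_bounded_add)

lemma bsmooth_scaleR [intro]:
  "bsmooth u \<Longrightarrow> bsmooth v \<Longrightarrow> bsmooth (\<lambda>t x. u t x *\<^sub>R v t x)"
  by (simp add: bsmooth_def Ck_bounded_bilinear[OF bounded_bilinear_scaleR])

lemma bsmooth_mult [intro]: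
  fixes u :: "real \<Rightarrow> real \<Rightarrow> real"
  shows "bsmooth u \<Longrightarrow> bsmooth v \<Longrightarrow> bsmooth (\<lambda>t x. u t x * v t x)"
  by (simp add: bsmooth_def Ck_bounded_bilinear[OF bounded_bilinear_mult])

lemma bsmooth_inner [intro]:
  fixes u :: "real \<Rightarrow> real \<Rightarrow> 'a::real_inner"
  shows "bsmooth u \<Longrightarrow> bsmooth v \<Longrightarrow> bsmooth (\<lambda>t x. u t x \<bullet> v t x)"
  by (simp add: bsmooth_def Ck_bounded_bilinear[OF bounded_bilinear_inner])

lemma bsmooth_uminus [intro]: "bsmooth u \<Longrightarrow> bsmooth (\<lambda>t x. - u t x)"
  using bsmooth_scaleR[of "\<lambda>t x. -1" u] by simp

lemma bsmooth_diff [intro]: "bsmooth u \<Longrightarrow> bsmooth v \<Longrightarrow> bsmooth (\<lambda>t x. u t x - v t x)"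
  using bsmooth_add[OF _ bsmooth_uminus, of u v] by simp

lemma bsmooth_power2 [intro]:
  fixes u :: "real \<Rightarrow> real \<Rightarrow> real"
  shows "bsmooth u \<Longrightarrow> bsmooth (\<lambda>t x. (u t x)\<^sup>2)"
  by (simp add: power2_eq_square bsmooth_mult)

lemma bsmooth_deriv:
  assumes "bsmooth u" "t \<ge> 0"
  shows "((\<lambda>\<tau>. u \<tau> x) has_vector_derivative Dt u t x) (at t within {0..})"
    and "(u t has_vector_derivative Dx u t x) (at x)"
proof -
  from assms(1) have "Ck_bounded (Suc 0) u" by (simp add: bsmooth_def)
  then obtain ut ux where h: "has_partials u ut ux" "Ck_bounded 0 ut" "Ck_bounded 0 ux" "locally_bounded_cont u"
    by auto
  show "((\<lambda>\<tau>. u \<tau> x) has_vector_derivative Dt u t x) (at t within {0..})"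
    using has_partials_t[OF h(1) assms(2)] Dt_eqI[OF assms(2) has_partials_t[OF h(1) assms(2)]] by simp
  have "(u t has_vector_derivative ux t x) (at x)" using has_partials_x[OF h(1) assms(2)] .
  then show "(u t has_vector_derivative Dx u t x) (at x)"
    using Dx_eqI[of u t "ux t x" x] by simp
qed

lemma bsmooth_Dt [intro]: assumes "bsmooth u" shows "bsmooth (Dt u)"
  unfolding bsmooth_def
proof
  fix k
  from assms have "Ck_bounded (Suc k) u" by (simp add: bsmooth_def)
  then obtain ut ux where h: "has_partials u ut ux" "Ck_bounded k ut" "Ck_bounded k ux" "locally_bounded_cont u"
    by auto
  show "Ck_bounded k (Dt u)" by (rule Ck_bounded_cong[OF _ h(2)]) (simp add: Dt_eqI[OF _ has_partials_t[OF h(1)]])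
qed

lemma bsmooth_Dx [intro]: assumes "bsmooth u" shows "bsmooth (Dx u)"
  unfolding bsmooth_def
proof
  fix k
  from assms have "Ck_bounded (Suc k) u" by (simp add: bsmooth_def)
  then obtain ut ux where h: "has_partials u ut ux" "Ck_bounded k ut" "Ck_bounded k ux" "locally_bounded_cont u"
    by auto
  show "Ck_bounded k (Dx u)" by (rule Ck_bounded_cong[OF _ h(3)]) (use Dx_eqI has_partials_x[OF h(1)] in metis)
qed

lemma bsmooth_locally_bounded_cont: "bsmooth u \<Longrightarrow> locally_bounded_cont u"
  unfolding bsmooth_def by (auto intro: Ck_bounded_imp_locally_bounded_cont)

lemma bsmooth_cont: "bsmooth u \<Longrightarrow> continuous_on ({0..} \<times> UNIV) (\<lambda>(t, x). u t x)"
  using bsmooth_locally_bounded_cont locally_bounded_cont_def by blast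

lemma bsmooth_bound:
  assumes "bsmooth u"
  obtains B where "B \<ge> 1" "\<And>t x. 0 \<le> t \<Longrightarrow> t \<le> T \<Longrightarrow> norm (u t x) \<le> B"
proof -
  obtain B where "\<forall>t\<in>{0..T}. \<forall>x. norm (u t x) \<le> B"
    using bsmooth_locally_bounded_cont[OF assms] unfolding locally_bounded_cont_def by meson
  then show ?thesis by (intro that[of "max B 1"]) (auto simp: le_max_iff_disj)
qed

lemma cont_slice:
  assumes "continuous_on ({0..} \<times> UNIV) (\<lambda>(t, x). u t x)" "t \<ge> 0"
  shows "continuous_on A (u t)"
proof -
  have "continuous_on A (\<lambda>x. (\<lambda>(t, x). u t x) (t, x))"
    by (rule continuous_on_compose2[OF assms(1)]) (use assms(2) in \<open>auto intro!: continuous_intros\<close>)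
  then show ?thesis by simp
qed

lemma bsmooth_cont_x: "bsmooth u \<Longrightarrow> t \<ge> 0 \<Longrightarrow> continuous_on A (u t)"
  by (rule cont_slice[OF bsmooth_cont])

text \<open>
  Differentiating \<open>u t b - u t a = \<integral>\<^sub>a\<^sup>b \<partial>\<^sub>x u\<close> under the integral sign shows that \<open>\<partial>\<^sub>t u\<close> is an antiderivative in \<open>x\<close>
  of the continuous function \<open>\<partial>\<^sub>t\<partial>\<^sub>x u\<close>. The existence of \<open>\<partial>\<^sub>x\<partial>\<^sub>t u\<close> is part of the conclusion.
\<close>

lemma mixed_partials:
  fixes u :: "real \<Rightarrow> real \<Rightarrow> 'a::banach"
  assumes ut: "\<And>t x. t \<ge> 0 \<Longrightarrow> ((\<lambda>\<tau>. u \<tau> x) has_vector_derivative ut t x) (at t within {0..})"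
    and ux: "\<And>t x. t \<ge> 0 \<Longrightarrow> (u t has_vector_derivative ux t x) (at x)"
    and uxt: "\<And>t x. t \<ge> 0 \<Longrightarrow> ((\<lambda>\<tau>. ux \<tau> x) has_vector_derivative uxt t x) (at t within {0..})"
    and cx: "continuous_on ({0..} \<times> UNIV) (\<lambda>(t, x). ux t x)"
    and cxt: "continuous_on ({0..} \<times> UNIV) (\<lambda>(t, x). uxt t x)"
    and t: "t \<ge> 0"
  shows "(ut t has_vector_derivative uxt t x) (at x)"
proof -
  have FTC: "integral (cbox a b) (ux s) = u s b - u s a" if "a \<le> b" "s \<ge> 0" for a b s
    by (intro integral_unique) (use fundamental_theorem_of_calculus[OF that(1), of "u s" "ux s"] ux[OF that(2)]
       in \<open>auto intro: has_vector_derivative_at_within\<close>)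
  have key: "ut t b = ut t a + integral {a..b} (uxt t)" if "a \<le> b" for a b
  proof -
    have 1: "((\<lambda>s. integral (cbox a b) (ux s)) has_vector_derivative integral (cbox a b) (uxt t)) (at t within {0..})"
      by (rule leibniz_rule_vector_derivative)
        (use uxt t in \<open>auto intro!: integrable_continuous_real cont_slice[OF cx] continuous_on_subset[OF cxt]\<close>)
    have 2: "((\<lambda>s. u s b - u s a) has_vector_derivative ut t b - ut t a) (at t within {0..})"
      by (intro has_vector_derivative_diff ut t)
    have "((\<lambda>s. u s b - u s a) has_vector_derivative integral (cbox a b) (uxt t)) (at t within {0..})"
      by (rule has_vector_derivative_transform[OF _ _ 1]) (use t FTC that in auto)
    from vector_derivative_unique_within[OF within_nonneg_not_bot[OF t] this 2]
    show ?thesis by (simp add: algebra_simps)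
  qed
  have c: "continuous_on {x-1..x+1} (uxt t)" by (rule cont_slice[OF cxt t])
  have "((\<lambda>b. ut t (x-1) + integral {x-1..b} (uxt t)) has_vector_derivative uxt t x) (at x within {x-1..x+1})"
    using integral_has_vector_derivative[OF c, of x]
    by (auto intro!: derivative_eq_intros)
  then have "(ut t has_vector_derivative uxt t x) (at x within {x-1..x+1})"
    by (rule has_vector_derivative_transform[rotated 2]) (use key in auto)
  moreover have "at x within {x-1..x+1} = at x"
    by (rule at_within_interior) auto
  ultimately show ?thesis by simp
qed

lemma bsmooth_commute:
  fixes u :: "real \<Rightarrow> real \<Rightarrow> 'a::banach"
  assumes "bsmooth u" "t \<ge> 0"
  shows "Dx (Dt u) t x = Dt (Dx u) t x"
proof -
  have x: "bsmooth (Dx u)" and xt: "bsmooth (Dt (Dx u))" using assms(1) by auto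
  show ?thesis
    by (rule Dx_eqI, rule mixed_partials[OF bsmooth_deriv(1)[OF assms(1)] bsmooth_deriv(2)[OF assms(1)]
        bsmooth_deriv(1)[OF x] bsmooth_cont[OF x] bsmooth_cont[OF xt] assms(2)])
qed


text \<open>
  Both derivatives of \<open>r = 1/\<surd>q\<close> have the form \<open>-1/2 q' r\<^sup>3\<close>, so each step of the induction only needs the previous order of \<open>r\<close>.
  With \<open>q = \<bar>\<partial>\<^sub>x\<gamma>\<bar>\<^sup>2\<close> this controls the factor in the arclength derivative.
\<close>

lemma Ck_bounded_inverse_sqrt:
  fixes q :: "real \<Rightarrow> real \<Rightarrow> real"
  assumes q: "bsmooth q" and pos: "\<And>T. T > 0 \<Longrightarrow> \<exists>c>0. \<forall>t\<in>{0..T}. \<forall>x. c \<le> q t x"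
  shows "Ck_bounded k (\<lambda>t x. 1 / sqrt (q t x))"
proof -
  have qpos: "q t x > 0" if "t \<ge> 0" for t x
  proof -
    have "t + 1 > 0" using that by simp
    from pos[OF this] obtain c where "c > 0" "\<forall>s\<in>{0..t+1}. \<forall>x. c \<le> q s x" by blast
    then have "c > 0" "c \<le> q t x" using that by auto
    then show ?thesis by linarith
  qed
  have c: "continuous_on ({0..} \<times> UNIV) (\<lambda>z. 1 / sqrt ((\<lambda>(t,x). q t x) z))"
    by (intro continuous_intros bsmooth_cont q) (clarsimp, metis less_irrefl qpos)
  have lbc: "locally_bounded_cont (\<lambda>t x. 1 / sqrt (q t x))"
    unfolding locally_bounded_cont_def
  proof (intro conjI allI)
    show "continuous_on ({0..} \<times> UNIV) (\<lambda>(t, x). 1 / sqrt (q t x))"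
      using c by (simp add: case_prod_beta)
    fix T :: real
    have "max T 1 > 0" by (simp add: less_max_iff_disj)
    from pos[OF this] obtain c where "c > 0" and c: "\<forall>t\<in>{0..max T 1}. \<forall>x. c \<le> q t x" by blast
    then have "1 / sqrt (q t x) \<le> 1 / sqrt c" if "t \<in> {0..T}" for t x
      using that by (intro divide_left_mono real_sqrt_le_mono mult_pos_pos) (auto simp: qpos)
    then show "\<exists>B. \<forall>t\<in>{0..T}. \<forall>x. norm (1 / sqrt (q t x)) \<le> B"
      by (intro exI[of _ "1 / sqrt c"]) (use qpos in \<open>auto simp: less_imp_le\<close>)
  qed
  show ?thesis
  proof (induction k)
    case 0 show ?case using lbc by (simp)
  next
    case (Suc k)
    let ?r = "\<lambda>t x. 1 / sqrt (q t x)"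
    let ?d = "\<lambda>p t x. (- 1/2) * (p t x * (?r t x * (?r t x * ?r t x)))"
    have dr: "((\<lambda>y. 1 / sqrt y) has_real_derivative (- 1/2) * (1 / sqrt y * (1 / sqrt y * (1 / sqrt y)))) (at y)"
      if "y > 0" for y
      using that
      by (auto intro!: derivative_eq_intros simp: field_simps power2_eq_square)
    have t: "((\<lambda>\<tau>. ?r \<tau> x) has_vector_derivative ?d (Dt q) t x) (at t within {0..})" if "t \<ge> 0" for t x
    proof -
      have "((\<lambda>\<tau>. q \<tau> x) has_real_derivative Dt q t x) (at t within {0..})"
        using bsmooth_deriv(1)[OF q that] by (simp add: has_real_derivative_iff_has_vector_derivative)
      from DERIV_chain2[OF dr[OF qpos[OF that]] this] show ?thesis
        by (simp add: has_real_derivative_iff_has_vector_derivative algebra_simps)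
    qed
    have x: "(?r t has_vector_derivative ?d (Dx q) t x) (at x)" if "t \<ge> 0" for t x
    proof -
      have "(q t has_real_derivative Dx q t x) (at x)"
        using bsmooth_deriv(2)[OF q that] by (simp add: has_real_derivative_iff_has_vector_derivative)
      from DERIV_chain2[OF dr[OF qpos[OF that]] this] show ?thesis
        by (simp add: has_real_derivative_iff_has_vector_derivative algebra_simps)
    qed
    have "Ck_bounded k (Dt q)" "Ck_bounded k (Dx q)" using bsmooth_Dt[OF q] bsmooth_Dx[OF q] by (auto simp: bsmooth_def)
    moreover have "Ck_bounded k (?d p)" if "Ck_bounded k p" for p
      by (intro Ck_bounded_bilinear[OF bounded_bilinear_mult] Suc Ck_bounded_const that)
    moreover have "has_partials ?r (?d (Dt q)) (?d (Dx q))" using t x by (simp add: has_partials_def)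
    ultimately show ?case using lbc unfolding Ck_bounded.simps by blast
  qed
qed

section \<open>Regularity of an elastic flow\<close>

text \<open>
  In \<open>partial_tx\<close> the time derivatives are applied last. Total differentiability yields all one-variable derivatives,
  and an induction on the number of time derivatives with \<open>mixed_partials\<close> identifies a further \<open>x\<close>-derivative.
\<close>

lemma smooth_family_partials:
  fixes \<gamma> :: "real \<Rightarrow> real \<Rightarrow> 'a::banach"
  assumes sm: "smooth_family {0..} \<gamma>" and t: "t \<ge> 0"
  shows "continuous_on ({0..} \<times> UNIV) (\<lambda>(t, x). partial_tx {0..} \<alpha> \<beta> \<gamma> t x)"
    and "((\<lambda>\<tau>. partial_tx {0..} \<alpha> \<beta> \<gamma> \<tau> x) has_vector_derivative partial_tx {0..} (Suc \<alpha>) \<beta> \<gamma> t x) (at t within {0..})"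
    and "(partial_tx {0..} \<alpha> \<beta> \<gamma> t has_vector_derivative partial_tx {0..} \<alpha> (Suc \<beta>) \<gamma> t x) (at x)"
proof -
  let ?P = "\<lambda>\<alpha> \<beta>. partial_tx {0..} \<alpha> \<beta> \<gamma>"
  have d: "(\<lambda>(t, x). ?P \<alpha> \<beta> t x) differentiable_on ({0..} \<times> UNIV)" for \<alpha> \<beta>
    using sm by (simp add: smooth_family_def)
  have c: "continuous_on ({0..} \<times> UNIV) (\<lambda>(t, x). ?P \<alpha> \<beta> t x)" for \<alpha> \<beta>
    by (rule differentiable_imp_continuous_on[OF d])
  have dt: "((\<lambda>\<tau>. ?P \<alpha> \<beta> \<tau> x) has_vector_derivative ?P (Suc \<alpha>) \<beta> t x) (at t within {0..})" if "t \<ge> 0" for \<alpha> \<beta> t x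
  proof -
    have "((\<lambda>(t, x). ?P \<alpha> \<beta> t x) \<circ> (\<lambda>\<tau>. (\<tau>, x))) differentiable (at t within {0..})"
    proof (rule differentiable_chain_within)
      show "(\<lambda>\<tau>. (\<tau>, x)) differentiable (at t within {0..})"
        by (auto intro!: derivative_eq_intros simp: differentiable_def exI)
      have "(\<lambda>(t, x). ?P \<alpha> \<beta> t x) differentiable (at (t, x) within {0..} \<times> UNIV)"
        using d[of \<alpha> \<beta>] that by (auto simp: differentiable_on_def)
      then show "(\<lambda>(t, x). ?P \<alpha> \<beta> t x) differentiable (at (t, x) within (\<lambda>\<tau>. (\<tau>, x)) ` {0..})"
        by (rule differentiable_within_subset) auto
    qed
    then have "(\<lambda>\<tau>. ?P \<alpha> \<beta> \<tau> x) differentiable (at t within {0..})" by (simp add: o_def)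
    then show ?thesis
      by (simp add: vector_derivative_works partial_tx_def partial_t_def)
  qed
  have dx0: "?P \<alpha> \<beta> t differentiable (at x)" if "t \<ge> 0" for \<alpha> \<beta> t x
  proof -
    have "((\<lambda>(t, x). ?P \<alpha> \<beta> t x) \<circ> (\<lambda>x. (t, x))) differentiable (at x within UNIV)"
    proof (rule differentiable_chain_within)
      show "(\<lambda>x. (t, x)) differentiable (at x within UNIV)"
        by (auto intro!: derivative_eq_intros simp: differentiable_def exI)
      have "(\<lambda>(t, x). ?P \<alpha> \<beta> t x) differentiable (at (t, x) within {0..} \<times> UNIV)"
        using d[of \<alpha> \<beta>] that by (auto simp: differentiable_on_def)
      then show "(\<lambda>(t, x). ?P \<alpha> \<beta> t x) differentiable (at (t, x) within (\<lambda>x. (t, x)) ` UNIV)"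
        by (rule differentiable_within_subset) (use that in auto)
    qed
    then show ?thesis by (simp add: o_def)
  qed
  have dx: "(?P \<alpha> \<beta> t has_vector_derivative ?P \<alpha> (Suc \<beta>) t x) (at x)" if "t \<ge> 0" for \<alpha> \<beta> t x
    using that
  proof (induction \<alpha> arbitrary: t x)
    case 0
    have "(?P 0 \<beta> t has_vector_derivative vderiv (?P 0 \<beta> t) x) (at x)"
      using dx0[OF 0] by (simp add: vderiv_def vector_derivative_works)
    then show ?case by (simp add: partial_tx_def partial_x_def)
  next
    case (Suc \<alpha>)
    show ?case
      by (rule mixed_partials[OF dt Suc.IH dt c c Suc.prems])
  qed
  show "continuous_on ({0..} \<times> UNIV) (\<lambda>(t, x). partial_tx {0..} \<alpha> \<beta> \<gamma> t x)"
    "((\<lambda>\<tau>. partial_tx {0..} \<alpha> \<beta> \<gamma> \<tau> x) has_vector_derivative partial_tx {0..} (Suc \<alpha>) \<beta> \<gamma> t x) (at t within {0..})"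
    "(partial_tx {0..} \<alpha> \<beta> \<gamma> t has_vector_derivative partial_tx {0..} \<alpha> (Suc \<beta>) \<gamma> t x) (at x)"
    using c dt[OF t] dx[OF t] by auto
qed

lemma vderiv_eqI: "(f has_vector_derivative d) (at x) \<Longrightarrow> vderiv f x = d"
  by (simp add: vderiv_def vector_derivative_at)

lemma homogeneous_C_inf_deriv:
  assumes "homogeneous_C_inf f"
  shows "((vderiv ^^ j) f has_vector_derivative (vderiv ^^ Suc j) f x) (at x)"
proof -
  have "(vderiv ^^ j) f differentiable_on UNIV"
    using assms unfolding homogeneous_C_inf_def C_k_def by blast
  then show ?thesis by (simp add: differentiable_on_def vderiv_def vector_derivative_works)
qed

text \<open>
  One-sided derivatives are unique, so derivatives within \<open>[0, T]\<close> and within \<open>[0, \<infinity>)\<close> agree on \<open>[0, T]\<close>. The bounds for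
  \<open>\<gamma> - \<gamma>0\<close> on a strip thereby become bounds for every derivative of \<open>\<gamma>\<close> of positive order.
\<close>

lemma partial_tx_difference:
  fixes \<gamma> :: "real \<Rightarrow> real \<Rightarrow> 'a::banach"
  assumes sm: "smooth_family {0..} \<gamma>" and \<gamma>0: "homogeneous_C_inf \<gamma>0" and T: "T > 0"
    and t: "t \<in> {0..T}"
  shows "partial_tx {0..T} 0 \<beta> (\<lambda>t x. \<gamma> t x - \<gamma>0 x) t x = partial_tx {0..} 0 \<beta> \<gamma> t x - (vderiv ^^ \<beta>) \<gamma>0 x"
    and "partial_tx {0..T} (Suc \<alpha>) \<beta> (\<lambda>t x. \<gamma> t x - \<gamma>0 x) t x = partial_tx {0..} (Suc \<alpha>) \<beta> \<gamma> t x"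
proof -
  let ?P = "\<lambda>\<alpha> \<beta>. partial_tx {0..} \<alpha> \<beta> \<gamma>"
  let ?Q = "\<lambda>\<alpha> \<beta>. partial_tx {0..T} \<alpha> \<beta> (\<lambda>t x. \<gamma> t x - \<gamma>0 x)"
  have nb: "at s within {0..T} \<noteq> bot" if "s \<in> {0..T}" for s
    using T that by (simp add: trivial_limit_within islimpt_Icc)
  have A: "?Q 0 \<beta> t x = ?P 0 \<beta> t x - (vderiv ^^ \<beta>) \<gamma>0 x" if "t \<in> {0..T}" for t x \<beta>
    using that
  proof (induction \<beta> arbitrary: t x)
    case 0 then show ?case by (simp add: partial_tx_def)
  next
    case (Suc \<beta>)
    have "?Q 0 (Suc \<beta>) t x = vderiv (?Q 0 \<beta> t) x" by (simp add: partial_tx_def partial_x_def)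
    also have "?Q 0 \<beta> t = (\<lambda>x. ?P 0 \<beta> t x - (vderiv ^^ \<beta>) \<gamma>0 x)" using Suc by auto
    also have "vderiv \<dots> x = ?P 0 (Suc \<beta>) t x - (vderiv ^^ Suc \<beta>) \<gamma>0 x"
      by (intro vderiv_eqI has_vector_derivative_diff
          homogeneous_C_inf_deriv[OF \<gamma>0] smooth_family_partials(3)[OF sm]) (use Suc in auto)
    finally show ?case .
  qed
  have B: "?Q (Suc \<alpha>) \<beta> t x = ?P (Suc \<alpha>) \<beta> t x" if "t \<in> {0..T}" for t x \<alpha> \<beta>
    using that
  proof (induction \<alpha> arbitrary: t x)
    case 0
    have "?Q (Suc 0) \<beta> t x = vector_derivative (\<lambda>\<tau>. ?Q 0 \<beta> \<tau> x) (at t within {0..T})"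
      by (simp add: partial_tx_def partial_t_def)
    also have "\<dots> = ?P (Suc 0) \<beta> t x"
    proof (rule vector_derivative_within[OF nb[OF 0]])
      have h: "((\<lambda>\<tau>. ?P 0 \<beta> \<tau> x - (vderiv ^^ \<beta>) \<gamma>0 x) has_vector_derivative ?P (Suc 0) \<beta> t x - 0) (at t within {0..T})"
        by (intro has_vector_derivative_diff has_vector_derivative_const
             has_vector_derivative_within_subset[OF smooth_family_partials(2)[OF sm]]) (use 0 in auto)
      show "((\<lambda>\<tau>. ?Q 0 \<beta> \<tau> x) has_vector_derivative ?P (Suc 0) \<beta> t x) (at t within {0..T})"
        by (rule has_vector_derivative_transform[OF 0 _ h[unfolded diff_zero]]) (rule A)
    qed
    finally show ?case .
  next
    case (Suc \<alpha>)
    have "?Q (Suc (Suc \<alpha>)) \<beta> t x = vector_derivative (\<lambda>\<tau>. ?Q (Suc \<alpha>) \<beta> \<tau> x) (at t within {0..T})"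
      by (simp add: partial_tx_def partial_t_def)
    also have "\<dots> = ?P (Suc (Suc \<alpha>)) \<beta> t x"
    proof (rule vector_derivative_within[OF nb[OF Suc.prems]])
      have h: "((\<lambda>\<tau>. ?P (Suc \<alpha>) \<beta> \<tau> x) has_vector_derivative ?P (Suc (Suc \<alpha>)) \<beta> t x) (at t within {0..T})"
        by (intro has_vector_derivative_within_subset[OF smooth_family_partials(2)[OF sm]]) (use Suc in auto)
      show "((\<lambda>\<tau>. ?Q (Suc \<alpha>) \<beta> \<tau> x) has_vector_derivative ?P (Suc (Suc \<alpha>)) \<beta> t x) (at t within {0..T})"
        by (rule has_vector_derivative_transform[OF Suc.prems _ h]) (rule Suc.IH)
    qed
    finally show ?case .
  qed
  show "?Q 0 \<beta> t x = ?P 0 \<beta> t x - (vderiv ^^ \<beta>) \<gamma>0 x" "?Q (Suc \<alpha>) \<beta> t x = ?P (Suc \<alpha>) \<beta> t x"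
    using A[OF t] B[OF t] by auto
qed

text \<open>
  The analytic content of \<open>elastic_flow\<close>. The curves themselves are unbounded, which is why smoothness is recorded for the
  two first derivatives of \<open>\<gamma>\<close>.
\<close>

locale bounded_flow =
  fixes \<gamma> :: "real \<Rightarrow> real \<Rightarrow> 'a::euclidean_space"
  assumes smooth_x: "bsmooth (Dx \<gamma>)" and smooth_t: "bsmooth (Dt \<gamma>)"
    and deriv_t: "\<And>t x. t \<ge> 0 \<Longrightarrow> ((\<lambda>\<tau>. \<gamma> \<tau> x) has_vector_derivative Dt \<gamma> t x) (at t within {0..})"
    and deriv_x: "\<And>t x. t \<ge> 0 \<Longrightarrow> (\<gamma> t has_vector_derivative Dx \<gamma> t x) (at x)"
    and speed_lower: "\<And>T. T > 0 \<Longrightarrow> \<exists>c>0. \<forall>t\<in>{0..T}. \<forall>x. c \<le> norm (Dx \<gamma> t x)"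
    and flow: "\<And>t x. t \<ge> 0 \<Longrightarrow> Dt \<gamma> t x =
        - (normal_deriv (\<gamma> t) ^^ 2) (curvature (\<gamma> t)) x
        - (1/2 * (norm (curvature (\<gamma> t) x))\<^sup>2) *\<^sub>R curvature (\<gamma> t) x
        + curvature (\<gamma> t) x"

theorem elastic_flow_bounded_flow:
  fixes \<gamma> :: "real \<Rightarrow> real \<Rightarrow> 'a::euclidean_space"
  assumes \<gamma>0: "homogeneous_C_inf \<gamma>\<^sub>0" and fl: "elastic_flow \<gamma>\<^sub>0 \<gamma>"
  shows "bounded_flow \<gamma>"
proof -
  let ?P = "\<lambda>\<alpha> \<beta>. partial_tx {0..} \<alpha> \<beta> \<gamma>"
  have sm: "smooth_family {0..} \<gamma>" using fl by (simp add: elastic_flow_def)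
  have bd: "\<exists>B. \<forall>t\<in>{0..T}. \<forall>x. norm (?P \<alpha> \<beta> t x) \<le> B" if ne: "\<alpha> > 0 \<or> \<beta> > 0" for \<alpha> \<beta> T
  proof -
    \<comment> \<open>Only positive end points are covered by the assumptions on the flow.\<close>
    define T' where "T' = max T 1"
    have T': "T' > 0" "T \<le> T'" by (auto simp: T'_def)
    have "C_inf_bounded {0..T'} (\<lambda>t x. \<gamma> t x - \<gamma>\<^sub>0 x)" using fl T' by (simp add: elastic_flow_def)
    then have "bounded ((\<lambda>(t, x). partial_tx {0..T'} \<alpha> \<beta> (\<lambda>t x. \<gamma> t x - \<gamma>\<^sub>0 x) t x) ` ({0..T'} \<times> UNIV))"
      by (simp add: C_inf_bounded_def)
    then obtain B where B0: "\<forall>z\<in>{0..T'} \<times> UNIV. norm ((\<lambda>(t, x). partial_tx {0..T'} \<alpha> \<beta> (\<lambda>t x. \<gamma> t x - \<gamma>\<^sub>0 x) t x) z) \<le> B"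
      unfolding bounded_iff by blast
    have B: "norm (partial_tx {0..T'} \<alpha> \<beta> (\<lambda>t x. \<gamma> t x - \<gamma>\<^sub>0 x) t x) \<le> B" if "t \<in> {0..T'}" for t x
      using bspec[OF B0, of "(t, x)"] that by simp
    show ?thesis
    proof (cases \<alpha>)
      case 0
      then have "\<beta> \<ge> 1" using ne by auto
      then have "bounded (range ((vderiv ^^ \<beta>) \<gamma>\<^sub>0))" using \<gamma>0 by (simp add: homogeneous_C_inf_def)
      then obtain C where C: "norm ((vderiv ^^ \<beta>) \<gamma>\<^sub>0 x) \<le> C" for x unfolding bounded_iff by blast
      have "norm (?P \<alpha> \<beta> t x) \<le> B + C" if "t \<in> {0..T}" for t x
      proof -
        have t: "t \<in> {0..T'}" using that T' by auto
        have "?P \<alpha> \<beta> t x = partial_tx {0..T'} \<alpha> \<beta> (\<lambda>t x. \<gamma> t x - \<gamma>\<^sub>0 x) t x + (vderiv ^^ \<beta>) \<gamma>\<^sub>0 x"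
          unfolding 0 partial_tx_difference(1)[OF sm \<gamma>0 T'(1) t] by (rule diff_add_cancel[symmetric])
        also have "norm \<dots> \<le> B + C" by (rule norm_triangle_le[OF add_mono[OF B[OF t] C]])
        finally show ?thesis .
      qed
      then show ?thesis by blast
    next
      case (Suc \<alpha>')
      have "norm (?P \<alpha> \<beta> t x) \<le> B" if "t \<in> {0..T}" for t x
      proof -
        have t: "t \<in> {0..T'}" using that T' by auto
        show ?thesis
          using B[OF t, of x] partial_tx_difference(2)[OF sm \<gamma>0 T'(1) t, of \<alpha>' \<beta> x] unfolding Suc by simp
      qed
      then show ?thesis by blast
    qed
  qed
  have bs: "Ck_bounded k (?P \<alpha> \<beta>)" if "\<alpha> > 0 \<or> \<beta> > 0" for k \<alpha> \<beta>
    using that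
  proof (induction k arbitrary: \<alpha> \<beta>)
    case 0
    then show ?case using bd smooth_family_partials(1)[OF sm order_refl] by (simp add: locally_bounded_cont_def)
  next
    case (Suc k)
    have "has_partials (?P \<alpha> \<beta>) (?P (Suc \<alpha>) \<beta>) (?P \<alpha> (Suc \<beta>))"
      using smooth_family_partials(2,3)[OF sm] by (simp add: has_partials_def)
    moreover have "locally_bounded_cont (?P \<alpha> \<beta>)"
      using bd[OF Suc.prems] smooth_family_partials(1)[OF sm order_refl] by (simp add: locally_bounded_cont_def)
    ultimately show ?case using Suc.IH by auto
  qed
  have P01: "?P 0 (Suc 0) = Dx \<gamma>" and P10: "?P (Suc 0) 0 = Dt \<gamma>" and P00: "?P 0 0 = \<gamma>"
    by (simp_all add: partial_tx_def)
  show ?thesis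
  proof
    show "bsmooth (Dx \<gamma>)" "bsmooth (Dt \<gamma>)"
      using bs[of 0 "Suc 0"] bs[of "Suc 0" 0] unfolding P01 P10 bsmooth_def by auto
    show "((\<lambda>\<tau>. \<gamma> \<tau> x) has_vector_derivative Dt \<gamma> t x) (at t within {0..})" if "t \<ge> 0" for t x
      using smooth_family_partials(2)[OF sm that, of 0 0 x] unfolding P00 P10 .
    show "(\<gamma> t has_vector_derivative Dx \<gamma> t x) (at x)" if "t \<ge> 0" for t x
      using smooth_family_partials(3)[OF sm that, of 0 0 x] unfolding P00 P01 .
    show "\<exists>c>0. \<forall>t\<in>{0..T}. \<forall>x. c \<le> norm (Dx \<gamma> t x)" if "T > 0" for T
    proof (intro exI[of _ "INF (t, x)\<in>{0..T} \<times> UNIV. norm (Dx \<gamma> t x)"] conjI ballI allI)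
      show "0 < (INF (t, x)\<in>{0..T} \<times> UNIV. norm (Dx \<gamma> t x))"
        using fl that by (simp add: elastic_flow_def)
      fix t x assume "t \<in> {0..T}"
      then show "(INF (t, x)\<in>{0..T} \<times> UNIV. norm (Dx \<gamma> t x)) \<le> norm (Dx \<gamma> t x)"
        using cINF_lower[of "\<lambda>(t,x). norm (Dx \<gamma> t x)" "{0..T} \<times> UNIV" "(t,x)", OF bdd_belowI2[of _ 0]] by auto
    qed
    show "Dt \<gamma> t x = - (normal_deriv (\<gamma> t) ^^ 2) (curvature (\<gamma> t)) x
        - (1/2 * (norm (curvature (\<gamma> t) x))\<^sup>2) *\<^sub>R curvature (\<gamma> t) x
        + curvature (\<gamma> t) x" if "t \<ge> 0" for t x
      using fl that by (simp add: elastic_flow_def)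
  qed
qed

section \<open>Evolution equations\<close>

lemmas bsmooth_intros = bsmooth_const bsmooth_add bsmooth_diff bsmooth_uminus bsmooth_scaleR bsmooth_mult
  bsmooth_inner bsmooth_power2 bsmooth_Dt bsmooth_Dx

lemma Dt_bilinear:
  assumes "bounded_bilinear pr" "bsmooth f" "bsmooth g" "t \<ge> 0"
  shows "Dt (\<lambda>t x. pr (f t x) (g t x)) t x = pr (f t x) (Dt g t x) + pr (Dt f t x) (g t x)"
  by (intro Dt_eqI bounded_bilinear.has_vector_derivative[OF assms(1)] bsmooth_deriv assms)

lemma Dx_bilinear:
  assumes "bounded_bilinear pr" "bsmooth f" "bsmooth g" "t \<ge> 0"
  shows "Dx (\<lambda>t x. pr (f t x) (g t x)) t x = pr (f t x) (Dx g t x) + pr (Dx f t x) (g t x)"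
  by (intro Dx_eqI bounded_bilinear.has_vector_derivative[OF assms(1)] bsmooth_deriv assms)

lemmas Dt_inner = Dt_bilinear[OF bounded_bilinear_inner]
lemmas Dt_scaleR = Dt_bilinear[OF bounded_bilinear_scaleR]
lemmas Dt_mult = Dt_bilinear[OF bounded_bilinear_mult]

lemma Dt_cong: assumes "\<And>t x. t \<ge> 0 \<Longrightarrow> f t x = g t x" "t \<ge> 0" "bsmooth f" shows "Dt f t x = Dt g t x"
  by (rule Dt_eqI[symmetric, OF assms(2)], rule has_vector_derivative_cong_nonneg[OF assms(1,2)], assumption)
    (rule bsmooth_deriv(1)[OF assms(3,2)])

context bounded_flow
begin

definition speed :: "real \<Rightarrow> real \<Rightarrow> real" where "speed t x = norm (Dx \<gamma> t x)"

definition D :: "(real \<Rightarrow> real \<Rightarrow> 'b::real_normed_vector) \<Rightarrow> real \<Rightarrow> real \<Rightarrow> 'b" where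
  "D f t = arc_deriv (\<gamma> t) (f t)"

definition T :: "real \<Rightarrow> real \<Rightarrow> 'a" where "T t = tangent (\<gamma> t)"

definition K :: "real \<Rightarrow> real \<Rightarrow> 'a" where "K t = curvature (\<gamma> t)"

definition Nd :: "(real \<Rightarrow> real \<Rightarrow> 'a) \<Rightarrow> real \<Rightarrow> real \<Rightarrow> 'a" where
  "Nd f t = normal_deriv (\<gamma> t) (f t)"

text \<open>
  The normal derivatives \<open>\<nabla>\<^sub>s\<^sup>m \<kappa>\<close>; they satisfy simpler evolution equations than \<open>\<partial>\<^sub>s\<^sup>m \<kappa>\<close>.
\<close>

definition N :: "nat \<Rightarrow> real \<Rightarrow> real \<Rightarrow> 'a" where
  "N m t = (normal_deriv (\<gamma> t) ^^ m) (curvature (\<gamma> t))"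

definition perp :: "real \<Rightarrow> real \<Rightarrow> 'a \<Rightarrow> 'a" where
  "perp t x v = v - (v \<bullet> T t x) *\<^sub>R T t x"

text \<open>
  The normal time derivative \<open>\<nabla>\<^sub>t\<close>.
\<close>

definition Nt :: "(real \<Rightarrow> real \<Rightarrow> 'a) \<Rightarrow> real \<Rightarrow> real \<Rightarrow> 'a" where
  "Nt f t x = perp t x (Dt f t x)"

abbreviation V :: "real \<Rightarrow> real \<Rightarrow> 'a" where "V \<equiv> Dt \<gamma>"

definition normal_field :: "(real \<Rightarrow> real \<Rightarrow> 'a) \<Rightarrow> bool" where
  "normal_field f \<longleftrightarrow> (\<forall>t\<ge>0. \<forall>x. f t x \<bullet> T t x = 0)"

lemma D_eq: "D f t x = (1 / speed t x) *\<^sub>R Dx f t x"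
  by (simp add: D_def arc_deriv_def speed_def partial_x_def)

lemma T_eq: "T t x = (1 / speed t x) *\<^sub>R Dx \<gamma> t x"
  by (simp add: T_def tangent_def arc_deriv_def speed_def partial_x_def)

lemma K_eq: "K = D T"
  by (rule ext) (simp add: K_def D_def T_def curvature_def tangent_def numeral_2_eq_2)

lemma N_0: "N 0 = K" by (rule ext) (simp add: N_def K_def)

lemma N_Suc: "N (Suc m) = Nd (N m)" by (rule ext) (simp add: N_def Nd_def)

lemma Nd_eq: "Nd f t x = perp t x (D f t x)"
  by (simp add: Nd_def normal_deriv_def D_def perp_def T_def)

lemma speed_pos: assumes "t \<ge> 0" shows "speed t x > 0"
proof -
  have "t + 1 > 0" using assms by simp
  from speed_lower[OF this] obtain c where "c > 0" "\<forall>s\<in>{0..t+1}. \<forall>x. c \<le> norm (Dx \<gamma> s x)" by blast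
  then have "c > 0" "c \<le> norm (Dx \<gamma> t x)" using assms by auto
  then show ?thesis unfolding speed_def by linarith
qed

lemma bsmooth_inverse_speed: "bsmooth (\<lambda>t x. 1 / speed t x)"
proof -
  have "\<exists>c>0. \<forall>t\<in>{0..T}. \<forall>x. c \<le> Dx \<gamma> t x \<bullet> Dx \<gamma> t x" if T: "T > 0" for T
  proof -
    from speed_lower[OF T] obtain c where c: "c > 0" "\<forall>s\<in>{0..T}. \<forall>x. c \<le> norm (Dx \<gamma> s x)" by blast
    have "c\<^sup>2 \<le> Dx \<gamma> t x \<bullet> Dx \<gamma> t x" if "t \<in> {0..T}" for t x
      unfolding dot_square_norm using c that by (intro power_mono) auto
    then show ?thesis using c(1) by (intro exI[of _ "c\<^sup>2"]) auto
  qed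
  then have "bsmooth (\<lambda>t x. 1 / sqrt (Dx \<gamma> t x \<bullet> Dx \<gamma> t x))"
    unfolding bsmooth_def using Ck_bounded_inverse_sqrt[OF bsmooth_inner[OF smooth_x smooth_x]] by blast
  then show ?thesis by (simp add: speed_def norm_eq_sqrt_inner)
qed

lemma bsmooth_speed: "bsmooth speed"
proof (rule bsmooth_cong[of "\<lambda>t x. (Dx \<gamma> t x \<bullet> Dx \<gamma> t x) * (1 / speed t x)"])
  show "bsmooth (\<lambda>t x. (Dx \<gamma> t x \<bullet> Dx \<gamma> t x) * (1 / speed t x))"
    by (intro bsmooth_intros smooth_x bsmooth_inverse_speed)
  show "(Dx \<gamma> t x \<bullet> Dx \<gamma> t x) * (1 / speed t x) = speed t x" if "t \<ge> 0" for t x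
    using speed_pos[OF that, of x] by (simp add: speed_def dot_square_norm power2_eq_square)
qed

lemma bsmooth_D: "bsmooth f \<Longrightarrow> bsmooth (D f)"
  unfolding D_eq[abs_def] by (intro bsmooth_intros bsmooth_inverse_speed)

lemma bsmooth_T: "bsmooth T"
  unfolding T_eq[abs_def] by (intro bsmooth_intros bsmooth_inverse_speed smooth_x)

lemma bsmooth_K: "bsmooth K"
  unfolding K_eq by (intro bsmooth_D bsmooth_T)

lemma bsmooth_Nd: "bsmooth f \<Longrightarrow> bsmooth (Nd f)"
  unfolding Nd_eq[abs_def] perp_def by (intro bsmooth_intros bsmooth_D bsmooth_T)

lemma bsmooth_Nt: "bsmooth f \<Longrightarrow> bsmooth (Nt f)"
  unfolding Nt_def[abs_def] perp_def by (intro bsmooth_intros bsmooth_T)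

lemma bsmooth_N: "bsmooth (N m)"
  by (induction m) (simp_all add: N_0 N_Suc bsmooth_K bsmooth_Nd)

lemmas bs_intros = bsmooth_intros bsmooth_D bsmooth_T bsmooth_K bsmooth_Nd bsmooth_Nt bsmooth_N bsmooth_speed
  bsmooth_inverse_speed smooth_x smooth_t

lemma D_bilinear:
  assumes "bounded_bilinear pr" "bsmooth f" "bsmooth g" "t \<ge> 0"
  shows "D (\<lambda>t x. pr (f t x) (g t x)) t x = pr (f t x) (D g t x) + pr (D f t x) (g t x)"
proof -
  interpret bounded_bilinear pr by fact
  show ?thesis unfolding D_eq Dx_bilinear[OF assms]
    by (simp add: scaleR_left scaleR_right scaleR_add_right)
qed

lemmas D_inner = D_bilinear[OF bounded_bilinear_inner]
lemmas D_scaleR = D_bilinear[OF bounded_bilinear_scaleR]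
lemmas D_mult = D_bilinear[OF bounded_bilinear_mult]

lemma D_add:
  assumes "bsmooth f" "bsmooth g" "t \<ge> 0"
  shows "D (\<lambda>t x. f t x + g t x) t x = D f t x + D g t x"
proof -
  have "Dx (\<lambda>t x. f t x + g t x) t x = Dx f t x + Dx g t x"
    by (intro Dx_eqI has_vector_derivative_add bsmooth_deriv assms)
  then show ?thesis by (simp add: D_eq scaleR_add_right)
qed

lemma D_diff:
  assumes "bsmooth f" "bsmooth g" "t \<ge> 0"
  shows "D (\<lambda>t x. f t x - g t x) t x = D f t x - D g t x"
proof -
  have "Dx (\<lambda>t x. f t x - g t x) t x = Dx f t x - Dx g t x"
    by (intro Dx_eqI has_vector_derivative_diff bsmooth_deriv assms)
  then show ?thesis by (simp add: D_eq scaleR_diff_right)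
qed

lemma D_const [simp]: "D (\<lambda>t x. c) t x = 0"
  unfolding D_eq by (subst Dx_eqI[of _ _ 0]) auto

lemma D_cong: "(\<And>x. f t x = g t x) \<Longrightarrow> D f t x = D g t x"
  by (simp add: D_def ext[of "f t" "g t"])

lemma D_cscale: "bsmooth f \<Longrightarrow> t \<ge> 0 \<Longrightarrow> D (\<lambda>t x. c *\<^sub>R f t x) t x = c *\<^sub>R D f t x"
  using D_scaleR[of "\<lambda>t x. c" f t x] by simp

lemma Nd_cong: "(\<And>x. f t x = g t x) \<Longrightarrow> Nd f t x = Nd g t x"
  by (simp add: Nd_eq cong: D_cong)

lemma T_T: "t \<ge> 0 \<Longrightarrow> T t x \<bullet> T t x = 1"
  using speed_pos[of t x] by (simp add: T_eq speed_def dot_square_norm power2_eq_square)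

lemma norm_T: "t \<ge> 0 \<Longrightarrow> norm (T t x) = 1"
  using T_T by (simp add: norm_eq_sqrt_inner)

lemma perp_add: "perp t x (u + v) = perp t x u + perp t x v"
  by (simp add: perp_def inner_add_left algebra_simps)
lemma perp_diff: "perp t x (u - v) = perp t x u - perp t x v"
  by (simp add: perp_def inner_diff_left algebra_simps)
lemma perp_uminus: "perp t x (- v) = - perp t x v"
  by (simp add: perp_def)
lemma perp_scaleR: "perp t x (a *\<^sub>R v) = a *\<^sub>R perp t x v"
  by (simp add: perp_def algebra_simps)
lemma perp_T: "t \<ge> 0 \<Longrightarrow> perp t x (T t x) = 0"
  by (simp add: perp_def T_T)
lemma perp_normal: "normal_field f \<Longrightarrow> t \<ge> 0 \<Longrightarrow> perp t x (f t x) = f t x"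
  by (simp add: perp_def normal_field_def)
lemma perp_inner_T: "t \<ge> 0 \<Longrightarrow> perp t x v \<bullet> T t x = 0"
  by (simp add: perp_def inner_diff_left T_T)
lemmas perp_simps = perp_add perp_diff perp_uminus perp_scaleR perp_T perp_normal

lemma normal_Nd: "normal_field (Nd f)"
  by (simp add: normal_field_def Nd_eq perp_inner_T)

lemma normal_K: "normal_field K"
  unfolding normal_field_def
proof (intro allI impI)
  fix t x :: real assume t: "t \<ge> 0"
  have "D (\<lambda>t x. T t x \<bullet> T t x) t x = D (\<lambda>t x. 1) t x"
    by (rule D_cong) (use T_T[OF t] in auto)
  then have "T t x \<bullet> K t x + K t x \<bullet> T t x = 0"
    by (simp add: D_inner[OF bsmooth_T bsmooth_T t] K_eq)
  then show "K t x \<bullet> T t x = 0" by (simp add: inner_commute)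
qed

lemma normal_N: "normal_field (N m)"
  by (cases m) (simp_all add: N_0 N_Suc normal_K normal_Nd)

lemma normal_intros:
  "normal_field f \<Longrightarrow> normal_field g \<Longrightarrow> normal_field (\<lambda>t x. f t x + g t x)"
  "normal_field f \<Longrightarrow> normal_field g \<Longrightarrow> normal_field (\<lambda>t x. f t x - g t x)"
  "normal_field f \<Longrightarrow> normal_field (\<lambda>t x. - f t x)"
  "normal_field f \<Longrightarrow> normal_field (\<lambda>t x. a t x *\<^sub>R f t x)"
  by (auto simp: normal_field_def inner_add_left inner_diff_left)

lemma V_eq: "t \<ge> 0 \<Longrightarrow> V t x = - N 2 t x - (1/2 * (N 0 t x \<bullet> N 0 t x)) *\<^sub>R N 0 t x + N 0 t x"
  using flow[of t x] by (simp add: N_def dot_square_norm)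

lemma normal_V: "normal_field V"
proof -
  have "normal_field (\<lambda>t x. - N 2 t x - (1/2 * (N 0 t x \<bullet> N 0 t x)) *\<^sub>R N 0 t x + N 0 t x)"
    by (intro normal_intros normal_N)
  then show ?thesis unfolding normal_field_def by (simp add: V_eq)
qed


text \<open>
  Differentiating \<open>\<langle>f, T\<rangle> = 0\<close>.
\<close>

lemma D_normal:
  assumes "bsmooth f" "normal_field f" "t \<ge> 0"
  shows "D f t x \<bullet> T t x = - (f t x \<bullet> K t x)" and "D f t x = Nd f t x - (f t x \<bullet> K t x) *\<^sub>R T t x"
proof -
  have "D (\<lambda>t x. f t x \<bullet> T t x) t x = D (\<lambda>t x. 0) t x"
    by (rule D_cong) (use assms in \<open>auto simp: normal_field_def\<close>)
  then have "f t x \<bullet> K t x + D f t x \<bullet> T t x = 0"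
    by (simp add: D_inner[OF assms(1) bsmooth_T assms(3)] K_eq)
  then show *: "D f t x \<bullet> T t x = - (f t x \<bullet> K t x)" by simp
  show "D f t x = Nd f t x - (f t x \<bullet> K t x) *\<^sub>R T t x"
    unfolding Nd_eq perp_def * by simp
qed

lemma D_inner_normal:
  assumes "bsmooth f" "normal_field f" "bsmooth g" "normal_field g" "t \<ge> 0"
  shows "D (\<lambda>t x. f t x \<bullet> g t x) t x = Nd f t x \<bullet> g t x + f t x \<bullet> Nd g t x"
  using assms(2,4,5) unfolding D_inner[OF assms(1,3,5)] D_normal(2)[OF assms(1,2,5)] D_normal(2)[OF assms(3,4,5)]
  by (simp add: inner_diff_left inner_diff_right normal_field_def inner_commute[of "T t x"])

lemma Nd_scaleR:
  assumes "bsmooth a" "bsmooth f" "normal_field f" "t \<ge> 0"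
  shows "Nd (\<lambda>t x. a t x *\<^sub>R f t x) t x = D a t x *\<^sub>R f t x + a t x *\<^sub>R Nd f t x"
  unfolding Nd_eq D_scaleR[OF assms(1,2,4)] by (simp add: perp_add perp_scaleR perp_normal assms)

lemma Nd_add: "bsmooth f \<Longrightarrow> bsmooth g \<Longrightarrow> t \<ge> 0 \<Longrightarrow> Nd (\<lambda>t x. f t x + g t x) t x = Nd f t x + Nd g t x"
  by (simp add: Nd_eq D_add perp_add)

lemma Nd_diff: "bsmooth f \<Longrightarrow> bsmooth g \<Longrightarrow> t \<ge> 0 \<Longrightarrow> Nd (\<lambda>t x. f t x - g t x) t x = Nd f t x - Nd g t x"
  by (simp add: Nd_eq D_diff perp_diff)

lemma Nd_cscale: "bsmooth f \<Longrightarrow> t \<ge> 0 \<Longrightarrow> Nd (\<lambda>t x. c *\<^sub>R f t x) t x = c *\<^sub>R Nd f t x"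
  by (simp add: Nd_eq D_cscale perp_scaleR)

lemma D_NN: "t \<ge> 0 \<Longrightarrow> D (\<lambda>t x. N i t x \<bullet> N j t x) t x = N (Suc i) t x \<bullet> N j t x + N i t x \<bullet> N (Suc j) t x"
  by (simp add: D_inner_normal bsmooth_N normal_N N_Suc)


lemma Dt_Dx_\<gamma>: assumes "t \<ge> 0" shows "Dt (Dx \<gamma>) t x = Dx V t x"
  by (rule sym, rule Dx_eqI, rule mixed_partials[OF deriv_t deriv_x bsmooth_deriv(1)[OF smooth_x]
        bsmooth_cont[OF smooth_x] bsmooth_cont[OF bsmooth_Dt[OF smooth_x]] assms])

text \<open>
  A normal motion changes length only through the curvature: \<open>\<langle>\<partial>\<^sub>sV, T\<rangle> = - \<langle>V, \<kappa>\<rangle>\<close>.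
\<close>

lemma Dt_speed: assumes t: "t \<ge> 0" shows "Dt speed t x = - (V t x \<bullet> K t x) * speed t x"
proof -
  have sp: "speed t x > 0" by (rule speed_pos[OF t])
  have "Dt (\<lambda>t x. speed t x * speed t x) t x = Dt (\<lambda>t x. Dx \<gamma> t x \<bullet> Dx \<gamma> t x) t x"
  proof (rule Dt_cong)
    show "bsmooth (\<lambda>t x. speed t x * speed t x)" by (intro bs_intros)
  qed (simp_all add: t speed_def dot_square_norm power2_eq_square)
  then have "2 * speed t x * Dt speed t x = 2 * (Dx V t x \<bullet> Dx \<gamma> t x)"
    by (simp add: Dt_inner[OF smooth_x smooth_x t] Dt_mult[OF bsmooth_speed bsmooth_speed t] Dt_Dx_\<gamma>[OF t] inner_commute)
  moreover have "Dx V t x \<bullet> Dx \<gamma> t x = speed t x * speed t x * (D V t x \<bullet> T t x)"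
    using sp by (simp add: D_eq T_eq)
  ultimately have "speed t x * Dt speed t x = speed t x * (speed t x * (D V t x \<bullet> T t x))" by simp
  then have "Dt speed t x = speed t x * (D V t x \<bullet> T t x)" using sp by simp
  then show ?thesis by (simp add: D_normal(1)[OF smooth_t normal_V t])
qed

lemma Dt_inverse_speed: assumes t: "t \<ge> 0"
  shows "Dt (\<lambda>t x. 1 / speed t x) t x = (V t x \<bullet> K t x) * (1 / speed t x)"
proof -
  have sp: "speed t x > 0" by (rule speed_pos[OF t])
  have "Dt (\<lambda>t x. (1 / speed t x) * speed t x) t x = Dt (\<lambda>t x. 1) t x"
  proof (rule Dt_cong)
    show "(1 / speed t x) * speed t x = 1" if "t \<ge> 0" for t x using speed_pos[OF that, of x] by simp
    show "bsmooth (\<lambda>t x. (1 / speed t x) * speed t x)" by (intro bs_intros)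
  qed (rule t)
  moreover have "Dt (\<lambda>t x. 1::real) t x = 0" by (rule Dt_eqI[OF t]) auto
  ultimately have "(1 / speed t x) * (- (V t x \<bullet> K t x) * speed t x) + Dt (\<lambda>t x. 1 / speed t x) t x * speed t x = 0"
    unfolding Dt_mult[OF bsmooth_inverse_speed bsmooth_speed t] Dt_speed[OF t] by simp
  then show ?thesis using sp by (simp add: field_simps)
qed

text \<open>
  The commutator of \<open>\<partial>\<^sub>t\<close> and \<open>\<partial>\<^sub>s\<close> comes from the time dependence of the speed alone, since \<open>\<partial>\<^sub>t\<close> and \<open>\<partial>\<^sub>x\<close> commute.
\<close>

lemma Dt_D:
  fixes f :: "real \<Rightarrow> real \<Rightarrow> 'b::banach"
  assumes f: "bsmooth f" and t: "t \<ge> 0"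
  shows "Dt (D f) t x = (V t x \<bullet> K t x) *\<^sub>R D f t x + D (Dt f) t x"
proof -
  have "Dt (D f) t x = Dt (\<lambda>t x. (1 / speed t x) *\<^sub>R Dx f t x) t x"
    by (rule arg_cong[where f = "\<lambda>g. Dt g t x"]) (simp add: D_eq fun_eq_iff)
  also have "\<dots> = (1 / speed t x) *\<^sub>R Dt (Dx f) t x + ((V t x \<bullet> K t x) * (1 / speed t x)) *\<^sub>R Dx f t x"
    using Dt_scaleR[OF bsmooth_inverse_speed bsmooth_Dx[OF f] t] by (simp add: Dt_inverse_speed[OF t])
  finally show ?thesis by (simp add: D_eq bsmooth_commute[OF f t, symmetric])
qed

lemma Dt_T: assumes t: "t \<ge> 0" shows "Dt T t x = Nd V t x"
proof -
  have "Dt T t x = Dt (\<lambda>t x. (1 / speed t x) *\<^sub>R Dx \<gamma> t x) t x"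
    by (rule arg_cong[where f = "\<lambda>g. Dt g t x"]) (simp add: T_eq fun_eq_iff)
  also have "\<dots> = (1 / speed t x) *\<^sub>R Dx V t x + ((V t x \<bullet> K t x) * (1 / speed t x)) *\<^sub>R Dx \<gamma> t x"
    using Dt_scaleR[OF bsmooth_inverse_speed smooth_x t] by (simp add: Dt_inverse_speed[OF t] Dt_Dx_\<gamma>[OF t])
  finally show ?thesis using D_normal(2)[OF smooth_t normal_V t, of x] by (simp add: D_eq T_eq)
qed

lemma Nt_K: assumes t: "t \<ge> 0" shows "Nt K t x = Nd (Nd V) t x + (V t x \<bullet> K t x) *\<^sub>R K t x"
proof -
  have "Dt K t x = (V t x \<bullet> K t x) *\<^sub>R K t x + D (Dt T) t x"
    unfolding K_eq by (rule Dt_D[OF bsmooth_T t, unfolded K_eq])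
  also have "D (Dt T) t x = D (Nd V) t x" by (rule D_cong) (rule Dt_T[OF t])
  finally show ?thesis unfolding Nt_def by (simp add: perp_add perp_scaleR perp_normal[OF normal_K t] Nd_eq[symmetric])
qed

lemma Dt_normal:
  assumes "bsmooth f" "normal_field f" "t \<ge> 0"
  shows "Dt f t x = Nt f t x - (f t x \<bullet> Nd V t x) *\<^sub>R T t x"
proof -
  have "Dt (\<lambda>t x. f t x \<bullet> T t x) t x = Dt (\<lambda>t x. 0) t x"
    by (rule Dt_cong) (use assms in \<open>auto simp: normal_field_def intro: bs_intros\<close>)
  moreover have "Dt (\<lambda>t x. 0::real) t x = 0" by (rule Dt_eqI[OF assms(3)]) auto
  ultimately have "f t x \<bullet> Nd V t x + Dt f t x \<bullet> T t x = 0"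
    by (simp add: Dt_inner[OF assms(1) bsmooth_T assms(3)] Dt_T[OF assms(3)])
  then have "Dt f t x \<bullet> T t x = - (f t x \<bullet> Nd V t x)" by simp
  then show ?thesis unfolding Nt_def perp_def by simp
qed

text \<open>
  The commutator of the normal derivatives. Besides the change of speed it contains the rotation of the normal space,
  \<open>\<partial>\<^sub>tT = \<nabla>\<^sub>sV\<close>, in an antisymmetric combination with \<open>\<kappa>\<close>.
\<close>

lemma Nt_Nd:
  assumes f: "bsmooth f" "normal_field f" and t: "t \<ge> 0"
  shows "Nt (Nd f) t x = Nd (Nt f) t x + (V t x \<bullet> K t x) *\<^sub>R Nd f t x
     + (f t x \<bullet> K t x) *\<^sub>R Nd V t x - (f t x \<bullet> Nd V t x) *\<^sub>R K t x"
proof -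
  have bV: "bsmooth (Nd V)" by (intro bs_intros)
  have "Dt (Nd f) t x = Dt (\<lambda>t x. D f t x + (f t x \<bullet> K t x) *\<^sub>R T t x) t x"
    by (rule Dt_cong) (auto intro: bs_intros f t simp: D_normal(2)[OF f])
  also have "\<dots> = Dt (D f) t x + Dt (\<lambda>t x. (f t x \<bullet> K t x) *\<^sub>R T t x) t x"
    by (intro Dt_eqI[OF t] has_vector_derivative_add bsmooth_deriv(1)[OF _ t] bs_intros f)
  also have "Dt (\<lambda>t x. (f t x \<bullet> K t x) *\<^sub>R T t x) t x = (f t x \<bullet> K t x) *\<^sub>R Nd V t x + Dt (\<lambda>t x. f t x \<bullet> K t x) t x *\<^sub>R T t x"
    using Dt_scaleR[OF bsmooth_inner[OF f(1) bsmooth_K] bsmooth_T t] by (simp add: Dt_T[OF t])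
  finally have 1: "Nt (Nd f) t x = perp t x (Dt (D f) t x) + (f t x \<bullet> K t x) *\<^sub>R Nd V t x"
    unfolding Nt_def by (simp add: perp_simps t normal_Nd)
  have "D (Dt f) t x = D (\<lambda>t x. Nt f t x - (f t x \<bullet> Nd V t x) *\<^sub>R T t x) t x"
    by (rule D_cong) (rule Dt_normal[OF f t])
  also have "\<dots> = D (Nt f) t x - D (\<lambda>t x. (f t x \<bullet> Nd V t x) *\<^sub>R T t x) t x"
    by (rule D_diff) (intro bs_intros f t)+
  also have "D (\<lambda>t x. (f t x \<bullet> Nd V t x) *\<^sub>R T t x) t x = (f t x \<bullet> Nd V t x) *\<^sub>R K t x + D (\<lambda>t x. f t x \<bullet> Nd V t x) t x *\<^sub>R T t x"
    using D_scaleR[OF bsmooth_inner[OF f(1) bV] bsmooth_T t] by (simp add: K_eq)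
  finally have "perp t x (D (Dt f) t x) = Nd (Nt f) t x - (f t x \<bullet> Nd V t x) *\<^sub>R K t x"
    by (simp add: perp_simps t normal_K Nd_eq)
  then show ?thesis unfolding 1 Dt_D[OF f(1) t]
    by (simp add: perp_add perp_scaleR Nd_eq[of f, symmetric])
qed


text \<open>
  Normal polynomials in the \<open>N i\<close> whose monomials have at least three factors and weight at most \<open>w\<close>, where \<open>N i\<close> has weight
  \<open>i + 1\<close>. This is the weight under scaling of the curve, and \<open>\<nabla>\<^sub>s\<close> raises it by one. Only an upper bound on it enters the
  estimates, which allows terms of different weights in one class.
\<close>

inductive cubic :: "nat \<Rightarrow> (real \<Rightarrow> real \<Rightarrow> 'a) \<Rightarrow> bool" where
  tri: "i + j + k + 3 \<le> w \<Longrightarrow> cubic w (\<lambda>t x. (N i t x \<bullet> N j t x) *\<^sub>R N k t x)"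
| mul: "cubic w f \<Longrightarrow> i + j + 2 + w \<le> w' \<Longrightarrow> cubic w' (\<lambda>t x. (N i t x \<bullet> N j t x) *\<^sub>R f t x)"
| add: "cubic w f \<Longrightarrow> cubic w g \<Longrightarrow> cubic w (\<lambda>t x. f t x + g t x)"
| scale: "cubic w f \<Longrightarrow> cubic w (\<lambda>t x. c *\<^sub>R f t x)"

lemma cubic_diff: "cubic w f \<Longrightarrow> cubic w g \<Longrightarrow> cubic w (\<lambda>t x. f t x - g t x)"
  using cubic.add[OF _ cubic.scale, of w f g "-1"] by simp

lemma cubic_bsmooth: "cubic w f \<Longrightarrow> bsmooth f"
  by (induction rule: cubic.induct) (intro bs_intros; assumption)+

lemma cubic_normal: "cubic w f \<Longrightarrow> normal_field f"
  by (induction rule: cubic.induct) (auto intro: normal_intros normal_N)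

lemma cubic_Nd: "cubic w f \<Longrightarrow> \<exists>g. cubic (Suc w) g \<and> (\<forall>t\<ge>0. \<forall>x. Nd f t x = g t x)"
proof (induction rule: cubic.induct)
  case (tri i j k w)
  let ?g = "\<lambda>t x. ((N (Suc i) t x \<bullet> N j t x) *\<^sub>R N k t x + (N i t x \<bullet> N (Suc j) t x) *\<^sub>R N k t x) + (N i t x \<bullet> N j t x) *\<^sub>R N (Suc k) t x"
  have "cubic (Suc w) ?g" using tri by (intro cubic.add cubic.tri) auto
  moreover have "Nd (\<lambda>t x. (N i t x \<bullet> N j t x) *\<^sub>R N k t x) t x = ?g t x" if "t \<ge> 0" for t x
    using Nd_scaleR[OF bsmooth_inner[OF bsmooth_N bsmooth_N] bsmooth_N normal_N that, of i j k x]
    by (simp add: D_NN[OF that] N_Suc scaleR_add_left)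
  ultimately show ?case by blast
next
  case (mul w f i j w')
  then obtain g where g: "cubic (Suc w) g" "\<forall>t\<ge>0. \<forall>x. Nd f t x = g t x" by blast
  let ?g = "\<lambda>t x. ((N (Suc i) t x \<bullet> N j t x) *\<^sub>R f t x + (N i t x \<bullet> N (Suc j) t x) *\<^sub>R f t x) + (N i t x \<bullet> N j t x) *\<^sub>R g t x"
  have "cubic (Suc w') ?g" using mul by (intro cubic.add cubic.mul[OF mul.hyps(1)] cubic.mul[OF g(1)]) auto
  moreover have "Nd (\<lambda>t x. (N i t x \<bullet> N j t x) *\<^sub>R f t x) t x = ?g t x" if "t \<ge> 0" for t x
    using Nd_scaleR[OF bsmooth_inner[OF bsmooth_N bsmooth_N] cubic_bsmooth cubic_normal that, OF mul.hyps(1) mul.hyps(1), of i j x] g(2) that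
    by (simp add: D_NN[OF that] scaleR_add_left)
  ultimately show ?case by blast
next
  case (add w f g)
  then obtain f' g' where g: "cubic (Suc w) f'" "\<forall>t\<ge>0. \<forall>x. Nd f t x = f' t x" "cubic (Suc w) g'" "\<forall>t\<ge>0. \<forall>x. Nd g t x = g' t x" by blast
  moreover have "Nd (\<lambda>t x. f t x + g t x) t x = f' t x + g' t x" if "t \<ge> 0" for t x
    using Nd_add[OF cubic_bsmooth[OF add.hyps(1)] cubic_bsmooth[OF add.hyps(2)] that] g that by simp
  ultimately show ?case using cubic.add by blast
next
  case (scale w f c)
  then obtain f' where g: "cubic (Suc w) f'" "\<forall>t\<ge>0. \<forall>x. Nd f t x = f' t x" by blast
  moreover have "Nd (\<lambda>t x. c *\<^sub>R f t x) t x = c *\<^sub>R f' t x" if "t \<ge> 0" for t x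
    using Nd_cscale[OF cubic_bsmooth[OF scale.hyps(1)] that] g that by simp
  ultimately show ?case using cubic.scale by blast
qed

lemma Nd_V: assumes t: "t \<ge> 0"
  shows "Nd V t x = - N 3 t x - ((N 0 t x \<bullet> N 1 t x) *\<^sub>R N 0 t x + (1/2) *\<^sub>R ((N 0 t x \<bullet> N 0 t x) *\<^sub>R N 1 t x)) + N 1 t x"
proof -
  have "Nd V t x = Nd (\<lambda>t x. (- 1) *\<^sub>R N 2 t x - (1/2) *\<^sub>R ((N 0 t x \<bullet> N 0 t x) *\<^sub>R N 0 t x) + N 0 t x) t x"
    by (rule Nd_cong) (simp add: V_eq[OF t])
  also have "\<dots> = (- 1) *\<^sub>R Nd (N 2) t x - (1/2) *\<^sub>R Nd (\<lambda>t x. (N 0 t x \<bullet> N 0 t x) *\<^sub>R N 0 t x) t x + Nd (N 0) t x"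
    by (subst Nd_add Nd_diff Nd_cscale, (intro bs_intros t)+)+ simp
  also have "Nd (\<lambda>t x. (N 0 t x \<bullet> N 0 t x) *\<^sub>R N 0 t x) t x
      = (2 * (N 0 t x \<bullet> N 1 t x)) *\<^sub>R N 0 t x + (N 0 t x \<bullet> N 0 t x) *\<^sub>R N 1 t x"
    using Nd_scaleR[OF bsmooth_inner[OF bsmooth_N bsmooth_N] bsmooth_N normal_N t, of 0 0 0 x]
    by (simp add: D_NN[OF t] N_Suc inner_commute)
  finally show ?thesis by (simp add: N_Suc[symmetric] scaleR_add_right eval_nat_numeral)
qed

text \<open>
  Induction on \<open>m\<close> with \<open>Nt_Nd\<close>. As \<open>V\<close> is \<open>- N 2 + N 0\<close> up to a cubic term, both the commutator terms and the nonlinear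
  part of \<open>V\<close> only contribute monomials with three or more factors.
\<close>

theorem evolution_N:
  "\<exists>P. cubic (m + 5) P \<and> (\<forall>t\<ge>0. \<forall>x. Nt (N m) t x = - N (m + 4) t x + N (m + 2) t x + P t x)"
proof (induction m)
  case 0
  let ?c = "\<lambda>t x. (N 0 t x \<bullet> N 1 t x) *\<^sub>R N 0 t x + (1/2) *\<^sub>R ((N 0 t x \<bullet> N 0 t x) *\<^sub>R N 1 t x)"
  have c: "cubic 4 ?c" by (intro cubic.add cubic.scale cubic.tri) auto
  then obtain g where g: "cubic 5 g" "\<forall>t\<ge>0. \<forall>x. Nd ?c t x = g t x" using cubic_Nd[OF c] by auto
  let ?VK = "\<lambda>t x. ((-1) *\<^sub>R ((N 2 t x \<bullet> N 0 t x) *\<^sub>R N 0 t x) - (1/2) *\<^sub>R ((N 0 t x \<bullet> N 0 t x) *\<^sub>R ((N 0 t x \<bullet> N 0 t x) *\<^sub>R N 0 t x))) + (N 0 t x \<bullet> N 0 t x) *\<^sub>R N 0 t x"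
  let ?P = "\<lambda>t x. ?VK t x - g t x"
  have "cubic 3 (\<lambda>t x. (N 0 t x \<bullet> N 0 t x) *\<^sub>R N 0 t x)" by (intro cubic.tri) auto
  then have "cubic 5 ?VK" by (intro cubic.add cubic_diff cubic.scale cubic.tri cubic.mul) auto
  then have "cubic (0 + 5) ?P" using g(1) by (simp add: cubic_diff)
  moreover have "Nt (N 0) t x = - N (0 + 4) t x + N (0 + 2) t x + ?P t x" if t: "t \<ge> 0" for t x
  proof -
    have "Nd (Nd V) t x = Nd (\<lambda>t x. (-1) *\<^sub>R N 3 t x - ?c t x + N 1 t x) t x"
      by (rule Nd_cong) (simp add: Nd_V[OF t])
    also have "\<dots> = (-1) *\<^sub>R Nd (N 3) t x - Nd ?c t x + Nd (N 1) t x"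
      by (subst Nd_add Nd_diff Nd_cscale, (intro bs_intros cubic_bsmooth[OF c] t)+)+ simp
    finally have "Nd (Nd V) t x = - N 4 t x - g t x + N 2 t x"
      using g(2) t by (simp add: N_Suc[symmetric] eval_nat_numeral)
    moreover have "(V t x \<bullet> K t x) *\<^sub>R K t x = ?VK t x"
      by (simp add: V_eq[OF t] N_0 inner_add_left inner_diff_left algebra_simps)
    ultimately show ?thesis by (simp add: N_0 Nt_K[OF t] numeral_2_eq_2)
  qed
  ultimately show ?case by blast
next
  case (Suc m)
  then obtain P where P: "cubic (m + 5) P" "\<And>t x. t \<ge> 0 \<Longrightarrow> Nt (N m) t x = - N (m + 4) t x + N (m + 2) t x + P t x" by blast
  obtain Q where Q: "cubic (Suc (m + 5)) Q" "\<And>t x. t \<ge> 0 \<Longrightarrow> Nd P t x = Q t x" using cubic_Nd[OF P(1)] by blast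
  let ?A = "\<lambda>t x. ((-1) *\<^sub>R ((N 2 t x \<bullet> N 0 t x) *\<^sub>R N (Suc m) t x) - (1/2) *\<^sub>R ((N 0 t x \<bullet> N 0 t x) *\<^sub>R ((N 0 t x \<bullet> N 0 t x) *\<^sub>R N (Suc m) t x))) + (N 0 t x \<bullet> N 0 t x) *\<^sub>R N (Suc m) t x"
  let ?c = "\<lambda>t x. (N 0 t x \<bullet> N 1 t x) *\<^sub>R N 0 t x + (1/2) *\<^sub>R ((N 0 t x \<bullet> N 0 t x) *\<^sub>R N 1 t x)"
  let ?B = "\<lambda>t x. (-1) *\<^sub>R ((N m t x \<bullet> N 0 t x) *\<^sub>R N 3 t x) - (N m t x \<bullet> N 0 t x) *\<^sub>R ?c t x + (N m t x \<bullet> N 0 t x) *\<^sub>R N 1 t x"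
  let ?C = "\<lambda>t x. (-1) *\<^sub>R ((N m t x \<bullet> N 3 t x) *\<^sub>R N 0 t x) - ((N 0 t x \<bullet> N 1 t x) *\<^sub>R ((N m t x \<bullet> N 0 t x) *\<^sub>R N 0 t x) + (1/2) *\<^sub>R ((N 0 t x \<bullet> N 0 t x) *\<^sub>R ((N m t x \<bullet> N 1 t x) *\<^sub>R N 0 t x))) + (N m t x \<bullet> N 1 t x) *\<^sub>R N 0 t x"
  let ?R = "\<lambda>t x. Q t x + ?A t x + ?B t x - ?C t x"
  have t1: "cubic (i + j + k + 3) (\<lambda>t x. (N i t x \<bullet> N j t x) *\<^sub>R N k t x)" for i j k by (intro cubic.tri) auto
  have c: "cubic 4 ?c" by (intro cubic.add cubic.scale cubic.tri) auto
  have A: "cubic (Suc m + 5) ?A"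
    by (intro cubic.add cubic_diff cubic.scale cubic.mul[OF t1] cubic.tri) auto
  have B: "cubic (Suc m + 5) ?B"
    by (intro cubic.add cubic_diff cubic.scale cubic.mul[OF c] cubic.tri) auto
  have C: "cubic (Suc m + 5) ?C"
    by (intro cubic.add cubic_diff cubic.scale cubic.mul[OF t1] cubic.tri) auto
  have "cubic (Suc m + 5) ?R" using Q(1) by (intro cubic_diff[OF _ C] cubic.add[OF _ B] cubic.add[OF _ A]) simp
  moreover have "Nt (N (Suc m)) t x = - N (Suc m + 4) t x + N (Suc m + 2) t x + ?R t x" if t: "t \<ge> 0" for t x
  proof -
    have "Nd (Nt (N m)) t x = Nd (\<lambda>t x. ((-1) *\<^sub>R N (m + 4) t x + N (m + 2) t x) + P t x) t x"
      by (rule Nd_cong) (simp add: P(2)[OF t])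
    also have "\<dots> = (-1) *\<^sub>R Nd (N (m + 4)) t x + Nd (N (m + 2)) t x + Nd P t x"
      by (subst Nd_add Nd_diff Nd_cscale, (intro bs_intros cubic_bsmooth[OF P(1)] t)+)+ simp
    finally have 1: "Nd (Nt (N m)) t x = - N (Suc m + 4) t x + N (Suc m + 2) t x + Q t x"
      using Q(2)[OF t] by (simp add: N_Suc[symmetric])
    have A: "(V t x \<bullet> K t x) *\<^sub>R Nd (N m) t x = ?A t x"
      by (simp add: V_eq[OF t] N_0[symmetric] N_Suc[symmetric] inner_add_left inner_diff_left algebra_simps)
    have B: "(N m t x \<bullet> K t x) *\<^sub>R Nd V t x = ?B t x"
      by (simp add: Nd_V[OF t] N_0[symmetric] algebra_simps)
    have C: "(N m t x \<bullet> Nd V t x) *\<^sub>R K t x = ?C t x"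
      by (simp add: Nd_V[OF t] N_0[symmetric] inner_add_right inner_diff_right algebra_simps)
    show ?thesis unfolding N_Suc Nt_Nd[OF bsmooth_N normal_N t] 1[unfolded N_Suc] A[unfolded N_Suc] B C by (simp add: N_Suc)
  qed
  ultimately show ?case by blast
qed

end

section \<open>Cut-off integrals along the curve\<close>

context bounded_flow
begin

text \<open>
  The integral of \<open>g\<close> with respect to arclength, with the cut-off \<open>1 - (x/R)\<^sup>2\<close>. Vanishing to first order at the end points
  is enough, because each integration by parts differentiates the cut-off once. Since it is independent of time and
  increases to \<open>1\<close> with \<open>R\<close>, integrals of nonnegative functions over the whole curve are monotone limits.
\<close>

definition J :: "real \<Rightarrow> real \<Rightarrow> (real \<Rightarrow> real) \<Rightarrow> real" where
  "J t R g = integral {-R..R} (\<lambda>x. (1 - (x / R)\<^sup>2) * g x * speed t x)"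

lemma cont_speed: "t \<ge> 0 \<Longrightarrow> continuous_on A (speed t)"
  by (rule bsmooth_cont_x[OF bsmooth_speed])

lemma cont_N: "t \<ge> 0 \<Longrightarrow> continuous_on A (N m t)"
  by (rule bsmooth_cont_x[OF bsmooth_N])

lemma J_integrable:
  assumes "t \<ge> 0" "continuous_on UNIV g"
  shows "(\<lambda>x. (1 - (x / R)\<^sup>2) * g x * speed t x) integrable_on {a..b}"
proof (rule integrable_continuous_real)
  have "continuous_on {a..b} (\<lambda>x. 1 - (x * inverse R)\<^sup>2)"
    by (intro continuous_intros)
  then show "continuous_on {a..b} (\<lambda>x. (1 - (x / R)\<^sup>2) * g x * speed t x)"
    by (intro continuous_on_mult cont_speed assms(1) continuous_on_subset[OF assms(2)]) (auto simp: field_simps)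
qed

lemma cut_nonneg: assumes "(R::real) > 0" "x \<in> {-R..R}" shows "0 \<le> 1 - (x / R)\<^sup>2"
proof -
  have "\<bar>x / R\<bar> \<le> 1" using assms by (auto simp: abs_le_iff field_simps)
  then show ?thesis by (simp add: abs_square_le_1)
qed

lemma J_integrand_nonneg:
  assumes "t \<ge> 0" "R > 0" "\<And>x. 0 \<le> f x"
  shows "\<forall>x\<in>{-R..R}. 0 \<le> (1 - (x / R)\<^sup>2) * f x * speed t x"
  by (intro ballI mult_nonneg_nonneg cut_nonneg less_imp_le[OF speed_pos] assms)

lemma J_add: "t \<ge> 0 \<Longrightarrow> continuous_on UNIV f \<Longrightarrow> continuous_on UNIV g \<Longrightarrow> J t R (\<lambda>x. f x + g x) = J t R f + J t R g"
  unfolding J_def integral_add[symmetric, OF J_integrable J_integrable] by (simp add: algebra_simps)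

lemma J_diff: "t \<ge> 0 \<Longrightarrow> continuous_on UNIV f \<Longrightarrow> continuous_on UNIV g \<Longrightarrow> J t R (\<lambda>x. f x - g x) = J t R f - J t R g"
  unfolding J_def integral_diff[symmetric, OF J_integrable J_integrable] by (simp add: algebra_simps)

lemma J_cmult: "J t R (\<lambda>x. c * f x) = c * J t R f"
proof -
  have "J t R (\<lambda>x. c * f x) = integral {-R..R} (\<lambda>x. c * ((1 - (x / R)\<^sup>2) * f x * speed t x))"
    unfolding J_def by (rule arg_cong[where f = "integral {-R..R}"]) (auto simp: algebra_simps)
  then show ?thesis by (simp add: J_def)
qed

lemma J_sum:
  assumes "t \<ge> 0" "finite A" "\<And>i. i \<in> A \<Longrightarrow> continuous_on UNIV (f i)"
  shows "J t R (\<lambda>x. \<Sum>i\<in>A. f i x) = (\<Sum>i\<in>A. J t R (f i))"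
  using assms(2,3)
proof (induction rule: finite_induct)
  case empty then show ?case by (simp add: J_def)
next
  case (insert i A)
  then show ?case by (simp add: J_add[OF assms(1)] continuous_on_sum)
qed

lemma J_mono:
  assumes "t \<ge> 0" "R > 0" "continuous_on UNIV f" "continuous_on UNIV g" "\<And>x. f x \<le> g x"
  shows "J t R f \<le> J t R g"
  unfolding J_def
proof (rule integral_le)
  fix x assume x: "x \<in> {-R..R}"
  show "(1 - (x / R)\<^sup>2) * f x * speed t x \<le> (1 - (x / R)\<^sup>2) * g x * speed t x"
    by (intro mult_right_mono mult_left_mono assms cut_nonneg[OF assms(2) x] less_imp_le[OF speed_pos])
qed (auto intro: J_integrable assms)

lemma J_nonneg:
  assumes "t \<ge> 0" "R > 0" "continuous_on UNIV f" "\<And>x. 0 \<le> f x"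
  shows "0 \<le> J t R f"
  using J_mono[OF assms(1,2), of "\<lambda>x. 0" f] assms by (simp add: J_def)

lemma J_mono_R:
  assumes "t \<ge> 0" "0 < R" "R \<le> R'" "continuous_on UNIV f" "\<And>x. 0 \<le> f x"
  shows "J t R f \<le> J t R' f"
proof -
  have "J t R f \<le> integral {-R..R} (\<lambda>x. (1 - (x / R')\<^sup>2) * f x * speed t x)"
    unfolding J_def
  proof (rule integral_le)
    fix x assume x: "x \<in> {-R..R}"
    have "\<bar>x / R'\<bar> \<le> \<bar>x / R\<bar>" using assms by (simp add: frac_le)
    then have "(x / R')\<^sup>2 \<le> (x / R)\<^sup>2" by (simp only: abs_le_square_iff)
    then show "(1 - (x / R)\<^sup>2) * f x * speed t x \<le> (1 - (x / R')\<^sup>2) * f x * speed t x"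
      by (intro mult_right_mono assms less_imp_le[OF speed_pos]) auto
  qed (auto intro: J_integrable assms)
  also have "\<dots> \<le> J t R' f"
    unfolding J_def
  proof (rule integral_subset_le)
    show "\<forall>x\<in>{-R'..R'}. 0 \<le> (1 - (x / R')\<^sup>2) * f x * speed t x"
      by (rule J_integrand_nonneg) (use assms in auto)
  qed (use assms in \<open>auto intro: J_integrable\<close>)
  finally show ?thesis .
qed

text \<open>
  On \<open>[-R, R]\<close> the cut-off of radius \<open>2R\<close> is at least \<open>3/4\<close>.
\<close>

lemma plain_le_J:
  assumes "t \<ge> 0" "R > 0" "continuous_on UNIV f" "\<And>x. 0 \<le> f x"
  shows "integral {-R..R} (\<lambda>x. f x * speed t x) \<le> 4/3 * J t (2 * R) f"
proof -
  have "integral {-R..R} (\<lambda>x. f x * speed t x) \<le> integral {-R..R} (\<lambda>x. 4/3 * ((1 - (x / (2*R))\<^sup>2) * f x * speed t x))"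
  proof (rule integral_le)
    show "(\<lambda>x. f x * speed t x) integrable_on {-R..R}"
      by (intro integrable_continuous_real continuous_on_mult cont_speed assms(1) continuous_on_subset[OF assms(3)]) auto
    show "(\<lambda>x. 4/3 * ((1 - (x / (2*R))\<^sup>2) * f x * speed t x)) integrable_on {-R..R}"
      by (intro integrable_on_mult_right J_integrable assms)
    fix x assume x: "x \<in> {-R..R}"
    have "\<bar>x / (2*R)\<bar> \<le> 1/2" using assms x by (auto simp: abs_le_iff field_simps)
    then have "\<bar>x / (2*R)\<bar>\<^sup>2 \<le> (1/2)\<^sup>2" by (intro power_mono) auto
    then have "(x / (2*R))\<^sup>2 \<le> 1/4" by (simp add: power2_eq_square)
    then have "1 \<le> 4/3 * (1 - (x / (2*R))\<^sup>2)" by simp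
    then have "1 * (f x * speed t x) \<le> (4/3 * (1 - (x / (2*R))\<^sup>2)) * (f x * speed t x)"
      by (rule mult_right_mono) (intro mult_nonneg_nonneg assms less_imp_le[OF speed_pos])
    then show "f x * speed t x \<le> 4/3 * ((1 - (x / (2*R))\<^sup>2) * f x * speed t x)" by (simp add: algebra_simps)
  qed
  also have "\<dots> = 4/3 * integral {-R..R} (\<lambda>x. (1 - (x / (2*R))\<^sup>2) * f x * speed t x)" by simp
  also have "integral {-R..R} (\<lambda>x. (1 - (x / (2*R))\<^sup>2) * f x * speed t x) \<le> J t (2*R) f"
    unfolding J_def
  proof (rule integral_subset_le)
    show "\<forall>x\<in>{-(2*R)..2*R}. 0 \<le> (1 - (x / (2*R))\<^sup>2) * f x * speed t x"
      by (rule J_integrand_nonneg) (use assms in auto)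
  qed (use assms in \<open>auto intro: J_integrable\<close>)
  finally show ?thesis by simp
qed

text \<open>
  The correction term is the rate of change \<open>- \<langle>V, \<kappa>\<rangle>\<close> of the arclength element.
\<close>

lemma J_deriv:
  assumes f: "bsmooth f" and t: "t \<ge> 0"
  shows "((\<lambda>t. J t R (f t)) has_real_derivative J t R (\<lambda>x. Dt f t x - f t x * (V t x \<bullet> K t x))) (at t within {0..})"
proof -
  let ?g = "\<lambda>t x. (1 - (x / R)\<^sup>2) * (f t x * speed t x)"
  let ?g' = "\<lambda>t x. (1 - (x / R)\<^sup>2) * Dt (\<lambda>t x. f t x * speed t x) t x"
  have b: "bsmooth (\<lambda>t x. f t x * speed t x)" by (intro bs_intros f)
  have "((\<lambda>t. integral (cbox (-R) R) (?g t)) has_real_derivative integral (cbox (-R) R) (?g' t)) (at t within {0..})"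
  proof (rule leibniz_rule_field_derivative)
    fix s x :: real assume "s \<in> {0..}" 
    then have s: "s \<ge> 0" by simp
    show "((\<lambda>t. ?g t x) has_real_derivative ?g' s x) (at s within {0..})"
      using bsmooth_deriv(1)[OF b s, of x] 
      by (intro DERIV_cmult) (simp add: has_real_derivative_iff_has_vector_derivative)
  next
    fix s :: real assume "s \<in> {0..}"
    then show "?g s integrable_on cbox (-R) R"
      using J_integrable[of s "f s" R "-R" R] bsmooth_cont_x[OF f, of s] by (simp add: mult.assoc)
  next
    have "continuous_on ({0..} \<times> cbox (-R) R) (\<lambda>z. (1 - (snd z * inverse R)\<^sup>2) * (\<lambda>(t,x). Dt (\<lambda>t x. f t x * speed t x) t x) z)"
      by (intro continuous_intros continuous_on_subset[OF bsmooth_cont[OF bsmooth_Dt[OF b]]]) auto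
    then show "continuous_on ({0..} \<times> cbox (-R) R) (\<lambda>(t, x). ?g' t x)"
      by (simp add: case_prod_beta divide_inverse)
  qed (use t in auto)
  moreover have "?g' t x = (1 - (x / R)\<^sup>2) * (Dt f t x - f t x * (V t x \<bullet> K t x)) * speed t x" for x
    unfolding Dt_mult[OF f bsmooth_speed t] Dt_speed[OF t] by (simp add: algebra_simps)
  ultimately show ?thesis unfolding J_def by (simp add: mult.assoc)
qed

lemma cut_slope_le:
  assumes R: "(R::real) > 0" and x: "x \<in> {-R..R}" shows "\<bar>- 2 * x / R\<^sup>2\<bar> \<le> 2 / R"
proof -
  have "\<bar>x\<bar> / (R * R) \<le> R / (R * R)" using x R by (intro divide_right_mono) auto
  then show ?thesis using R by (simp add: power2_eq_square abs_mult)
qed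

lemma cut_slope_mult_le:
  "(R::real) > 0 \<Longrightarrow> x \<in> {-R..R} \<Longrightarrow> \<bar>(- 2 * x / R\<^sup>2) * y\<bar> \<le> 2 / R * \<bar>y\<bar>"
  unfolding abs_mult[of "- 2 * x / R\<^sup>2"] by (intro mult_right_mono cut_slope_le) auto

lemma cut_has_real_derivative:
  "(R::real) > 0 \<Longrightarrow> ((\<lambda>x. 1 - (x / R)\<^sup>2) has_real_derivative (- 2 * x / R\<^sup>2)) (at x)"
  by (auto intro!: derivative_eq_intros simp: power2_eq_square)

lemma cut_FTC:
  assumes f: "bsmooth f" and t: "t \<ge> 0" and R: "R > 0" and "a \<le> b"
  shows "((\<lambda>x. (1 - (x / R)\<^sup>2) * Dx f t x + (- 2 * x / R\<^sup>2) * f t x) has_integral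
      ((1 - (b / R)\<^sup>2) * f t b - (1 - (a / R)\<^sup>2) * f t a)) {a..b}"
proof (rule fundamental_theorem_of_calculus[OF assms(4)])
  fix x assume "x \<in> {a..b}"
  have "(f t has_real_derivative Dx f t x) (at x)"
    using bsmooth_deriv(2)[OF f t] by (simp add: has_real_derivative_iff_has_vector_derivative)
  from DERIV_mult[OF cut_has_real_derivative[OF R] this]
  have "((\<lambda>x. (1 - (x / R)\<^sup>2) * f t x) has_real_derivative (1 - (x / R)\<^sup>2) * Dx f t x + (- 2 * x / R\<^sup>2) * f t x) (at x)"
    by (simp add: algebra_simps)
  then show "((\<lambda>x. (1 - (x / R)\<^sup>2) * f t x) has_vector_derivative (1 - (x / R)\<^sup>2) * Dx f t x + (- 2 * x / R\<^sup>2) * f t x) (at x within {a..b})"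
    by (simp add: has_real_derivative_iff_has_vector_derivative has_vector_derivative_at_within)
qed

text \<open>
  Integration by parts: the cut-off vanishes at the end points and its slope is at most \<open>2/R\<close>.
\<close>

lemma J_IBP:
  assumes f: "bsmooth f" and t: "t \<ge> 0" and R: "R > 0"
  shows "\<bar>J t R (D f t)\<bar> \<le> 2 / R * integral {-R..R} (\<lambda>x. \<bar>f t x\<bar>)"
proof -
  have Df: "(1 - (x / R)\<^sup>2) * D f t x * speed t x = (1 - (x / R)\<^sup>2) * Dx f t x" for x
    using speed_pos[OF t, of x] by (simp add: D_eq)
  have cf: "continuous_on A (f t)" and cfx: "continuous_on A (Dx f t)" for A
    by (intro bsmooth_cont_x f t bs_intros)+
  have I: "((\<lambda>x. (1 - (x / R)\<^sup>2) * Dx f t x + (- 2 * x / R\<^sup>2) * f t x) has_integral 0) {-R..R}"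
    using cut_FTC[OF f t R, of "-R" R] R by simp
  have c1: "continuous_on {-R..R} (\<lambda>x. (- 2 * x / R\<^sup>2) * f t x)"
    using R by (intro continuous_intros cf) auto
  have i1: "(\<lambda>x. (- 2 * x / R\<^sup>2) * f t x) integrable_on {-R..R}" by (rule integrable_continuous_real[OF c1])
  have "((\<lambda>x. ((1 - (x / R)\<^sup>2) * Dx f t x + (- 2 * x / R\<^sup>2) * f t x) - (- 2 * x / R\<^sup>2) * f t x) has_integral
      (0 - integral {-R..R} (\<lambda>x. (- 2 * x / R\<^sup>2) * f t x))) {-R..R}"
    by (intro has_integral_diff I integrable_integral i1)
  then have "J t R (D f t) = - integral {-R..R} (\<lambda>x. (- 2 * x / R\<^sup>2) * f t x)"
    unfolding J_def Df by (auto dest!: integral_unique)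
  then have "\<bar>J t R (D f t)\<bar> = norm (integral {-R..R} (\<lambda>x. (- 2 * x / R\<^sup>2) * f t x))" by simp
  also have "\<dots> \<le> integral {-R..R} (\<lambda>x. 2 / R * \<bar>f t x\<bar>)"
  proof (rule integral_norm_bound_integral[OF i1])
    show "(\<lambda>x. 2 / R * \<bar>f t x\<bar>) integrable_on {-R..R}"
      by (intro integrable_continuous_real continuous_intros cf)
    fix x assume x: "x \<in> {-R..R}"
    show "norm ((- 2 * x / R\<^sup>2) * f t x) \<le> 2 / R * \<bar>f t x\<bar>"
      unfolding real_norm_def by (rule cut_slope_mult_le[OF R x])
  qed
  finally show ?thesis by simp
qed

text \<open>
  The cut-off function vanishes at both ends, so it rises to its value at \<open>x0\<close> and descends again; each of the two passages
  is bounded by the integral of the derivative over one side. The factor \<open>2\<close> is what makes the energy threshold sharp.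
\<close>

lemma cut_value_le:
  assumes f: "bsmooth f" and t: "t \<ge> 0" and R: "R > 0" and x0: "x0 \<in> {-R..R}"
  shows "2 * ((1 - (x0 / R)\<^sup>2) * f t x0) \<le> J t R (\<lambda>x. \<bar>D f t x\<bar>) + 2 / R * integral {-R..R} (\<lambda>x. \<bar>f t x\<bar>)"
proof -
  have Df: "(1 - (x / R)\<^sup>2) * \<bar>D f t x\<bar> * speed t x = (1 - (x / R)\<^sup>2) * \<bar>Dx f t x\<bar>" for x
    using speed_pos[OF t, of x] by (simp add: D_eq abs_mult)
  have cf: "continuous_on A (f t)" and cfx: "continuous_on A (Dx f t)" for A
    by (intro bsmooth_cont_x f t bs_intros)+
  let ?d = "\<lambda>x. (1 - (x / R)\<^sup>2) * Dx f t x + (- 2 * x / R\<^sup>2) * f t x"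
  let ?g = "\<lambda>x. (1 - (x / R)\<^sup>2) * \<bar>Dx f t x\<bar> + 2 / R * \<bar>f t x\<bar>"
  have cc: "continuous_on {a..b} (\<lambda>x. 1 - (x / R)\<^sup>2)" for a b using R by (intro continuous_intros) auto
  have ci: "?g integrable_on {a..b}" for a b
    by (intro integrable_continuous_real continuous_on_add continuous_on_mult cc continuous_intros cf cfx)
  have I: "(?d has_integral ((1 - (x0 / R)\<^sup>2) * f t x0)) {-R..x0}" using cut_FTC[OF f t R, of "-R" x0] x0 R by simp
  have I2: "((\<lambda>x. - ?d x) has_integral ((1 - (x0 / R)\<^sup>2) * f t x0)) {x0..R}"
    using has_integral_neg[OF cut_FTC[OF f t R, of x0 R]] x0 R by simp
  have le: "\<bar>?d x\<bar> \<le> ?g x" if x: "x \<in> {-R..R}" for x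
  proof -
    have cut: "0 \<le> 1 - (x / R)\<^sup>2" by (rule cut_nonneg[OF R x])
    have "\<bar>(- 2 * x / R\<^sup>2) * f t x\<bar> \<le> 2 / R * \<bar>f t x\<bar>" by (rule cut_slope_mult_le[OF R x])
    moreover have "\<bar>(1 - (x / R)\<^sup>2) * Dx f t x\<bar> = (1 - (x / R)\<^sup>2) * \<bar>Dx f t x\<bar>" using cut by (simp add: abs_mult)
    ultimately show "\<bar>?d x\<bar> \<le> ?g x" by linarith
  qed
  have "(1 - (x0 / R)\<^sup>2) * f t x0 \<le> integral {-R..x0} ?g"
  proof (rule has_integral_le[OF I integrable_integral[OF ci]])
    show "?d x \<le> ?g x" if "x \<in> {-R..x0}" for x using le[of x] that x0 by (auto simp: abs_le_iff)
  qed
  moreover have "(1 - (x0 / R)\<^sup>2) * f t x0 \<le> integral {x0..R} ?g"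
  proof (rule has_integral_le[OF I2 integrable_integral[OF ci]])
    show "- ?d x \<le> ?g x" if "x \<in> {x0..R}" for x using le[of x] that x0 by (auto simp: abs_le_iff)
  qed
  moreover have "integral {-R..x0} ?g + integral {x0..R} ?g = integral {-R..R} ?g"
    by (rule Henstock_Kurzweil_Integration.integral_combine[OF _ _ ci]) (use x0 in auto)
  ultimately have "2 * ((1 - (x0 / R)\<^sup>2) * f t x0) \<le> integral {-R..R} ?g" by linarith
  also have "\<dots> = integral {-R..R} (\<lambda>x. (1 - (x / R)\<^sup>2) * \<bar>Dx f t x\<bar>) + integral {-R..R} (\<lambda>x. 2 / R * \<bar>f t x\<bar>)"
    by (rule integral_add; intro integrable_continuous_real continuous_on_mult cc continuous_intros cf cfx)
  also have "\<dots> = J t R (\<lambda>x. \<bar>D f t x\<bar>) + 2 / R * integral {-R..R} (\<lambda>x. \<bar>f t x\<bar>)"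
    by (simp add: J_def Df)
  finally show ?thesis .
qed

lemma J_IBP_bounded:
  assumes "bsmooth f" "t \<ge> 0" "R > 0" "\<And>x. \<bar>f t x\<bar> \<le> B"
  shows "\<bar>J t R (D f t)\<bar> \<le> 4 * B"
proof -
  have c: "continuous_on {-R..R} (f t)" by (intro bsmooth_cont_x assms)
  have "integral {-R..R} (\<lambda>x. \<bar>f t x\<bar>) \<le> integral {-R..R} (\<lambda>x. B)"
    by (intro integral_le integrable_continuous_real continuous_intros c assms)
  also have "\<dots> = 2 * R * B" using assms(3) by simp
  finally have "2 / R * integral {-R..R} (\<lambda>x. \<bar>f t x\<bar>) \<le> 2 / R * (2 * R * B)"
    by (intro mult_left_mono) (use assms(3) in auto)
  then show ?thesis using J_IBP[OF assms(1-3)] assms(3) by simp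
qed


lemma speed_bound_below:
  obtains c where "c > 0" "\<And>t x. 0 \<le> t \<Longrightarrow> t \<le> U \<Longrightarrow> c \<le> speed t x"
proof -
  have "max U 1 > 0" by (simp add: less_max_iff_disj)
  from speed_lower[OF this] obtain c where "c > 0" "\<forall>t\<in>{0..max U 1}. \<forall>x. c \<le> norm (Dx \<gamma> t x)" by blast
  then show ?thesis by (intro that[of c]) (auto simp: speed_def)
qed

lemma plain_integral_dominated:
  obtains A where "A > 0" "\<And>f g t R. \<lbrakk>continuous_on UNIV f; 0 \<le> t; t \<le> U; R > 0; continuous_on UNIV g; \<And>x. \<bar>f x\<bar> \<le> g x\<rbrakk>
      \<Longrightarrow> 2 / R * integral {-R..R} (\<lambda>x. \<bar>f x\<bar>) \<le> A / R * J t (2 * R) g"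
proof -
  obtain c where c: "c > 0" "\<And>t x. 0 \<le> t \<Longrightarrow> t \<le> U \<Longrightarrow> c \<le> speed t x" using speed_bound_below[of U] by blast
  show ?thesis
  proof (rule that[of "8 / 3 / c"])
    show "8 / 3 / c > 0" using c by simp
    fix f g :: "real \<Rightarrow> real" and t R :: real assume f: "continuous_on UNIV f" and t: "0 \<le> t" "t \<le> U" and R: "R > 0" and g: "continuous_on UNIV g" 
      and le: "\<And>x. \<bar>f x\<bar> \<le> g x"
    have g0: "0 \<le> g x" for x using le[of x] by linarith
    have cf: "continuous_on {-R..R} f" by (rule continuous_on_subset[OF f]) simp
    have "integral {-R..R} (\<lambda>x. \<bar>f x\<bar>) \<le> integral {-R..R} (\<lambda>x. (1/c) * (g x * speed t x))"
    proof (rule integral_le)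
      show "(\<lambda>x. \<bar>f x\<bar>) integrable_on {-R..R}" by (intro integrable_continuous_real continuous_intros cf)
      show "(\<lambda>x. (1/c) * (g x * speed t x)) integrable_on {-R..R}"
        by (intro integrable_continuous_real continuous_intros continuous_on_subset[OF g] cont_speed t) auto
      fix x
      have "c * g x \<le> speed t x * g x" by (intro mult_right_mono c t g0)
      then have "g x \<le> (1/c) * (g x * speed t x)" using c by (simp add: field_simps)
      then show "\<bar>f x\<bar> \<le> (1/c) * (g x * speed t x)" using le[of x] by linarith
    qed
    also have "\<dots> = (1/c) * integral {-R..R} (\<lambda>x. g x * speed t x)" by simp
    also have "\<dots> \<le> (1/c) * (4/3 * J t (2*R) g)"
      by (intro mult_left_mono plain_le_J) (use c t R g g0 in auto)
    finally have "2 / R * integral {-R..R} (\<lambda>x. \<bar>f x\<bar>) \<le> 2 / R * ((1/c) * (4/3 * J t (2*R) g))"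
      by (intro mult_left_mono) (use R in auto)
    also have "\<dots> = 8 / 3 / c / R * J t (2*R) g" by simp
    finally show "2 / R * integral {-R..R} (\<lambda>x. \<bar>f x\<bar>) \<le> 8 / 3 / c / R * J t (2 * R) g" .
  qed
qed

text \<open>
  The boundary term is of order \<open>1/R\<close> if \<open>f\<close> is dominated by an integrable function.
\<close>

lemma J_IBP_dominated:
  obtains A where "A > 0" "\<And>f g t R. \<lbrakk>bsmooth f; 0 \<le> t; t \<le> U; R > 0; continuous_on UNIV g; \<And>x. \<bar>f t x\<bar> \<le> g x\<rbrakk>
      \<Longrightarrow> \<bar>J t R (D f t)\<bar> \<le> A / R * J t (2 * R) g"
proof -
  obtain A where A: "A > 0" "\<And>f g t R. \<lbrakk>continuous_on UNIV f; 0 \<le> t; t \<le> U; R > 0; continuous_on UNIV g; \<And>x. \<bar>f x\<bar> \<le> g x\<rbrakk>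
      \<Longrightarrow> 2 / R * integral {-R..R} (\<lambda>x. \<bar>f x\<bar>) \<le> A / R * J t (2 * R) g"
    using plain_integral_dominated[of U] by blast
  show ?thesis
  proof (rule that[OF A(1)])
    fix f :: "real \<Rightarrow> real \<Rightarrow> real" and g :: "real \<Rightarrow> real" and t R :: real
    assume h: "bsmooth f" "0 \<le> t" "t \<le> U" "R > 0" "continuous_on UNIV g" "\<And>x. \<bar>f t x\<bar> \<le> g x"
    show "\<bar>J t R (D f t)\<bar> \<le> A / R * J t (2 * R) g"
      using J_IBP[OF h(1,2,4)] A(2)[OF bsmooth_cont_x[OF h(1,2)] h(2-6)] by linarith
  qed
qed

text \<open>
  The boundary term still vanishes in the limit if \<open>f\<close> is dominated by a square integrable function \<open>g\<close>: Young's inequality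
  \<open>\<bar>g\<bar> \<le> \<delta> + g\<^sup>2/\<delta>\<close> with \<open>\<delta> = 1/\<surd>R\<close> balances the length of the interval against the slope of the cut-off.
\<close>

lemma J_IBP_sqrt:
  obtains A where "A > 0" "\<And>f g t R B. \<lbrakk>bsmooth f; 0 \<le> t; t \<le> U; R > 0; continuous_on UNIV g; B \<ge> 0; \<And>x. \<bar>f t x\<bar> \<le> B * \<bar>g x\<bar>\<rbrakk>
      \<Longrightarrow> \<bar>J t R (D f t)\<bar> \<le> A * B / sqrt R * (1 + J t (2 * R) (\<lambda>x. (g x)\<^sup>2))"
proof -
  obtain c where c: "c > 0" "\<And>t x. 0 \<le> t \<Longrightarrow> t \<le> U \<Longrightarrow> c \<le> speed t x" using speed_bound_below[of U] by blast
  show ?thesis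
  proof (rule that[of "4 + 8 / 3 / c"])
    show "4 + 8 / 3 / c > 0" using c by (simp add: add_pos_pos)
    fix f :: "real \<Rightarrow> real \<Rightarrow> real" and g :: "real \<Rightarrow> real" and t R B :: real assume f: "bsmooth f" and t: "0 \<le> t" "t \<le> U" and R: "R > 0" and g: "continuous_on UNIV g" 
      and B: "B \<ge> 0" and le: "\<And>x. \<bar>f t x\<bar> \<le> B * \<bar>g x\<bar>"
    have cf: "continuous_on {-R..R} (f t)" by (intro bsmooth_cont_x f t)
    define \<delta> where "\<delta> = 1 / sqrt R"
    have \<delta>: "\<delta> > 0" "\<delta> * \<delta> = 1 / R" using R by (auto simp: \<delta>_def)
    have gi: "(\<lambda>x. (g x)\<^sup>2 * speed t x) integrable_on {-R..R}"
      by (intro integrable_continuous_real continuous_intros continuous_on_subset[OF g] cont_speed t) auto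
    have "integral {-R..R} (\<lambda>x. \<bar>f t x\<bar>) \<le> integral {-R..R} (\<lambda>x. B * \<delta> + (B / \<delta> / c) * ((g x)\<^sup>2 * speed t x))"
    proof (rule integral_le)
      show "(\<lambda>x. \<bar>f t x\<bar>) integrable_on {-R..R}" by (intro integrable_continuous_real continuous_intros cf)
      show "(\<lambda>x. B * \<delta> + (B / \<delta> / c) * ((g x)\<^sup>2 * speed t x)) integrable_on {-R..R}"
        by (intro integrable_continuous_real continuous_intros continuous_on_subset[OF g] cont_speed t) auto
      fix x
      have "2 * (\<delta> * \<bar>g x\<bar>) \<le> \<delta> * \<delta> + (g x)\<^sup>2"
        using zero_le_power2[of "\<delta> - \<bar>g x\<bar>"] by (simp add: power2_eq_square algebra_simps)
      then have "\<delta> * \<bar>g x\<bar> \<le> \<delta> * \<delta> + (g x)\<^sup>2" using \<delta> by (smt (verit) mult_nonneg_nonneg abs_ge_zero)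
      then have 1: "\<bar>g x\<bar> \<le> \<delta> + (g x)\<^sup>2 / \<delta>" using \<delta> by (simp add: field_simps)
      have "c * (g x)\<^sup>2 \<le> speed t x * (g x)\<^sup>2" by (intro mult_right_mono c t) auto
      then have "(g x)\<^sup>2 \<le> (g x)\<^sup>2 * speed t x / c" using c by (simp add: field_simps)
      then have "(g x)\<^sup>2 / \<delta> \<le> (g x)\<^sup>2 * speed t x / c / \<delta>" using \<delta> by (intro divide_right_mono) auto
      then have "\<bar>g x\<bar> \<le> \<delta> + (g x)\<^sup>2 * speed t x / c / \<delta>" using 1 by linarith
      then have "B * \<bar>g x\<bar> \<le> B * (\<delta> + (g x)\<^sup>2 * speed t x / c / \<delta>)" by (intro mult_left_mono B)
      then show "\<bar>f t x\<bar> \<le> B * \<delta> + (B / \<delta> / c) * ((g x)\<^sup>2 * speed t x)" using le[of x] by (simp add: algebra_simps)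
    qed
    also have "\<dots> = 2 * R * (B * \<delta>) + (B / \<delta> / c) * integral {-R..R} (\<lambda>x. (g x)\<^sup>2 * speed t x)"
      using R by (subst integral_add[OF _ integrable_on_mult_right[OF gi]]) auto
    also have "\<dots> \<le> 2 * R * (B * \<delta>) + (B / \<delta> / c) * (4/3 * J t (2*R) (\<lambda>x. (g x)\<^sup>2))"
      by (intro add_left_mono mult_left_mono plain_le_J) (use c t R g B \<delta> in \<open>auto intro!: continuous_intros\<close>)
    finally have "2 / R * integral {-R..R} (\<lambda>x. \<bar>f t x\<bar>) \<le> 2 / R * (2 * R * (B * \<delta>) + (B / \<delta> / c) * (4/3 * J t (2*R) (\<lambda>x. (g x)\<^sup>2)))"
      by (intro mult_left_mono) (use R in auto)
    also have "\<dots> = 4 * B * \<delta> + (\<delta> * \<delta>) * (8 / 3 / c * B / \<delta>) * J t (2*R) (\<lambda>x. (g x)\<^sup>2)"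
      unfolding \<delta>(2) using R by (simp add: field_simps)
    also have "\<dots> = 4 * B * \<delta> + 8 / 3 / c * B * \<delta> * J t (2*R) (\<lambda>x. (g x)\<^sup>2)" using \<delta>(1) by simp
    also have "\<dots> \<le> (4 + 8 / 3 / c) * B * \<delta> * (1 + J t (2*R) (\<lambda>x. (g x)\<^sup>2))"
    proof -
      have "0 \<le> J t (2*R) (\<lambda>x. (g x)\<^sup>2)" by (rule J_nonneg) (use t R g in \<open>auto intro!: continuous_intros\<close>)
      moreover have "0 \<le> 8 / 3 / c * B * \<delta>" "0 \<le> 4 * B * \<delta>" using c B \<delta> by auto
      ultimately have "0 \<le> 8 / 3 / c * B * \<delta> + 4 * B * \<delta> * J t (2*R) (\<lambda>x. (g x)\<^sup>2)"
        by (intro add_nonneg_nonneg mult_nonneg_nonneg[of "4 * B * \<delta>"])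
      moreover have "(4 + k) * B * \<delta> * (1 + j) = 4 * B * \<delta> + k * B * \<delta> * j + (k * B * \<delta> + 4 * B * \<delta> * j)" for k j
        by (simp add: algebra_simps)
      ultimately show ?thesis by simp
    qed
    finally show "\<bar>J t R (D f t)\<bar> \<le> (4 + 8 / 3 / c) * B / sqrt R * (1 + J t (2 * R) (\<lambda>x. (g x)\<^sup>2))"
      using J_IBP[OF f t(1) R] by (simp add: \<delta>_def)
  qed
qed

definition F :: "nat \<Rightarrow> real \<Rightarrow> real \<Rightarrow> real" where
  "F m R t = J t R (\<lambda>x. N m t x \<bullet> N m t x)"

lemma cont_NN: "t \<ge> 0 \<Longrightarrow> continuous_on UNIV (\<lambda>x. N i t x \<bullet> N j t x)"
  by (intro continuous_intros cont_N)

lemma F_nonneg: "t \<ge> 0 \<Longrightarrow> R > 0 \<Longrightarrow> 0 \<le> F m R t"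
  unfolding F_def by (intro J_nonneg cont_NN) auto

lemma F_mono: "t \<ge> 0 \<Longrightarrow> 0 < R \<Longrightarrow> R \<le> R' \<Longrightarrow> F m R t \<le> F m R' t"
  unfolding F_def by (intro J_mono_R cont_NN) auto

lemma J_normal_deriv:
  assumes f: "bsmooth f" "normal_field f" and t: "t \<ge> 0"
  shows "((\<lambda>t. J t R (\<lambda>x. f t x \<bullet> f t x)) has_real_derivative
     J t R (\<lambda>x. 2 * (f t x \<bullet> Nt f t x) - (f t x \<bullet> f t x) * (V t x \<bullet> K t x))) (at t within {0..})"
proof -
  have "Dt (\<lambda>t x. f t x \<bullet> f t x) t x = 2 * (f t x \<bullet> Nt f t x)" for x
    unfolding Dt_inner[OF f(1) f(1) t] Dt_normal[OF f t] using f(2) t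
    by (simp add: normal_field_def inner_diff_left inner_diff_right inner_commute)
  then show ?thesis using J_deriv[OF bsmooth_inner[OF f(1) f(1)] t, of R] by simp
qed

text \<open>
  The flux that collects the boundary terms when \<open>2 \<langle>N m, N (m+2) - N (m+4)\<rangle>\<close> is integrated by parts.
\<close>

definition G :: "nat \<Rightarrow> real \<Rightarrow> real \<Rightarrow> real" where
  "G m t x = 2 * (N (m+1) t x \<bullet> N (m+2) t x) - 2 * (N m t x \<bullet> N (m+3) t x) + 2 * (N m t x \<bullet> N (m+1) t x)"

lemma bsmooth_G: "bsmooth (G m)"
  unfolding G_def[abs_def] by (intro bs_intros)

lemma D_G: assumes t: "t \<ge> 0"
  shows "D (G m) t x = 2 * (N (m+2) t x \<bullet> N (m+2) t x) + 2 * (N (m+1) t x \<bullet> N (m+1) t x)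
     - 2 * (N m t x \<bullet> N (m+4) t x) + 2 * (N m t x \<bullet> N (m+2) t x)"
proof -
  let ?a = "\<lambda>i j t x. 2 *\<^sub>R (N i t x \<bullet> N j t x)"
  have G: "G m = (\<lambda>t x. (?a (m+1) (m+2) t x - ?a m (m+3) t x) + ?a m (m+1) t x)" by (simp add: G_def fun_eq_iff)
  have a: "bsmooth (?a i j)" for i j by (intro bs_intros)
  have "D (?a i j) t x = 2 * (N (Suc i) t x \<bullet> N j t x + N i t x \<bullet> N (Suc j) t x)" for i j
    using D_cscale[OF bsmooth_inner[OF bsmooth_N bsmooth_N] t, of 2 i j x] by (simp add: D_NN[OF t])
  then show ?thesis unfolding G
    by (subst D_add D_diff, (intro a bsmooth_diff t)+)+ (simp add: eval_nat_numeral)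
qed

lemma F_deriv:
  obtains P where "cubic (m + 5) P"
   "\<And>t R. t \<ge> 0 \<Longrightarrow> ((\<lambda>t. F m R t) has_real_derivative
      (- 2 * F (m+2) R t - 2 * F (m+1) R t + J t R (\<lambda>x. 2 * (N m t x \<bullet> P t x) - (N m t x \<bullet> N m t x) * (V t x \<bullet> K t x))
       + J t R (D (G m) t))) (at t within {0..})"
proof -
  obtain P where P: "cubic (m + 5) P" "\<And>t x. t \<ge> 0 \<Longrightarrow> Nt (N m) t x = - N (m + 4) t x + N (m + 2) t x + P t x"
    using evolution_N[of m] by blast
  show ?thesis
  proof (rule that[OF P(1)])
    fix t R :: real assume t: "t \<ge> 0"
    have cP: "continuous_on UNIV (P t)" by (rule bsmooth_cont_x[OF cubic_bsmooth[OF P(1)] t])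
    have cV: "continuous_on UNIV (V t)" "continuous_on UNIV (K t)" by (intro bsmooth_cont_x bs_intros t)+
    have cG: "continuous_on UNIV (D (G m) t)" by (intro bsmooth_cont_x bsmooth_D bsmooth_G t)
    let ?L = "\<lambda>x. 2 * (N m t x \<bullet> P t x) - (N m t x \<bullet> N m t x) * (V t x \<bullet> K t x)"
    have cL: "continuous_on UNIV ?L" by (intro continuous_intros cont_N t cP cV)
    have "(\<lambda>x. 2 * (N m t x \<bullet> Nt (N m) t x) - (N m t x \<bullet> N m t x) * (V t x \<bullet> K t x))
      = (\<lambda>x. ((D (G m) t x - 2 * (N (m+2) t x \<bullet> N (m+2) t x)) - 2 * (N (m+1) t x \<bullet> N (m+1) t x)) + ?L x)"
      unfolding D_G[OF t] P(2)[OF t] by (simp add: inner_add_right fun_eq_iff algebra_simps)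
    then have "J t R (\<lambda>x. 2 * (N m t x \<bullet> Nt (N m) t x) - (N m t x \<bullet> N m t x) * (V t x \<bullet> K t x))
      = J t R (\<lambda>x. ((D (G m) t x - 2 * (N (m+2) t x \<bullet> N (m+2) t x)) - 2 * (N (m+1) t x \<bullet> N (m+1) t x)) + ?L x)"
      by (rule arg_cong)
    also have "\<dots> = ((J t R (D (G m) t) - J t R (\<lambda>x. 2 * (N (m+2) t x \<bullet> N (m+2) t x))) - J t R (\<lambda>x. 2 * (N (m+1) t x \<bullet> N (m+1) t x))) + J t R ?L"
      by (subst J_add J_diff, (intro t continuous_intros cont_N cG cP cV)+)+ simp
    also have "\<dots> = - 2 * F (m+2) R t - 2 * F (m+1) R t + J t R ?L + J t R (D (G m) t)"
      by (simp add: J_cmult F_def)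
    finally show "((\<lambda>t. F m R t) has_real_derivative
      (- 2 * F (m+2) R t - 2 * F (m+1) R t + J t R ?L + J t R (D (G m) t))) (at t within {0..})"
      using J_normal_deriv[OF bsmooth_N normal_N t, of R m] by (simp add: F_def)
  qed
qed

end

section \<open>Cubic curvature terms\<close>

text \<open>
  A list of orders stands for the product of the norms of the corresponding \<open>N i\<close>; the conditions are those of \<open>cubic\<close>.
\<close>

definition monomials :: "nat \<Rightarrow> nat list set" where
  "monomials w = {l. 3 \<le> length l \<and> sum_list (map Suc l) \<le> w}"

lemma length_le_weight: "length l \<le> sum_list (map Suc l)"
  by (induction l) auto

text \<open>
  Every other entry contributes at least \<open>1\<close> to the weight.
\<close>

lemma mem_le_weight: "i \<in> set l \<Longrightarrow> Suc i + (length l - 1) \<le> sum_list (map Suc l)"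
proof (induction l)
  case (Cons a l)
  show ?case
  proof (cases "i = a")
    case True then show ?thesis using length_le_weight[of l] by simp
  next
    case False
    then have "i \<in> set l" using Cons.prems by simp
    moreover from this have "length l > 0" by (cases l) auto
    ultimately show ?thesis using Cons.IH by simp
  qed
qed simp

lemma finite_monomials: "finite (monomials w)"
proof (rule finite_subset)
  show "monomials w \<subseteq> {l. set l \<subseteq> {..w} \<and> length l \<le> w}"
  proof
    fix l assume "l \<in> monomials w"
    then have w: "sum_list (map Suc l) \<le> w" by (simp add: monomials_def)
    have "i \<le> w" if "i \<in> set l" for i using mem_le_weight[OF that] w by linarith
    then show "l \<in> {l. set l \<subseteq> {..w} \<and> length l \<le> w}" using length_le_weight[of l] w by auto
  qed
  show "finite {l. set l \<subseteq> {..w} \<and> length l \<le> w}" by (rule finite_lists_length_le) simp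
qed

lemma deriv_le_integral:
  fixes f :: "real \<Rightarrow> real"
  assumes "0 \<le> a" "a \<le> b" and f: "\<And>t. a \<le> t \<Longrightarrow> t \<le> b \<Longrightarrow> (f has_real_derivative f' t) (at t within {0..})"
    and g: "g integrable_on {a..b}" "\<And>t. a \<le> t \<Longrightarrow> t \<le> b \<Longrightarrow> f' t \<le> g t"
  shows "f b - f a \<le> integral {a..b} g"
proof -
  have "(f' has_integral (f b - f a)) {a..b}"
  proof (rule fundamental_theorem_of_calculus[OF assms(2)])
    fix t assume t: "t \<in> {a..b}"
    then have "(f has_real_derivative f' t) (at t within {a..b})"
      using f[of t] assms(1) by (auto intro: DERIV_subset)
    then show "(f has_vector_derivative f' t) (at t within {a..b})"
      by (simp add: has_real_derivative_iff_has_vector_derivative)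
  qed
  then show ?thesis by (rule has_integral_le[OF _ integrable_integral[OF g(1)]]) (use g(2) in auto)
qed

lemma le_of_vanishing_error:
  fixes x y C :: real
  assumes "\<And>R. R \<ge> R0 \<Longrightarrow> x \<le> y + C / sqrt R"
  shows "x \<le> y"
proof (rule tendsto_lowerbound)
  have "((\<lambda>R. C / sqrt R) \<longlongrightarrow> 0) at_top"
    by (rule tendsto_divide_0[OF tendsto_const filterlim_at_top_imp_at_infinity[OF sqrt_at_top]])
  then show "((\<lambda>R. y + C / sqrt R) \<longlongrightarrow> y) at_top"
    using tendsto_add[OF tendsto_const] by fastforce
  show "\<forall>\<^sub>F R in at_top. x \<le> y + C / sqrt R"
    using assms eventually_at_top_linorder by blast
qed simp

context bounded_flow
begin

definition mon :: "nat list \<Rightarrow> real \<Rightarrow> real \<Rightarrow> real" where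
  "mon l t x = prod_list (map (\<lambda>i. norm (N i t x)) l)"

definition S :: "nat \<Rightarrow> real \<Rightarrow> real \<Rightarrow> real" where
  "S w t x = (\<Sum>l\<in>monomials w. mon l t x)"

lemma mon_nonneg: "0 \<le> mon l t x"
  unfolding mon_def by (induction l) auto

lemma S_nonneg: "0 \<le> S w t x"
  unfolding S_def by (intro sum_nonneg mon_nonneg)

lemma cont_mon: "t \<ge> 0 \<Longrightarrow> continuous_on A (mon l t)"
  unfolding mon_def by (induction l) (auto intro!: continuous_intros cont_N)

lemma cubic_bound:
  assumes "cubic w P" shows "\<exists>C\<ge>0. \<forall>t x. norm (P t x) \<le> C * S w t x"
  using assms
proof (induction rule: cubic.induct)
  case (tri i j k w)
  have "norm ((N i t x \<bullet> N j t x) *\<^sub>R N k t x) \<le> 1 * S w t x" for t x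
  proof -
    have "norm ((N i t x \<bullet> N j t x) *\<^sub>R N k t x) \<le> (norm (N i t x) * norm (N j t x)) * norm (N k t x)"
      unfolding norm_scaleR by (intro mult_right_mono Cauchy_Schwarz_ineq2) simp
    also have "\<dots> = mon [i, j, k] t x" by (simp add: mon_def)
    also have "\<dots> \<le> S w t x" unfolding S_def
      by (rule member_le_sum) (use tri finite_monomials mon_nonneg in \<open>auto simp: monomials_def\<close>)
    finally show ?thesis by simp
  qed
  then show ?case by (intro exI[of _ 1]) auto
next
  case (mul w f i j w')
  then obtain C where C: "C \<ge> 0" "\<And>t x. norm (f t x) \<le> C * S w t x" by blast
  have "norm ((N i t x \<bullet> N j t x) *\<^sub>R f t x) \<le> C * S w' t x" for t x
  proof -
    let ?h = "\<lambda>l. i # j # l"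
    have "norm ((N i t x \<bullet> N j t x) *\<^sub>R f t x) \<le> (norm (N i t x) * norm (N j t x)) * (C * S w t x)"
      unfolding norm_scaleR by (intro mult_mono C Cauchy_Schwarz_ineq2) auto
    also have "\<dots> = C * (\<Sum>l\<in>monomials w. mon (?h l) t x)"
      by (simp add: S_def mon_def sum_distrib_left algebra_simps)
    also have "(\<Sum>l\<in>monomials w. mon (?h l) t x) = (\<Sum>l\<in>?h ` monomials w. mon l t x)"
      by (subst sum.reindex) (auto simp: inj_on_def)
    also have "\<dots> \<le> S w' t x" unfolding S_def
      by (rule sum_mono2) (use mul finite_monomials mon_nonneg in \<open>auto simp: monomials_def\<close>)
    finally show ?thesis using C(1) by (simp add: mult_left_mono)
  qed
  then show ?case using C(1) by blast
next
  case (add w f g)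
  then obtain C D where C: "C \<ge> 0" "\<And>t x. norm (f t x) \<le> C * S w t x" "D \<ge> 0" "\<And>t x. norm (g t x) \<le> D * S w t x" by blast
  have "norm (f t x + g t x) \<le> (C + D) * S w t x" for t x
    using norm_triangle_ineq[of "f t x" "g t x"] C(2)[of t x] C(4)[of t x] by (simp add: distrib_right)
  then show ?case using C by (intro exI[of _ "C + D"]) auto
next
  case (scale w f c)
  then obtain C where C: "C \<ge> 0" "\<And>t x. norm (f t x) \<le> C * S w t x" by blast
  have "norm (c *\<^sub>R f t x) \<le> (\<bar>c\<bar> * C) * S w t x" for t x
    unfolding norm_scaleR mult.assoc by (intro mult_left_mono C) simp
  then show ?case using C by (intro exI[of _ "\<bar>c\<bar> * C"]) auto
qed

lemma N_bounds:
  obtains B where "B \<ge> 1" "\<And>j t x. j \<le> m \<Longrightarrow> 0 \<le> t \<Longrightarrow> t \<le> U \<Longrightarrow> norm (N j t x) \<le> B"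
proof -
  have "\<exists>B. \<forall>j. B j \<ge> 1 \<and> (\<forall>t x. 0 \<le> t \<longrightarrow> t \<le> U \<longrightarrow> norm (N j t x) \<le> B j)"
    by (rule choice) (metis bsmooth_bound[OF bsmooth_N])
  then obtain B where B: "\<And>j. B j \<ge> 1" "\<And>j t x. 0 \<le> t \<Longrightarrow> t \<le> U \<Longrightarrow> norm (N j t x) \<le> B j" by blast
  have "B j \<le> sum B {..m}" if "j \<le> m" for j
    by (rule member_le_sum) (use that B(1) in \<open>auto intro: order_trans[OF zero_le_one]\<close>)
  then show ?thesis using B by (intro that[of "sum B {..m}"]) (meson order_trans le0)+
qed

text \<open>
  The weight limits every order to \<open>m + 2\<close>; all factors but one are estimated by \<open>B\<close>.
\<close>

lemma mon_le_linear:
  assumes B: "B \<ge> 1" "\<And>j. j \<le> m + 2 \<Longrightarrow> norm (N j t x) \<le> B" and l: "l \<in> monomials (m + 5)"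
  shows "mon l t x \<le> B ^ (m + 5) * (\<Sum>j\<le>m+2. norm (N j t x))"
proof -
  from l obtain a r where ar: "l = a # r" by (cases l) (auto simp: monomials_def)
  have small: "i \<le> m + 2" if "i \<in> set l" for i
    using mem_le_weight[OF that] l by (auto simp: monomials_def)
  have r: "mon r t x \<le> B ^ length r" if "\<And>i. i \<in> set r \<Longrightarrow> i \<le> m + 2" for r
    using that
  proof (induction r)
    case (Cons b r)
    have "norm (N b t x) * mon r t x \<le> B * B ^ length r"
      by (intro mult_mono Cons.IH B(2)) (use Cons.prems B(1) mon_nonneg in auto)
    then show ?case by (simp add: mon_def)
  qed (simp add: mon_def)
  have "length l \<le> m + 5" using length_le_weight[of l] l by (simp add: monomials_def)
  then have len: "length r \<le> m + 5" using ar by simp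
  have "mon l t x = norm (N a t x) * mon r t x" by (simp add: ar mon_def)
  also have "\<dots> \<le> norm (N a t x) * B ^ (m + 5)"
    by (intro mult_left_mono order_trans[OF r power_increasing]) (use small ar len B(1) in auto)
  also have "\<dots> \<le> (\<Sum>j\<le>m+2. norm (N j t x)) * B ^ (m + 5)"
    by (intro mult_right_mono member_le_sum) (use small ar B(1) in auto)
  finally show ?thesis by (simp add: mult.commute)
qed

lemma cubic_le_linear:
  assumes P: "cubic (m + 5) P"
  obtains C where "C \<ge> 0" "\<And>t x. 0 \<le> t \<Longrightarrow> t \<le> U \<Longrightarrow> norm (P t x) \<le> C * (\<Sum>j\<le>m+2. norm (N j t x))"
proof -
  obtain C where C: "C \<ge> 0" "\<And>t x. norm (P t x) \<le> C * S (m+5) t x" using cubic_bound[OF P] by blast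
  obtain B where B: "B \<ge> 1" "\<And>j t x. j \<le> m + 2 \<Longrightarrow> 0 \<le> t \<Longrightarrow> t \<le> U \<Longrightarrow> norm (N j t x) \<le> B" using N_bounds[of "m+2" U] by blast
  let ?n = "real (card (monomials (m+5)))"
  show ?thesis
  proof (rule that[of "C * (?n * B ^ (m+5))"])
    show "0 \<le> C * (?n * B ^ (m+5))" using C B(1) by simp
    fix t x :: real assume t: "0 \<le> t" "t \<le> U"
    have "S (m+5) t x \<le> ?n * (B ^ (m + 5) * (\<Sum>j\<le>m+2. norm (N j t x)))"
      unfolding S_def by (rule sum_bounded_above) (rule mon_le_linear[OF B(1) B(2)[OF _ t]])
    then have "C * S (m+5) t x \<le> C * (?n * (B ^ (m + 5) * (\<Sum>j\<le>m+2. norm (N j t x))))"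
      by (rule mult_left_mono[OF _ C(1)])
    then show "norm (P t x) \<le> C * (?n * B ^ (m+5)) * (\<Sum>j\<le>m+2. norm (N j t x))"
      using C(2)[of t x] by (simp add: algebra_simps)
  qed
qed

text \<open>
  On a bounded time interval all \<open>N j\<close> are bounded, so the cubic terms are dominated linearly and Young's inequality
  absorbs the orders \<open>m + 1\<close> and \<open>m + 2\<close> into the good terms. The flux \<open>G m\<close> is merely bounded here, so the
  boundary terms are of order one; this suffices for finiteness.
\<close>

lemma F_deriv_qualitative:
  obtains C where "C \<ge> 0" "\<And>t R. 0 \<le> t \<Longrightarrow> t \<le> U \<Longrightarrow> R > 0 \<Longrightarrow>
     \<exists>d. ((\<lambda>t. F m R t) has_real_derivative d) (at t within {0..}) \<and>
         d \<le> - F (m+2) R t - F (m+1) R t + C * (1 + (\<Sum>j\<le>m. F j R t))"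
proof -
  obtain P where P: "cubic (m + 5) P"
   "\<And>t R. t \<ge> 0 \<Longrightarrow> ((\<lambda>t. F m R t) has_real_derivative
      (- 2 * F (m+2) R t - 2 * F (m+1) R t + J t R (\<lambda>x. 2 * (N m t x \<bullet> P t x) - (N m t x \<bullet> N m t x) * (V t x \<bullet> K t x))
       + J t R (D (G m) t))) (at t within {0..})" using F_deriv[of m] by blast
  obtain C1 where C1: "C1 \<ge> 0" "\<And>t x. 0 \<le> t \<Longrightarrow> t \<le> U \<Longrightarrow> norm (P t x) \<le> C1 * (\<Sum>j\<le>m+2. norm (N j t x))"
    using cubic_le_linear[OF P(1), of U] by blast
  obtain B1 where B1: "B1 \<ge> 1" "\<And>t x. 0 \<le> t \<Longrightarrow> t \<le> U \<Longrightarrow> norm (V t x \<bullet> K t x) \<le> B1"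
    using bsmooth_bound[OF bsmooth_inner[OF smooth_t bsmooth_K]] by blast
  obtain B2 where B2: "B2 \<ge> 1" "\<And>t x. 0 \<le> t \<Longrightarrow> t \<le> U \<Longrightarrow> norm (G m t x) \<le> B2"
    using bsmooth_bound[OF bsmooth_G] by blast
  define C where "C = (C1 * (m + 2) + 2 * C1\<^sup>2 + B1) + 4 * B2"
  show ?thesis
  proof (rule that[of C])
    show "C \<ge> 0" using C1 B1 B2 by (simp add: C_def)
    fix t R :: real assume t: "0 \<le> t" "t \<le> U" and R: "R > 0"
    let ?L = "\<lambda>x. 2 * (N m t x \<bullet> P t x) - (N m t x \<bullet> N m t x) * (V t x \<bullet> K t x)"
    let ?d = "- 2 * F (m+2) R t - 2 * F (m+1) R t + J t R ?L + J t R (D (G m) t)"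
    let ?n = "\<lambda>j x. N j t x \<bullet> N j t x"
    let ?M = "\<lambda>x. (?n (m+2) x + ?n (m+1) x) + (C1 * (m + 2) + 2 * C1\<^sup>2 + B1) * (\<Sum>j\<le>m. ?n j x)"
    have pt: "?L x \<le> ?M x" for x
    proof -
      let ?a = "\<lambda>j. norm (N j t x)"
      have n: "?n j x = (?a j)\<^sup>2" for j by (simp add: dot_square_norm)
      let ?q = "\<Sum>j\<le>m. (?a j)\<^sup>2"
      have am: "(?a m)\<^sup>2 \<le> ?q" by (rule member_le_sum) auto
      have "N m t x \<bullet> P t x \<le> ?a m * (C1 * (\<Sum>j\<le>m+2. ?a j))"
        by (rule order_trans[OF norm_cauchy_schwarz]) (intro mult_left_mono C1(2) t, simp)
      then have 1: "2 * (N m t x \<bullet> P t x) \<le> C1 * (2 * ?a m * (\<Sum>j\<le>m. ?a j)) + 2 * (C1 * ?a m) * ?a (m+1) + 2 * (C1 * ?a m) * ?a (m+2)"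
        by (simp add: algebra_simps)
      have "2 * ?a m * ?a j \<le> ?q + (?a j)\<^sup>2" for j
        using am zero_le_power2[of "?a m - ?a j"] by (simp add: power2_diff)
      then have "(\<Sum>j\<le>m. 2 * ?a m * ?a j) \<le> (\<Sum>j\<le>m. ?q + (?a j)\<^sup>2)" by (intro sum_mono)
      then have 2: "2 * ?a m * (\<Sum>j\<le>m. ?a j) \<le> (m + 2) * ?q"
        by (simp add: sum_distrib_left sum.distrib algebra_simps)
      have 3: "2 * (C1 * ?a m) * b \<le> b\<^sup>2 + C1\<^sup>2 * ?q" for b
      proof -
        have "2 * (C1 * ?a m) * b \<le> b\<^sup>2 + C1\<^sup>2 * (?a m)\<^sup>2"
          using zero_le_power2[of "b - C1 * ?a m"] by (simp add: power2_diff power_mult_distrib algebra_simps)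
        then show ?thesis using mult_left_mono[OF am, of "C1\<^sup>2"] by simp
      qed
      have "- (?n m x * (V t x \<bullet> K t x)) \<le> (?a m)\<^sup>2 * B1"
        using B1(2)[OF t, of x] mult_left_mono[of "- (V t x \<bullet> K t x)" B1 "(?a m)\<^sup>2"] by (simp add: n abs_le_iff)
      also have "\<dots> \<le> B1 * ?q" using mult_right_mono[OF am, of B1] B1(1) by (simp add: mult.commute)
      finally have 4: "- (?n m x * (V t x \<bullet> K t x)) \<le> B1 * ?q" .
      have h2: "C1 * (2 * ?a m * (\<Sum>j\<le>m. ?a j)) \<le> C1 * ((m + 2) * ?q)" by (rule mult_left_mono[OF 2 C1(1)])
      have "?L x \<le> C1 * ((m + 2) * ?q) + ((?a (m+1))\<^sup>2 + C1\<^sup>2 * ?q) + ((?a (m+2))\<^sup>2 + C1\<^sup>2 * ?q) + B1 * ?q"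
        using 1 h2 3[of "?a (m+1)"] 3[of "?a (m+2)"] 4 by linarith
      then show ?thesis unfolding n by (simp add: algebra_simps)
    qed
    have cP: "continuous_on UNIV (P t)" by (rule bsmooth_cont_x[OF cubic_bsmooth[OF P(1)] t(1)])
    have cV: "continuous_on UNIV (V t)" "continuous_on UNIV (K t)" by (intro bsmooth_cont_x bs_intros t)+
    have "J t R ?L \<le> J t R ?M"
      by (rule J_mono[OF t(1) R _ _ pt]) (intro continuous_intros cont_N t cP cV)+
    also have "\<dots> = (F (m+2) R t + F (m+1) R t) + (C1 * (m + 2) + 2 * C1\<^sup>2 + B1) * (\<Sum>j\<le>m. F j R t)"
      by (subst J_add, (intro t continuous_intros cont_N)+)+ (simp add: J_cmult J_sum t cont_NN F_def)
    finally have L: "J t R ?L \<le> (F (m+2) R t + F (m+1) R t) + (C1 * (m + 2) + 2 * C1\<^sup>2 + B1) * (\<Sum>j\<le>m. F j R t)" .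
    have "\<bar>J t R (D (G m) t)\<bar> \<le> 4 * B2"
      by (rule J_IBP_bounded[OF bsmooth_G t(1) R]) (use B2(2)[OF t] in simp)
    moreover have "(C1 * (m + 2) + 2 * C1\<^sup>2 + B1) * (\<Sum>j\<le>m. F j R t) + 4 * B2 \<le> C * (1 + (\<Sum>j\<le>m. F j R t))"
    proof -
      have "0 \<le> (\<Sum>j\<le>m. F j R t)" by (intro sum_nonneg F_nonneg t R)
      then have "0 \<le> 4 * B2 * (\<Sum>j\<le>m. F j R t)" "0 \<le> C1 * (m + 2) + 2 * C1\<^sup>2 + B1" using C1 B1 B2 by auto
      then show ?thesis unfolding C_def by (simp add: algebra_simps)
    qed
    ultimately have "?d \<le> - F (m+2) R t - F (m+1) R t + C * (1 + (\<Sum>j\<le>m. F j R t))" using L by linarith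
    then show "\<exists>d. ((\<lambda>t. F m R t) has_real_derivative d) (at t within {0..}) \<and>
         d \<le> - F (m+2) R t - F (m+1) R t + C * (1 + (\<Sum>j\<le>m. F j R t))"
      using P(2)[OF t(1), of R] by blast
  qed
qed

lemma J_cont_t: "bsmooth f \<Longrightarrow> A \<subseteq> {0..} \<Longrightarrow> continuous_on A (\<lambda>t. J t R (f t))"
  by (rule continuous_on_subset[of "{0..}"], rule DERIV_continuous_on, rule J_deriv) auto

lemma F_cont_t: "A \<subseteq> {0..} \<Longrightarrow> continuous_on A (\<lambda>t. F m R t)"
  unfolding F_def by (rule J_cont_t[of "\<lambda>t x. N m t x \<bullet> N m t x"]) (intro bs_intros)

lemma F_integrable: "0 \<le> a \<Longrightarrow> (\<lambda>t. F m R t) integrable_on {a..b}"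
  by (intro integrable_continuous_real F_cont_t) auto

end

section \<open>Energy dissipation and smoothing\<close>

context bounded_flow
begin

text \<open>
  Integration in time of \<open>F_deriv_qualitative\<close>, keeping the good term of order \<open>m + 1\<close>.
\<close>

lemma F_integral_bound:
  assumes a: "0 \<le> a" and F: "\<And>j t R. \<lbrakk>j \<le> m; a \<le> t; t \<le> U; R > 0\<rbrakk> \<Longrightarrow> F j R t \<le> C"
  shows "\<exists>C'. \<forall>t1 t2 R. a \<le> t1 \<longrightarrow> t1 \<le> t2 \<longrightarrow> t2 \<le> U \<longrightarrow> R > 0 \<longrightarrow> integral {t1..t2} (\<lambda>t. F (m+1) R t) \<le> C'"
proof -
  obtain C1 where C1: "C1 \<ge> 0" "\<And>t R. 0 \<le> t \<Longrightarrow> t \<le> U \<Longrightarrow> R > 0 \<Longrightarrow>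
     \<exists>d. ((\<lambda>t. F m R t) has_real_derivative d) (at t within {0..}) \<and>
         d \<le> - F (m+2) R t - F (m+1) R t + C1 * (1 + (\<Sum>j\<le>m. F j R t))"
    using F_deriv_qualitative[of U m] by blast
  define C2 where "C2 = C1 * (1 + (m+1) * C)"
  have "integral {t1..t2} (\<lambda>t. F (m+1) R t) \<le> C + \<bar>C2\<bar> * (U - a)" if t: "a \<le> t1" "t1 \<le> t2" "t2 \<le> U" and R: "R > 0" for t1 t2 R
  proof -
    have "\<forall>t. t1 \<le> t \<and> t \<le> t2 \<longrightarrow> (\<exists>d. ((\<lambda>t. F m R t) has_real_derivative d) (at t within {0..}) \<and>
         d \<le> C2 - F (m+1) R t)"
    proof (intro allI impI)
      fix t assume s: "t1 \<le> t \<and> t \<le> t2"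
      then have t0: "0 \<le> t" "t \<le> U" "a \<le> t" using t a by auto
      obtain d where d: "((\<lambda>t. F m R t) has_real_derivative d) (at t within {0..})"
         "d \<le> - F (m+2) R t - F (m+1) R t + C1 * (1 + (\<Sum>j\<le>m. F j R t))"
        using C1(2)[OF t0(1,2) R] by blast
      have "(\<Sum>j\<le>m. F j R t) \<le> (\<Sum>j\<le>m. C)" by (intro sum_mono F t0 R) auto
      then have "C1 * (1 + (\<Sum>j\<le>m. F j R t)) \<le> C2" unfolding C2_def by (intro mult_left_mono C1(1)) (simp add: algebra_simps)
      then show "\<exists>d. ((\<lambda>t. F m R t) has_real_derivative d) (at t within {0..}) \<and> d \<le> C2 - F (m+1) R t"
        using d F_nonneg[OF t0(1) R, of "m+2"] by (intro exI[of _ d]) auto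
    qed
    then obtain d where d: "\<And>t. t1 \<le> t \<Longrightarrow> t \<le> t2 \<Longrightarrow> ((\<lambda>t. F m R t) has_real_derivative d t) (at t within {0..})"
        "\<And>t. t1 \<le> t \<Longrightarrow> t \<le> t2 \<Longrightarrow> d t \<le> C2 - F (m+1) R t" by metis
    have i: "(\<lambda>t. F (m+1) R t) integrable_on {t1..t2}" by (rule F_integrable) (use t a in auto)
    have "F m R t2 - F m R t1 \<le> integral {t1..t2} (\<lambda>t. C2 - F (m+1) R t)"
      by (rule deriv_le_integral[of t1 t2 _ d]) (use t a d i in \<open>auto intro: integrable_diff\<close>)
    also have "\<dots> = C2 * (t2 - t1) - integral {t1..t2} (\<lambda>t. F (m+1) R t)"
      using t by (subst integral_diff[OF _ i]) auto
    finally have "integral {t1..t2} (\<lambda>t. F (m+1) R t) \<le> F m R t1 - F m R t2 + C2 * (t2 - t1)" by linarith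
    also have "C2 * (t2 - t1) \<le> \<bar>C2\<bar> * (U - a)" by (intro mult_mono) (use t in auto)
    finally show ?thesis using F[of m t1 R] F_nonneg[of t2 R m] t R a by auto
  qed
  then show ?thesis by blast
qed

end

locale finite_energy_flow = bounded_flow \<gamma> for \<gamma> :: "real \<Rightarrow> real \<Rightarrow> 'a::euclidean_space" +
  fixes e :: 'a and E0 :: real
  assumes norm_e: "norm e = 1"
    and initial_energy: "\<And>R. R > 0 \<Longrightarrow> J 0 R (\<lambda>x. 1/2 * (K 0 x \<bullet> K 0 x) + (1 - T 0 x \<bullet> e)) \<le> E0"
begin

text \<open>
  The energy density, because \<open>\<bar>T - e\<bar>\<^sup>2 = 2 (1 - \<langle>T, e\<rangle>)\<close>.
\<close>

definition dens :: "real \<Rightarrow> real \<Rightarrow> real" where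
  "dens t x = 1/2 * (K t x \<bullet> K t x) + (1 - T t x \<bullet> e)"

definition E :: "real \<Rightarrow> real \<Rightarrow> real" where "E R t = J t R (dens t)"

definition Te :: "real \<Rightarrow> real \<Rightarrow> 'a" where "Te t x = T t x - e"

lemma bsmooth_dens: "bsmooth dens"
  unfolding dens_def[abs_def] by (intro bs_intros)

lemma bsmooth_Te: "bsmooth Te"
  unfolding Te_def[abs_def] by (intro bs_intros)

lemma e_e: "e \<bullet> e = 1" using norm_e by (simp add: norm_eq_sqrt_inner)

lemma Te_Te: "t \<ge> 0 \<Longrightarrow> Te t x \<bullet> Te t x = 2 * (1 - T t x \<bullet> e)"
  by (simp add: Te_def inner_diff_left inner_diff_right T_T e_e inner_commute)

lemma T_e_le: "t \<ge> 0 \<Longrightarrow> T t x \<bullet> e \<le> 1" "t \<ge> 0 \<Longrightarrow> -1 \<le> T t x \<bullet> e"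
  using Cauchy_Schwarz_ineq2[of "T t x" e] norm_T[of t x] norm_e by auto

lemma dens_bounds: 
  assumes "t \<ge> 0" shows "0 \<le> dens t x" "K t x \<bullet> K t x \<le> 2 * dens t x" "Te t x \<bullet> Te t x \<le> 2 * dens t x"
  using T_e_le(1)[OF assms, of x] Te_Te[OF assms, of x] inner_ge_zero[of "K t x"] by (auto simp: dens_def)

lemma E_nonneg: "t \<ge> 0 \<Longrightarrow> R > 0 \<Longrightarrow> 0 \<le> E R t"
  unfolding E_def by (intro J_nonneg bsmooth_cont_x bsmooth_dens dens_bounds)

lemma E_mono: "t \<ge> 0 \<Longrightarrow> 0 < R \<Longrightarrow> R \<le> R' \<Longrightarrow> E R t \<le> E R' t"
  unfolding E_def by (intro J_mono_R bsmooth_cont_x bsmooth_dens dens_bounds)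

lemma F0_le_E: assumes "t \<ge> 0" "R > 0" shows "F 0 R t \<le> 2 * E R t"
proof -
  have "F 0 R t \<le> J t R (\<lambda>x. 2 * dens t x)"
    unfolding F_def N_0 by (intro J_mono assms continuous_intros bsmooth_cont_x bsmooth_K bsmooth_dens dens_bounds)
  then show ?thesis by (simp add: J_cmult E_def)
qed

lemma Te_le_E: assumes "t \<ge> 0" "R > 0" shows "J t R (\<lambda>x. Te t x \<bullet> Te t x) \<le> 2 * E R t"
proof -
  have "J t R (\<lambda>x. Te t x \<bullet> Te t x) \<le> J t R (\<lambda>x. 2 * dens t x)"
    by (intro J_mono assms continuous_intros bsmooth_cont_x bsmooth_Te bsmooth_dens dens_bounds)
  then show ?thesis by (simp add: J_cmult E_def)
qed


text \<open>
  The fluxes of the first variation of the energy. They contain the factors \<open>\<kappa>\<close>, \<open>\<nabla>\<^sub>s\<kappa>\<close> and, as \<open>V\<close> is normal, \<open>T - e\<close>.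
\<close>

definition h1 :: "real \<Rightarrow> real \<Rightarrow> real" where "h1 t x = K t x \<bullet> Nd V t x"
definition h2 :: "real \<Rightarrow> real \<Rightarrow> real" where "h2 t x = N 1 t x \<bullet> V t x"
definition h3 :: "real \<Rightarrow> real \<Rightarrow> real" where "h3 t x = V t x \<bullet> e"

lemma bsmooth_h: "bsmooth h1" "bsmooth h2" "bsmooth h3"
  unfolding h1_def[abs_def] h2_def[abs_def] h3_def[abs_def] by (intro bs_intros)+

text \<open>
  Up to the three fluxes, the energy density together with the length element changes at rate \<open>- \<bar>V\<bar>\<^sup>2\<close>.
\<close>

lemma first_variation:
  assumes t: "t \<ge> 0"
  shows "Dt dens t x - dens t x * (V t x \<bullet> K t x) = ((D h1 t x - D h2 t x) - D h3 t x) - V t x \<bullet> V t x"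
proof -
  have "Dt dens t x = 1/2 * (K t x \<bullet> Dt K t x + Dt K t x \<bullet> K t x) + (0 - Dt T t x \<bullet> e)"
    unfolding dens_def[abs_def]
    by (intro Dt_eqI[OF t] has_vector_derivative_add has_vector_derivative_diff has_vector_derivative_const
       has_vector_derivative_mult_right bounded_bilinear.has_vector_derivative[OF bounded_bilinear_inner]
       bounded_linear.has_vector_derivative[OF bounded_linear_inner_left] bsmooth_deriv(1)[OF _ t] bsmooth_K bsmooth_T)
  also have "\<dots> = K t x \<bullet> Dt K t x - Nd V t x \<bullet> e" by (simp add: inner_commute Dt_T[OF t])
  also have "K t x \<bullet> Dt K t x = K t x \<bullet> Nd (Nd V) t x + (V t x \<bullet> K t x) * (K t x \<bullet> K t x)"
    unfolding Dt_normal[OF bsmooth_K normal_K t] Nt_K[OF t]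
    using normal_K t by (simp add: inner_add_right inner_diff_right normal_field_def)
  finally have 1: "Dt dens t x = K t x \<bullet> Nd (Nd V) t x + (V t x \<bullet> K t x) * (K t x \<bullet> K t x) - Nd V t x \<bullet> e" by simp
  have 2: "D h1 t x = N 1 t x \<bullet> Nd V t x + K t x \<bullet> Nd (Nd V) t x"
    unfolding h1_def[abs_def] using D_inner_normal[OF bsmooth_K normal_K bsmooth_Nd[OF smooth_t] normal_Nd t, of x]
    by (simp add: N_0 N_Suc)
  have 3: "D h2 t x = N 2 t x \<bullet> V t x + N 1 t x \<bullet> Nd V t x"
    unfolding h2_def[abs_def] using D_inner_normal[OF bsmooth_N normal_N smooth_t normal_V t, of 1 x]
    by (simp add: N_Suc numeral_2_eq_2)
  have "D h3 t x = V t x \<bullet> D (\<lambda>t x. e) t x + D V t x \<bullet> e"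
    unfolding h3_def[abs_def] by (rule D_inner[OF smooth_t bsmooth_const t])
  then have 4: "D h3 t x = Nd V t x \<bullet> e - (V t x \<bullet> K t x) * (T t x \<bullet> e)"
    unfolding D_normal(2)[OF smooth_t normal_V t] by (simp add: inner_diff_left)
  have "V t x \<bullet> V t x = V t x \<bullet> (- N 2 t x - (1/2 * (K t x \<bullet> K t x)) *\<^sub>R K t x + K t x)"
    by (subst (2) V_eq[OF t]) (simp add: N_0)
  also have "\<dots> = - (N 2 t x \<bullet> V t x) - 1/2 * (K t x \<bullet> K t x) * (V t x \<bullet> K t x) + V t x \<bullet> K t x"
    by (simp add: inner_add_right inner_diff_right inner_commute)
  finally show ?thesis unfolding 1 2 3 4 dens_def by (simp add: algebra_simps)
qed

lemma cont_VV: "t \<ge> 0 \<Longrightarrow> continuous_on A (\<lambda>x. V t x \<bullet> V t x)"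
  by (intro continuous_intros bsmooth_cont_x smooth_t)

lemma E_deriv:
  assumes t: "t \<ge> 0"
  shows "((\<lambda>t. E R t) has_real_derivative (J t R (D h1 t) - J t R (D h2 t) - J t R (D h3 t) - J t R (\<lambda>x. V t x \<bullet> V t x))) (at t within {0..})"
proof -
  have c: "continuous_on UNIV (D h1 t)" "continuous_on UNIV (D h2 t)" "continuous_on UNIV (D h3 t)"
    by (intro bsmooth_cont_x bsmooth_D bsmooth_h t)+
  have "J t R (\<lambda>x. Dt dens t x - dens t x * (V t x \<bullet> K t x)) = J t R (D h1 t) - J t R (D h2 t) - J t R (D h3 t) - J t R (\<lambda>x. V t x \<bullet> V t x)"
    unfolding first_variation[OF t] by (subst J_diff, (intro t continuous_intros c cont_VV)+)+ simp
  then show ?thesis using J_deriv[OF bsmooth_dens t, of R] by (simp add: E_def)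
qed

text \<open>
  With bounded fluxes the boundary terms are of order one, which already shows that the energy stays finite.
\<close>

lemma E_bounded_on_interval:
  shows "\<exists>C\<ge>0. \<forall>t R. 0 \<le> t \<longrightarrow> t \<le> U \<longrightarrow> R > 0 \<longrightarrow> E R t \<le> C"
proof -
  obtain B1 where B1: "B1 \<ge> 1" "\<And>t x. 0 \<le> t \<Longrightarrow> t \<le> U \<Longrightarrow> norm (h1 t x) \<le> B1" using bsmooth_bound[OF bsmooth_h(1)] by blast
  obtain B2 where B2: "B2 \<ge> 1" "\<And>t x. 0 \<le> t \<Longrightarrow> t \<le> U \<Longrightarrow> norm (h2 t x) \<le> B2" using bsmooth_bound[OF bsmooth_h(2)] by blast
  obtain B3 where B3: "B3 \<ge> 1" "\<And>t x. 0 \<le> t \<Longrightarrow> t \<le> U \<Longrightarrow> norm (h3 t x) \<le> B3" using bsmooth_bound[OF bsmooth_h(3)] by blast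
  let ?B = "4 * B1 + 4 * B2 + 4 * B3"
  have "E R t \<le> max 0 (E0 + ?B * \<bar>U\<bar>)" if t: "0 \<le> t" "t \<le> U" and R: "R > 0" for t R
  proof -
    have "E R t - E R 0 \<le> integral {0..t} (\<lambda>t. ?B)"
    proof (rule deriv_le_integral[OF order_refl t(1)])
      fix s assume s: "0 \<le> s" "s \<le> t"
      show "((\<lambda>t. E R t) has_real_derivative (J s R (D h1 s) - J s R (D h2 s) - J s R (D h3 s) - J s R (\<lambda>x. V s x \<bullet> V s x))) (at s within {0..})"
        by (rule E_deriv[OF s(1)])
      have sU: "s \<le> U" using s t by simp
      have "\<bar>J s R (D h1 s)\<bar> \<le> 4 * B1" "\<bar>J s R (D h2 s)\<bar> \<le> 4 * B2" "\<bar>J s R (D h3 s)\<bar> \<le> 4 * B3"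
        using B1(2)[OF s(1) sU] B2(2)[OF s(1) sU] B3(2)[OF s(1) sU]
        by (auto intro!: J_IBP_bounded bsmooth_h s R)
      moreover have "0 \<le> J s R (\<lambda>x. V s x \<bullet> V s x)" by (intro J_nonneg s R cont_VV) auto
      ultimately show "J s R (D h1 s) - J s R (D h2 s) - J s R (D h3 s) - J s R (\<lambda>x. V s x \<bullet> V s x) \<le> ?B" by linarith
    qed auto
    also have "\<dots> = ?B * t" using t by simp
    also have "\<dots> \<le> ?B * \<bar>U\<bar>" using t B1(1) B2(1) B3(1) by (intro mult_left_mono) auto
    finally show ?thesis using initial_energy[OF R] by (simp add: E_def dens_def[abs_def])
  qed
  then show ?thesis by (intro exI[of _ "max 0 (E0 + ?B * \<bar>U\<bar>)"]) auto
qed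

text \<open>
  Now \<open>\<kappa>\<close> and \<open>T - e\<close> are known to be square integrable, and \<open>\<nabla>\<^sub>s\<kappa>\<close> is so after integration in time. Hence all three
  boundary terms are small for large \<open>R\<close>.
\<close>

lemma energy_inequality:
  shows "\<exists>C. \<forall>t1 t2 R. 0 \<le> t1 \<longrightarrow> t1 \<le> t2 \<longrightarrow> t2 \<le> U \<longrightarrow> R > 0 \<longrightarrow>
     E R t2 + integral {t1..t2} (\<lambda>t. J t R (\<lambda>x. V t x \<bullet> V t x)) \<le> E R t1 + C / sqrt R"
proof -
  obtain C0 where C0: "C0 \<ge> 0" "\<And>t R. \<lbrakk>0 \<le> t; t \<le> U; R > 0\<rbrakk> \<Longrightarrow> E R t \<le> C0" using E_bounded_on_interval[of U] by blast
  have F0: "F 0 R t \<le> 2 * C0" if "0 \<le> t" "t \<le> U" "R > 0" for t R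
    using F0_le_E[of t R] C0(2)[of t R] that by auto
  have "\<exists>C'. \<forall>t1 t2 R. 0 \<le> t1 \<longrightarrow> t1 \<le> t2 \<longrightarrow> t2 \<le> U \<longrightarrow> R > 0 \<longrightarrow> integral {t1..t2} (\<lambda>t. F (0+1) R t) \<le> C'"
    by (rule F_integral_bound[of 0 0 U "2 * C0"]) (use F0 in auto)
  then obtain C1 where
    C1: "\<And>t1 t2 R. \<lbrakk>0 \<le> t1; t1 \<le> t2; t2 \<le> U; R > 0\<rbrakk> \<Longrightarrow> integral {t1..t2} (\<lambda>t. F 1 R t) \<le> C1"
    unfolding add_0 by blast
  obtain A where A: "A > 0" "\<And>f g t R B. \<lbrakk>bsmooth f; 0 \<le> t; t \<le> U; R > 0; continuous_on UNIV g; B \<ge> 0; \<And>x. \<bar>f t x\<bar> \<le> B * \<bar>g x\<bar>\<rbrakk>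
      \<Longrightarrow> \<bar>J t R (D f t)\<bar> \<le> A * B / sqrt R * (1 + J t (2 * R) (\<lambda>x. (g x)\<^sup>2))" using J_IBP_sqrt[of U] by blast
  obtain B1 where B1: "B1 \<ge> 1" "\<And>t x. 0 \<le> t \<Longrightarrow> t \<le> U \<Longrightarrow> norm (Nd V t x) \<le> B1" using bsmooth_bound[OF bsmooth_Nd[OF smooth_t]] by blast
  obtain B2 where B2: "B2 \<ge> 1" "\<And>t x. 0 \<le> t \<Longrightarrow> t \<le> U \<Longrightarrow> norm (V t x) \<le> B2" using bsmooth_bound[OF smooth_t] by blast
  define Q where "Q = A * B1 * (1 + 2 * C0) + A * B2 * (1 + 2 * C0) + A * B2"
  have Q: "Q \<ge> 0" using A B1 B2 C0 by (simp add: Q_def)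
  have main: "E R t2 + integral {t1..t2} (\<lambda>t. J t R (\<lambda>x. V t x \<bullet> V t x)) \<le> E R t1 + Q * (U + C1) / sqrt R"
    if t: "0 \<le> t1" "t1 \<le> t2" "t2 \<le> U" and R: "R > 0" for t1 t2 R
  proof -
    have iV: "(\<lambda>t. J t R (\<lambda>x. V t x \<bullet> V t x)) integrable_on {t1..t2}"
      by (intro integrable_continuous_real J_cont_t[of "\<lambda>t x. V t x \<bullet> V t x"] bs_intros) (use t in auto)
    have iF: "(\<lambda>t. F 1 (2*R) t) integrable_on {t1..t2}" by (rule F_integrable[OF t(1)])
    let ?g = "\<lambda>t. (Q / sqrt R + Q / sqrt R * F 1 (2*R) t) - J t R (\<lambda>x. V t x \<bullet> V t x)"
    have "E R t2 - E R t1 \<le> integral {t1..t2} ?g"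
    proof (rule deriv_le_integral[OF t(1,2)])
      show "?g integrable_on {t1..t2}" by (intro integrable_diff integrable_add iV integrable_on_mult_right iF integrable_const_ivl)
      fix s assume s: "t1 \<le> s" "s \<le> t2"
      have s0: "0 \<le> s" "s \<le> U" using s t by auto
      show "((\<lambda>t. E R t) has_real_derivative (J s R (D h1 s) - J s R (D h2 s) - J s R (D h3 s) - J s R (\<lambda>x. V s x \<bullet> V s x))) (at s within {0..})"
        by (rule E_deriv[OF s0(1)])
      have R2: "2 * R > 0" using R by simp
      have sq: "sqrt R > 0" using R by simp
      have n2: "(norm v)\<^sup>2 = v \<bullet> v" for v :: 'a by (simp add: dot_square_norm)
      have 1: "\<bar>J s R (D h1 s)\<bar> \<le> A * B1 / sqrt R * (1 + 2 * C0)"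
      proof -
        have "\<bar>J s R (D h1 s)\<bar> \<le> A * B1 / sqrt R * (1 + J s (2 * R) (\<lambda>x. (norm (K s x))\<^sup>2))"
        proof (rule A(2)[OF bsmooth_h(1) s0 R])
          show "\<bar>h1 s x\<bar> \<le> B1 * \<bar>norm (K s x)\<bar>" for x
            using Cauchy_Schwarz_ineq2[of "K s x" "Nd V s x"] mult_left_mono[OF B1(2)[OF s0, of x], of "norm (K s x)"]
            by (simp add: h1_def mult.commute)
        qed (use B1 in \<open>auto intro!: continuous_intros bsmooth_cont_x bsmooth_K s0\<close>)
        also have "\<dots> \<le> A * B1 / sqrt R * (1 + 2 * C0)"
          using F0[OF s0 R2] A(1) B1(1) sq by (intro mult_left_mono) (auto simp: F_def N_0 n2)
        finally show ?thesis .
      qed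
      have 2: "\<bar>J s R (D h2 s)\<bar> \<le> A * B2 / sqrt R * (1 + F 1 (2*R) s)"
      proof -
        have "\<bar>J s R (D h2 s)\<bar> \<le> A * B2 / sqrt R * (1 + J s (2 * R) (\<lambda>x. (norm (N 1 s x))\<^sup>2))"
        proof (rule A(2)[OF bsmooth_h(2) s0 R])
          show "\<bar>h2 s x\<bar> \<le> B2 * \<bar>norm (N 1 s x)\<bar>" for x
            using Cauchy_Schwarz_ineq2[of "N 1 s x" "V s x"] mult_left_mono[OF B2(2)[OF s0, of x], of "norm (N 1 s x)"]
            by (simp add: h2_def mult.commute)
        qed (use B2 in \<open>auto intro!: continuous_intros bsmooth_cont_x bsmooth_N s0\<close>)
        then show ?thesis by (simp add: F_def n2)
      qed
      have 3: "\<bar>J s R (D h3 s)\<bar> \<le> A * B2 / sqrt R * (1 + 2 * C0)"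
      proof -
        have "\<bar>J s R (D h3 s)\<bar> \<le> A * B2 / sqrt R * (1 + J s (2 * R) (\<lambda>x. (norm (Te s x))\<^sup>2))"
        proof (rule A(2)[OF bsmooth_h(3) s0 R])
          show "\<bar>h3 s x\<bar> \<le> B2 * \<bar>norm (Te s x)\<bar>" for x
          proof -
            have "h3 s x = - (Te s x \<bullet> V s x)"
              using normal_V s0 by (simp add: h3_def Te_def normal_field_def inner_diff_right inner_commute[of _ "V s x"])
            then show ?thesis
            using Cauchy_Schwarz_ineq2[of "Te s x" "V s x"] mult_left_mono[OF B2(2)[OF s0, of x], of "norm (Te s x)"]
            by (simp add: mult.commute)
          qed
        qed (use B2 in \<open>auto intro!: continuous_intros bsmooth_cont_x bsmooth_Te s0\<close>)
        also have "\<dots> \<le> A * B2 / sqrt R * (1 + 2 * C0)"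
          using Te_le_E[OF s0(1) R2] C0(2)[OF s0 R2] A(1) B2(1) sq by (intro mult_left_mono) (auto simp: n2)
        finally show ?thesis .
      qed
      have "A * B1 / sqrt R * (1 + 2 * C0) + A * B2 / sqrt R * (1 + F 1 (2*R) s) + A * B2 / sqrt R * (1 + 2 * C0)
         = Q / sqrt R + A * B2 / sqrt R * F 1 (2*R) s"
        unfolding Q_def divide_inverse by (simp add: algebra_simps)
      also have "\<dots> \<le> Q / sqrt R + Q / sqrt R * F 1 (2*R) s"
      proof (intro add_left_mono mult_right_mono divide_right_mono)
        have "0 \<le> A * B1 * (1 + 2 * C0)" "0 \<le> A * B2 * (1 + 2 * C0)" using A B1 B2 C0 by auto
        then show "A * B2 \<le> Q" by (simp add: Q_def)
      qed (use F_nonneg[OF s0(1) R2] R in auto)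
      finally show "J s R (D h1 s) - J s R (D h2 s) - J s R (D h3 s) - J s R (\<lambda>x. V s x \<bullet> V s x) \<le> ?g s"
        using 1 2 3 by linarith
    qed
    also have "\<dots> = (Q / sqrt R * (t2 - t1) + Q / sqrt R * integral {t1..t2} (\<lambda>t. F 1 (2*R) t)) - integral {t1..t2} (\<lambda>t. J t R (\<lambda>x. V t x \<bullet> V t x))"
      unfolding integral_diff[OF integrable_add[OF integrable_const_ivl integrable_on_mult_right[OF iF]] iV]
        integral_add[OF integrable_const_ivl integrable_on_mult_right[OF iF]] using t by simp
    also have "Q / sqrt R * (t2 - t1) + Q / sqrt R * integral {t1..t2} (\<lambda>t. F 1 (2*R) t) \<le> Q / sqrt R * U + Q / sqrt R * C1"
      by (intro add_mono mult_left_mono C1) (use t R Q in auto)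
    finally show ?thesis by (simp add: algebra_simps add_divide_distrib)
  qed
  show ?thesis using main by blast
qed

definition E_lim :: "real \<Rightarrow> real" where "E_lim t = (SUP R\<in>{0<..}. E R t)"

lemma E_bdd: assumes "t \<ge> 0" shows "bdd_above ((\<lambda>R. E R t) ` {0<..})"
proof -
  obtain C where "\<And>s R. \<lbrakk>0 \<le> s; s \<le> t; R > 0\<rbrakk> \<Longrightarrow> E R s \<le> C" using E_bounded_on_interval[of t] by blast
  then show ?thesis using assms by (intro bdd_aboveI2[of _ _ C]) auto
qed

lemma E_le_E_lim: "t \<ge> 0 \<Longrightarrow> R > 0 \<Longrightarrow> E R t \<le> E_lim t"
  unfolding E_lim_def by (rule cSUP_upper[OF _ E_bdd]) auto

lemma E_lim_le: "(\<And>R. R > 0 \<Longrightarrow> E R t \<le> c) \<Longrightarrow> E_lim t \<le> c"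
  unfolding E_lim_def by (rule cSUP_least) (auto intro: exI[of _ 1])

lemma E_lim_0: "E_lim 0 \<le> E0"
  by (rule E_lim_le) (use initial_energy in \<open>simp add: E_def dens_def[abs_def]\<close>)

lemma E_lim_nonneg: "t \<ge> 0 \<Longrightarrow> 0 \<le> E_lim t"
  using E_nonneg[of t 1] E_le_E_lim[of t 1] by simp

lemma dissipation_mono_R:
  assumes "0 \<le> t1" "0 < R" "R \<le> R'"
  shows "integral {t1..t2} (\<lambda>t. J t R (\<lambda>x. V t x \<bullet> V t x)) \<le> integral {t1..t2} (\<lambda>t. J t R' (\<lambda>x. V t x \<bullet> V t x))"
proof -
  have i: "(\<lambda>t. J t r (\<lambda>x. V t x \<bullet> V t x)) integrable_on {t1..t2}" for r
    by (intro integrable_continuous_real J_cont_t[of "\<lambda>t x. V t x \<bullet> V t x"] bs_intros) (use assms in auto)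
  show ?thesis by (rule integral_le[OF i i]) (use assms in \<open>auto intro!: J_mono_R cont_VV\<close>)
qed

theorem energy_dissipation:
  assumes t: "0 \<le> t1" "t1 \<le> t2" and R: "R > 0"
  shows "E_lim t2 + integral {t1..t2} (\<lambda>t. J t R (\<lambda>x. V t x \<bullet> V t x)) \<le> E_lim t1"
proof -
  let ?I = "\<lambda>R. integral {t1..t2} (\<lambda>t. J t R (\<lambda>x. V t x \<bullet> V t x))"
  obtain C where C: "\<And>R. R > 0 \<Longrightarrow> E R t2 + ?I R \<le> E R t1 + C / sqrt R"
    using energy_inequality[of t2] t by blast
  have "E R0 t2 + ?I R \<le> E_lim t1" if R0: "R0 > 0" for R0
  proof (rule le_of_vanishing_error[of "max R R0" _ _ C])
    fix R' assume R': "max R R0 \<le> R'"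
    have "E R0 t2 + ?I R \<le> E R' t2 + ?I R'"
      using R' R R0 t by (intro add_mono E_mono dissipation_mono_R) auto
    also have "\<dots> \<le> E R' t1 + C / sqrt R'" using R' R by (intro C) auto
    also have "E R' t1 \<le> E_lim t1" using R' R t by (intro E_le_E_lim) auto
    finally show "E R0 t2 + ?I R \<le> E_lim t1 + C / sqrt R'" by simp
  qed
  then have "E R0 t2 \<le> E_lim t1 - ?I R" if "R0 > 0" for R0 using that by (simp add: algebra_simps)
  then have "E_lim t2 \<le> E_lim t1 - ?I R" by (rule E_lim_le)
  then show ?thesis by simp
qed

lemma E_lim_antimono: assumes "0 \<le> t1" "t1 \<le> t2" shows "E_lim t2 \<le> E_lim t1"
proof -
  have "0 \<le> integral {t1..t2} (\<lambda>t. J t 1 (\<lambda>x. V t x \<bullet> V t x))"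
    by (intro integral_nonneg integrable_continuous_real J_cont_t[of "\<lambda>t x. V t x \<bullet> V t x"] bs_intros J_nonneg cont_VV) (use assms in auto)
  then show ?thesis using energy_dissipation[OF assms, of 1] by simp
qed

lemma E_lim_le_E0: "t \<ge> 0 \<Longrightarrow> E_lim t \<le> E0"
  using E_lim_antimono[of 0 t] E_lim_0 by simp

lemma F0_bound: "t \<ge> 0 \<Longrightarrow> R > 0 \<Longrightarrow> F 0 R t \<le> 2 * E0"
  using F0_le_E[of t R] E_le_E_lim[of t R] E_lim_le_E0[of t] by linarith


text \<open>
  Induction on the order. The time integral of \<open>F (m+1)\<close> is finite by \<open>F_integral_bound\<close>; multiplying \<open>F (m+1)\<close> by a weight that
  vanishes at the time \<open>a/2\<close> removes the unknown initial value from its differential inequality.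
\<close>

theorem F_bounded_positive_time:
  assumes "0 < a"
  shows "\<exists>C\<ge>0. \<forall>j\<le>m. \<forall>t R. a \<le> t \<longrightarrow> t \<le> U \<longrightarrow> R > 0 \<longrightarrow> F j R t \<le> C"
  using assms
proof (induction m arbitrary: a)
  case 0
  have "E0 \<ge> 0" using E_lim_0 E_lim_nonneg[of 0] by simp
  then show ?case using F0_bound 0 by (intro exI[of _ "2 * E0"]) auto
next
  case (Suc m)
  obtain C where C: "C \<ge> 0" "\<And>j t R. \<lbrakk>j \<le> m; a/2 \<le> t; t \<le> U; R > 0\<rbrakk> \<Longrightarrow> F j R t \<le> C"
    using Suc.IH[of "a/2"] Suc.prems by auto
  have a2: "0 \<le> a/2" using Suc.prems by simp
  obtain C3 where C3: "\<And>t1 t2 R. \<lbrakk>a/2 \<le> t1; t1 \<le> t2; t2 \<le> U; R > 0\<rbrakk> \<Longrightarrow> integral {t1..t2} (\<lambda>t. F (m+1) R t) \<le> C3"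
    using F_integral_bound[of "a/2" m U C] a2 C(2) by blast
  obtain C1 where C1: "C1 \<ge> 0" "\<And>t R. 0 \<le> t \<Longrightarrow> t \<le> U \<Longrightarrow> R > 0 \<Longrightarrow>
     \<exists>d. ((\<lambda>t. F (m+1) R t) has_real_derivative d) (at t within {0..}) \<and>
         d \<le> - F (m+1+2) R t - F (m+1+1) R t + C1 * (1 + (\<Sum>j\<le>m+1. F j R t))"
    using F_deriv_qualitative[of U "m+1"] by blast
  \<comment> \<open>\<open>C5\<close> and \<open>C1\<close> bound the growth of \<open>F (m+1)\<close>; \<open>C6\<close> bounds its product with the weight \<open>t - a/2 \<le> U\<close>.\<close>
  define C5 where "C5 = C1 * (1 + (m+1) * C)"
  have C5: "C5 \<ge> 0" using C1 C by (simp add: C5_def)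
  define C6 where "C6 = (1 + U * C1) * \<bar>C3\<bar> + U * C5 * U"
  have main: "F (m+1) R t \<le> \<bar>C6 / (a/2)\<bar>" if t: "a \<le> t" "t \<le> U" and R: "R > 0" for t R
  proof -
    have U: "U > 0" using t Suc.prems by simp
    have "\<forall>s. a/2 \<le> s \<and> s \<le> t \<longrightarrow> (\<exists>d. ((\<lambda>t. F (m+1) R t) has_real_derivative d) (at s within {0..}) \<and> d \<le> C5 + C1 * F (m+1) R s)"
    proof (intro allI impI)
      fix s assume s: "a/2 \<le> s \<and> s \<le> t"
      then have s0: "0 \<le> s" "s \<le> U" "a/2 \<le> s" using t a2 by auto
      obtain d where d: "((\<lambda>t. F (m+1) R t) has_real_derivative d) (at s within {0..})"
         "d \<le> - F (m+1+2) R s - F (m+1+1) R s + C1 * (1 + (\<Sum>j\<le>m+1. F j R s))"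
        using C1(2)[OF s0(1,2) R] by blast
      have "(\<Sum>j\<le>m. F j R s) \<le> (\<Sum>j\<le>m. C)" by (intro sum_mono C s0 R) auto
      then have "1 + (\<Sum>j\<le>m+1. F j R s) \<le> (1 + (m+1) * C) + F (m+1) R s" by (simp add: algebra_simps)
      then have "C1 * (1 + (\<Sum>j\<le>m+1. F j R s)) \<le> C1 * ((1 + (m+1) * C) + F (m+1) R s)" by (rule mult_left_mono[OF _ C1(1)])
      then have "C1 * (1 + (\<Sum>j\<le>m+1. F j R s)) \<le> C5 + C1 * F (m+1) R s" by (simp add: C5_def algebra_simps)
      then have "d \<le> C5 + C1 * F (m+1) R s" using d(2) F_nonneg[OF s0(1) R, of "m+1+2"] F_nonneg[OF s0(1) R, of "m+1+1"] by linarith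
      with d(1) show "\<exists>d. ((\<lambda>t. F (m+1) R t) has_real_derivative d) (at s within {0..}) \<and> d \<le> C5 + C1 * F (m+1) R s" by blast
    qed
    then obtain d where d: "\<And>s. a/2 \<le> s \<Longrightarrow> s \<le> t \<Longrightarrow> ((\<lambda>t. F (m+1) R t) has_real_derivative d s) (at s within {0..})"
        "\<And>s. a/2 \<le> s \<Longrightarrow> s \<le> t \<Longrightarrow> d s \<le> C5 + C1 * F (m+1) R s" by metis
    have i: "(\<lambda>t. F (m+1) R t) integrable_on {a/2..t}" by (rule F_integrable[OF a2])
    let ?g = "\<lambda>s. (1 + U * C1) * F (m+1) R s + U * C5"
    have "(t - a/2) * F (m+1) R t - (a/2 - a/2) * F (m+1) R (a/2) \<le> integral {a/2..t} ?g"
    proof (rule deriv_le_integral[OF a2, of _ "\<lambda>s. (s - a/2) * F (m+1) R s" "\<lambda>s. F (m+1) R s + (s - a/2) * d s"])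
      show "a/2 \<le> t" using t Suc.prems by simp
      fix s assume s: "a/2 \<le> s" "s \<le> t"
      show "((\<lambda>s. (s - a/2) * F (m+1) R s) has_real_derivative F (m+1) R s + (s - a/2) * d s) (at s within {0..})"
        by (rule derivative_eq_intros d(1)[OF s] | simp)+
      have F0: "0 \<le> F (m+1) R s" by (rule F_nonneg) (use s a2 R in auto)
      have "(s - a/2) * d s \<le> (s - a/2) * (C5 + C1 * F (m+1) R s)" by (intro mult_left_mono d s) (use s in simp)
      also have "\<dots> \<le> U * (C5 + C1 * F (m+1) R s)" by (intro mult_right_mono) (use s t a2 C5 C1 F0 in auto)
      finally show "F (m+1) R s + (s - a/2) * d s \<le> ?g s" by (simp add: algebra_simps)
    next
      show "?g integrable_on {a/2..t}" by (intro integrable_add integrable_const_ivl integrable_on_mult_right i)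
    qed
    also have "\<dots> = (1 + U * C1) * integral {a/2..t} (\<lambda>s. F (m+1) R s) + U * C5 * (t - a/2)"
      using t Suc.prems by (subst integral_add[OF integrable_on_mult_right[OF i]]) auto
    also have "\<dots> \<le> (1 + U * C1) * \<bar>C3\<bar> + U * C5 * U"
    proof (intro add_mono mult_left_mono)
      show "integral {a/2..t} (\<lambda>s. F (m+1) R s) \<le> \<bar>C3\<bar>" by (rule order_trans[OF C3 abs_ge_self]) (use t R Suc.prems in auto)
    qed (use t a2 U C1 C5 in auto)
    finally have 1: "(t - a/2) * F (m+1) R t \<le> C6" by (simp add: C6_def)
    have F0: "0 \<le> F (m+1) R t" by (rule F_nonneg) (use t a2 R Suc.prems in auto)
    have "a/2 * F (m+1) R t \<le> (t - a/2) * F (m+1) R t" by (intro mult_right_mono F0) (use t in simp)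
    then have "F (m+1) R t \<le> C6 / (a/2)" using 1 Suc.prems by (simp add: field_simps)
    then show ?thesis by linarith
  qed
  have "F j R t \<le> C + \<bar>C6 / (a/2)\<bar>" if "j \<le> Suc m" "a \<le> t" "t \<le> U" "R > 0" for j t R
  proof (cases "j = Suc m")
    case True
    then show ?thesis using main[OF that(2-4)] C(1) by simp
  next
    case False
    then have "F j R t \<le> C" using that Suc.prems by (intro C) auto
    then show ?thesis by linarith
  qed
  then show ?case using C(1) by (intro exI[of _ "C + \<bar>C6 / (a/2)\<bar>"]) auto
qed

end

section \<open>Interpolation and uniform curvature bounds\<close>

text \<open>
  The quotients \<open>a i / (K b\<^sup>i)\<close> are again log-convex and at most \<open>1\<close> at both ends. Log-convexity excludes that their maximum is
  first attained in the interior.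
\<close>

lemma log_convex_interpolation:
  fixes a :: "nat \<Rightarrow> real"
  assumes nn: "\<And>i. i \<le> n \<Longrightarrow> 0 \<le> a i" and lc: "\<And>i. i + 2 \<le> n \<Longrightarrow> (a (i+1))\<^sup>2 \<le> a i * a (i+2)"
    and K: "K > 0" and b: "b > 0" and a0: "a 0 \<le> K" and an: "a n \<le> K * b ^ n" and i: "i \<le> n"
  shows "a i \<le> K * b ^ i"
proof -
  define q where "q i = a i / (K * b ^ i)" for i
  have qn: "0 \<le> q i" if "i \<le> n" for i using nn[OF that] K b by (simp add: q_def)
  have qlc: "(q (i+1))\<^sup>2 \<le> q i * q (i+2)" if "i + 2 \<le> n" for i
  proof -
    have e: "(K * b ^ (i+1)) * (K * b ^ (i+1)) = (K * b ^ i) * (K * b ^ (i+2))"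
      by (simp add: power_add power2_eq_square)
    have "(q (i+1))\<^sup>2 = (a (i+1))\<^sup>2 / ((K * b ^ i) * (K * b ^ (i+2)))"
      unfolding q_def power_divide power2_eq_square[of "K * b ^ (i+1)"] e ..
    also have "\<dots> \<le> (a i * a (i+2)) / ((K * b ^ i) * (K * b ^ (i+2)))"
      by (intro divide_right_mono lc that) (use K b in auto)
    finally show ?thesis by (simp add: q_def)
  qed
  define M where "M = Max (q ` {..n})"
  have M: "q j \<le> M" if "j \<le> n" for j unfolding M_def by (rule Max_ge) (use that in auto)
  have "M \<le> 1"
  proof (rule ccontr)
    assume "\<not> M \<le> 1"
    then have M1: "M > 1" by simp
    have "M \<in> q ` {..n}" unfolding M_def by (rule Max_in) auto
    then have ex: "\<exists>j. j \<le> n \<and> q j = M" by auto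
    define j where "j = (LEAST j. j \<le> n \<and> q j = M)"
    have j: "j \<le> n" "q j = M" using LeastI_ex[OF ex] by (auto simp: j_def)
    have q0: "q 0 \<le> 1" using a0 K by (simp add: q_def)
    have qn1: "q n \<le> 1" using an K b by (simp add: q_def)
    have "j \<noteq> 0" using j(2) M1 q0 by (metis not_le)
    moreover have "j \<noteq> n" using j(2) M1 qn1 by (metis not_le)
    ultimately obtain i where i: "j = i + 1" "i + 2 \<le> n" using j(1) by (cases j) auto
    have "q i \<noteq> M"
    proof
      assume "q i = M"
      then have "j \<le> i" unfolding j_def by (intro Least_le) (use i in auto)
      then show False using i by simp
    qed
    then have "q i < M" using M[of i] i by auto
    then have "q i * q (i+2) \<le> q i * M" "q i * M < M * M"
      using M[of "i+2"] i qn[of i] M1 by (auto intro: mult_left_mono)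
    then show False using qlc[OF i(2)] j i by (simp add: power2_eq_square)
  qed
  then have "q i \<le> 1" using M[OF i] by simp
  then show ?thesis using K b by (simp add: q_def)
qed

text \<open>
  The inequality makes \<open>Y\<close> one-sided Lipschitz, so over a unit interval its integral is at least its final value minus \<open>C\<close>.
  Then \<open>(1 + k) Y(s + 1) \<le> Y(s) + (1 + k) C\<close>, and any bound \<open>B \<ge> 2C/k\<close> is preserved from one unit time to the next.
\<close>

lemma bounded_of_damped_inequality:
  fixes Y :: "real \<Rightarrow> real"
  assumes C: "C \<ge> 0" and k: "0 < k" "k \<le> 1"
    and int: "\<And>s t. 1 \<le> s \<Longrightarrow> s \<le> t \<Longrightarrow> Y integrable_on {s..t}"
    and nn: "\<And>t. 1 \<le> t \<Longrightarrow> 0 \<le> Y t"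
    and ineq: "\<And>s t. 1 \<le> s \<Longrightarrow> s \<le> t \<Longrightarrow> Y t - Y s \<le> C * (t - s) - k * integral {s..t} Y"
  shows "\<exists>B. \<forall>t\<ge>1. Y t \<le> B"
proof -
  have up: "Y t \<le> Y s + C * (t - s)" if "1 \<le> s" "s \<le> t" for s t
  proof -
    have "0 \<le> integral {s..t} Y" by (intro integral_nonneg int that) (use nn that in auto)
    then have "0 \<le> k * integral {s..t} Y" using k by simp
    then show ?thesis using ineq[OF that] by linarith
  qed
  define B where "B = max (Y 1) (2 * C / k)"
  have step: "Y (s + 1) \<le> B" if s: "1 \<le> s" "Y s \<le> B" for s
  proof -
    have "integral {s..s+1} (\<lambda>_. Y (s+1) - C) \<le> integral {s..s+1} Y"
    proof (rule integral_le)
      fix t assume t: "t \<in> {s..s+1}"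
      have "C * (s + 1 - t) \<le> C * 1" using C t by (intro mult_left_mono) auto
      then show "Y (s+1) - C \<le> Y t" using up[of t "s+1"] t s by auto
    qed (use int s in auto)
    then have "Y (s+1) - C \<le> integral {s..s+1} Y" by simp
    then have "k * (Y (s+1) - C) \<le> k * integral {s..s+1} Y" using k by (intro mult_left_mono) auto
    then have "Y (s+1) - Y s \<le> C - k * (Y (s+1) - C)" using ineq[of s "s+1"] s by simp
    moreover have "k * C \<le> C" using mult_right_mono[OF k(2) C] by simp
    moreover have "k * B \<ge> 2 * C"
    proof -
      have "2 * C / k \<le> B" by (simp add: B_def)
      then show ?thesis using k by (simp add: field_simps)
    qed
    ultimately have "Y (s+1) + k * Y (s+1) \<le> B + k * B" using s(2) by (simp add: algebra_simps)
    then have "(1 + k) * Y (s+1) \<le> (1 + k) * B" by (simp add: algebra_simps)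
    then show ?thesis using k by simp
  qed
  have n: "Y (1 + real n) \<le> B" for n
  proof (induction n)
    case 0 then show ?case by (simp add: B_def)
  next
    case (Suc n)
    then show ?case using step[of "1 + real n"] by (simp add: algebra_simps)
  qed
  have "Y t \<le> B + C" if "t \<ge> 1" for t
  proof -
    define n where "n = nat \<lfloor>t - 1\<rfloor>"
    have n1: "1 + real n \<le> t" "t - (1 + real n) \<le> 1" unfolding n_def using that by linarith+
    have "Y t \<le> Y (1 + real n) + C * (t - (1 + real n))" by (rule up) (use n1 in auto)
    also have "C * (t - (1 + real n)) \<le> C * 1" by (rule mult_left_mono[OF n1(2) C])
    finally show ?thesis using n[of n] by simp
  qed
  then show ?thesis by blast
qed

lemma power_absorb:
  fixes A c :: real
  assumes "A \<ge> 0" "c \<ge> 1"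
  shows "A * c ^ p \<le> c ^ (p + 2) + A * (A + 1) ^ p"
proof (cases "A \<le> c * c")
  case True
  then have "A * c ^ p \<le> (c * c) * c ^ p" using assms by (intro mult_right_mono) auto
  moreover have "0 \<le> A * (A + 1) ^ p" using assms by simp
  ultimately show ?thesis by (simp add: power_add power2_eq_square mult.commute)
next
  case False
  have "c * 1 \<le> c * c" using assms by (intro mult_left_mono) auto
  then have "c \<le> A + 1" using False by simp
  then have "A * c ^ p \<le> A * (A + 1) ^ p" using assms by (intro mult_left_mono power_mono) auto
  moreover have "0 \<le> c ^ (p + 2)" using assms by simp
  ultimately show ?thesis by linarith
qed

lemma mult_le_sum_squares:
  fixes a b :: real
  assumes "a \<ge> 0" "b \<ge> 0" shows "a * b \<le> a\<^sup>2 + b\<^sup>2"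
proof -
  have "2 * a * b \<le> a\<^sup>2 + b\<^sup>2" by (rule sum_squares_bound)
  moreover have "0 \<le> a * b" using assms by simp
  ultimately show ?thesis by linarith
qed

lemma weight_remove1:
  "i \<in> set l \<Longrightarrow> sum_list (map f l) = f i + sum_list (map f (remove1 i l))"
  for f :: "nat \<Rightarrow> nat"
  by (induction l) auto

context bounded_flow
begin

lemma mon_remove1: "i \<in> set l \<Longrightarrow> mon l t x = norm (N i t x) * mon (remove1 i l) t x"
  unfolding mon_def by (induction l) auto

lemma J_cauchy_schwarz:
  assumes t: "t \<ge> 0" and R: "R > 0" and f: "continuous_on UNIV f" and g: "continuous_on UNIV g"
  shows "\<bar>J t R (\<lambda>x. f x * g x)\<bar> \<le> sqrt (J t R (\<lambda>x. (f x)\<^sup>2)) * sqrt (J t R (\<lambda>x. (g x)\<^sup>2))"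
proof -
  define a b c where "a = J t R (\<lambda>x. (f x)\<^sup>2)" and "b = J t R (\<lambda>x. f x * g x)" and "c = J t R (\<lambda>x. (g x)\<^sup>2)"
  have a: "a \<ge> 0" and c: "c \<ge> 0" unfolding a_def c_def by (intro J_nonneg t R continuous_intros f g; simp)+
  have q: "0 \<le> a - 2 * l * b + l\<^sup>2 * c" for l
  proof -
    have "0 \<le> J t R (\<lambda>x. (f x - l * g x)\<^sup>2)" by (intro J_nonneg t R continuous_intros f g) simp
    also have "(\<lambda>x. (f x - l * g x)\<^sup>2) = (\<lambda>x. ((f x)\<^sup>2 - (2 * l) * (f x * g x)) + l\<^sup>2 * (g x)\<^sup>2)"
      by (simp add: fun_eq_iff power2_eq_square algebra_simps)
    also have "J t R \<dots> = a - (2 * l) * b + l\<^sup>2 * c"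
      unfolding a_def b_def c_def
      by (subst J_add J_diff, (intro t continuous_intros f g)+)+ (simp add: J_cmult)
    finally show ?thesis by simp
  qed
  have "b\<^sup>2 \<le> a * c"
  proof (cases "c = 0")
    case True
    have "b = 0"
    proof (rule ccontr)
      assume b: "b \<noteq> 0"
      have "0 \<le> a - 2 * ((a + 1) / (2 * b)) * b" using q[of "(a + 1) / (2 * b)"] True by simp
      then show False using b by simp
    qed
    then show ?thesis using a c by simp
  next
    case False
    then have "c > 0" using c by simp
    have "0 \<le> a - 2 * (b / c) * b + (b / c)\<^sup>2 * c" by (rule q)
    also have "\<dots> = a - b\<^sup>2 / c" using \<open>c > 0\<close> by (simp add: power2_eq_square field_simps)
    finally show ?thesis using \<open>c > 0\<close> by (simp add: field_simps)
  qed
  then have "\<bar>b\<bar> \<le> sqrt (a * c)" by (simp add: real_le_rsqrt abs_le_square_iff[symmetric] real_sqrt_le_mono flip: real_sqrt_abs)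
  then show ?thesis by (simp add: real_sqrt_mult a_def b_def c_def)
qed

text \<open>
  The limit \<open>R \<rightarrow> \<infinity>\<close> of \<open>cut_value_le\<close>: an integrable function is bounded by half of its total variation.
\<close>

lemma pointwise_le_integral:
  assumes h: "bsmooth h" and t: "t \<ge> 0" and g: "continuous_on UNIV g" and k: "continuous_on UNIV k"
    and hg: "\<And>x. \<bar>h t x\<bar> \<le> g x" and hk: "\<And>x. \<bar>D h t x\<bar> \<le> k x"
    and Gb: "\<And>R. R > 0 \<Longrightarrow> J t R g \<le> B" and M: "\<And>R. R > 0 \<Longrightarrow> J t R k \<le> M"
  shows "2 * h t x \<le> M"
proof -
  obtain A where A: "A > 0" "\<And>f g s R. \<lbrakk>continuous_on UNIV f; 0 \<le> s; s \<le> t; R > 0; continuous_on UNIV g; \<And>x. \<bar>f x\<bar> \<le> g x\<rbrakk>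
      \<Longrightarrow> 2 / R * integral {-R..R} (\<lambda>x. \<bar>f x\<bar>) \<le> A / R * J s (2 * R) g"
    using plain_integral_dominated[of t] by blast
  have ev: "2 * ((1 - (x / R)\<^sup>2) * h t x) \<le> M + A * \<bar>B\<bar> / R" if R: "R \<ge> \<bar>x\<bar> + 1" for R
  proof -
    have R0: "R > 0" and xR: "x \<in> {-R..R}" using R by auto
    have "2 * ((1 - (x / R)\<^sup>2) * h t x) \<le> J t R (\<lambda>x. \<bar>D h t x\<bar>) + 2 / R * integral {-R..R} (\<lambda>x. \<bar>h t x\<bar>)"
      by (rule cut_value_le[OF h t R0 xR])
    also have "J t R (\<lambda>x. \<bar>D h t x\<bar>) \<le> J t R k"
      by (rule J_mono[OF t R0 _ k hk]) (intro continuous_intros bsmooth_cont_x bsmooth_D h t)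
    also have "J t R k \<le> M" by (rule M[OF R0])
    also have "2 / R * integral {-R..R} (\<lambda>x. \<bar>h t x\<bar>) \<le> A / R * J t (2 * R) g"
      by (rule A(2)[OF bsmooth_cont_x[OF h t] t order_refl R0 g hg])
    also have "\<dots> \<le> A / R * \<bar>B\<bar>"
      by (intro mult_left_mono order_trans[OF Gb abs_ge_self]) (use A R0 in auto)
    finally show ?thesis by simp
  qed
  show ?thesis
  proof (rule tendsto_le)
    have "((\<lambda>R. x / R) \<longlongrightarrow> 0) at_top"
      by (rule tendsto_divide_0[OF tendsto_const filterlim_at_top_imp_at_infinity[OF filterlim_ident]])
    then have "((\<lambda>R. 2 * ((1 - (x / R)\<^sup>2) * h t x)) \<longlongrightarrow> 2 * ((1 - 0\<^sup>2) * h t x)) at_top"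
      by (intro tendsto_intros)
    then show "((\<lambda>R. 2 * ((1 - (x / R)\<^sup>2) * h t x)) \<longlongrightarrow> 2 * h t x) at_top" by simp
    have "((\<lambda>R. A * \<bar>B\<bar> / R) \<longlongrightarrow> 0) at_top"
      by (rule tendsto_divide_0[OF tendsto_const filterlim_at_top_imp_at_infinity[OF filterlim_ident]])
    then have "((\<lambda>R. M + A * \<bar>B\<bar> / R) \<longlongrightarrow> M + 0) at_top" by (intro tendsto_intros)
    then show "((\<lambda>R. M + A * \<bar>B\<bar> / R) \<longlongrightarrow> M) at_top" by simp
    show "\<forall>\<^sub>F R in at_top. 2 * ((1 - (x / R)\<^sup>2) * h t x) \<le> M + A * \<bar>B\<bar> / R"
      using ev eventually_at_top_linorder by blast
  qed simp
qed

text \<open>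
  The integral of \<open>\<bar>N m\<bar>\<^sup>2\<close> over the whole curve, as a supremum over integer radii so that limits of sequences apply.
\<close>

definition F_lim :: "nat \<Rightarrow> real \<Rightarrow> real" where "F_lim m t = (SUP n. F m (real (Suc n)) t)"

end

context finite_energy_flow
begin

lemma F_lim_bdd: assumes "t > 0" shows "bdd_above (range (\<lambda>n. F m (real (Suc n)) t))"
proof -
  obtain C where "\<forall>j\<le>m. \<forall>s R. t \<le> s \<longrightarrow> s \<le> t \<longrightarrow> R > 0 \<longrightarrow> F j R s \<le> C"
    using F_bounded_positive_time[OF assms, of m t] by blast
  then show ?thesis by (intro bdd_aboveI2[of _ _ C]) auto
qed

lemma F_le_F_lim: assumes "t > 0" "R > 0" shows "F m R t \<le> F_lim m t"
proof -
  obtain n where n: "R \<le> real n" using real_arch_simple by blast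
  have "F m R t \<le> F m (real (Suc n)) t" using assms n by (intro F_mono) auto
  also have "\<dots> \<le> F_lim m t" unfolding F_lim_def by (rule cSUP_upper[OF _ F_lim_bdd]) (use assms in auto)
  finally show ?thesis .
qed

lemma F_lim_le: "(\<And>R. R > 0 \<Longrightarrow> F m R t \<le> c) \<Longrightarrow> F_lim m t \<le> c"
  unfolding F_lim_def by (rule cSUP_least) auto

lemma F_lim_nonneg: "t > 0 \<Longrightarrow> 0 \<le> F_lim m t"
  using F_nonneg[of t 1 m] F_le_F_lim[of t 1 m] by simp

lemma F_lim_tendsto: assumes "t > 0" shows "(\<lambda>n. F m (real (Suc n)) t) \<longlonglongrightarrow> F_lim m t"
  unfolding F_lim_def
  by (rule LIMSEQ_incseq_SUP[OF F_lim_bdd[OF assms]]) (use assms in \<open>auto simp: incseq_def intro!: F_mono\<close>)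

lemma J_norm_norm:
  assumes t: "t > 0" and R: "R > 0"
  shows "J t R (\<lambda>x. norm (N i t x) * norm (N j t x)) \<le> sqrt (F_lim i t) * sqrt (F_lim j t)"
proof -
  have sq: "sqrt (J t R (\<lambda>x. (norm (N i t x))\<^sup>2)) \<le> sqrt (F_lim i t)" for i
    using F_le_F_lim[OF t R, of i] by (simp add: F_def dot_square_norm)
  have "\<bar>J t R (\<lambda>x. norm (N i t x) * norm (N j t x))\<bar> \<le> sqrt (J t R (\<lambda>x. (norm (N i t x))\<^sup>2)) * sqrt (J t R (\<lambda>x. (norm (N j t x))\<^sup>2))"
    by (rule J_cauchy_schwarz[OF _ R]) (use t in \<open>auto intro!: continuous_intros cont_N\<close>)
  also have "\<dots> \<le> sqrt (F_lim i t) * sqrt (F_lim j t)"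
    by (intro mult_mono sq real_sqrt_ge_zero J_nonneg R F_lim_nonneg t) (use t in \<open>auto intro!: continuous_intros cont_N\<close>)
  finally show ?thesis by simp
qed

text \<open>
  Integration by parts of \<open>\<bar>N (i+1)\<bar>\<^sup>2\<close> and the Cauchy-Schwarz inequality.
\<close>

lemma F_lim_log_convex: assumes t: "t > 0" shows "F_lim (i+1) t \<le> sqrt (F_lim i t) * sqrt (F_lim (i+2) t)"
proof (rule F_lim_le)
  fix R0 :: real assume R0: "R0 > 0"
  have t0: "t \<ge> 0" using t by simp
  obtain A where A: "A > 0" "\<And>f g s R. \<lbrakk>bsmooth f; 0 \<le> s; s \<le> t; R > 0; continuous_on UNIV g; \<And>x. \<bar>f s x\<bar> \<le> g x\<rbrakk>
      \<Longrightarrow> \<bar>J s R (D f s)\<bar> \<le> A / R * J s (2 * R) g" using J_IBP_dominated[of t] by blast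
  let ?f = "\<lambda>t x. N i t x \<bullet> N (i+1) t x"
  let ?c = "F_lim i t + F_lim (i+1) t"
  show "F (i+1) R0 t \<le> sqrt (F_lim i t) * sqrt (F_lim (i+2) t)"
  proof (rule le_of_vanishing_error[of "max 1 R0" _ _ "A * ?c"])
    fix R assume R: "max 1 R0 \<le> R"
    then have R1: "R > 0" "R \<ge> 1" by auto
    have cD: "continuous_on UNIV (D ?f t)" by (intro bsmooth_cont_x bs_intros t0)
    have "F (i+1) R0 t \<le> F (i+1) R t" using R R0 t by (intro F_mono) auto
    also have "F (i+1) R t = J t R (\<lambda>x. D ?f t x - N i t x \<bullet> N (i+2) t x)"
      unfolding F_def by (simp add: D_NN[OF t0])
    also have "\<dots> = J t R (D ?f t) - J t R (\<lambda>x. N i t x \<bullet> N (i+2) t x)"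
      by (intro J_diff t0 cD cont_NN)
    finally have 1: "F (i+1) R0 t \<le> J t R (D ?f t) - J t R (\<lambda>x. N i t x \<bullet> N (i+2) t x)" .
    have "J t R (\<lambda>x. (-1) * (N i t x \<bullet> N (i+2) t x)) \<le> J t R (\<lambda>x. norm (N i t x) * norm (N (i+2) t x))"
    proof (rule J_mono[OF t0 R1(1)])
      fix x show "(-1) * (N i t x \<bullet> N (i+2) t x) \<le> norm (N i t x) * norm (N (i+2) t x)"
        using Cauchy_Schwarz_ineq2[of "N i t x" "N (i+2) t x"] by linarith
    qed (intro continuous_intros cont_N t0)+
    also have "\<dots> \<le> sqrt (F_lim i t) * sqrt (F_lim (i+2) t)" by (rule J_norm_norm[OF t R1(1)])
    finally have 2: "- J t R (\<lambda>x. N i t x \<bullet> N (i+2) t x) \<le> sqrt (F_lim i t) * sqrt (F_lim (i+2) t)" by (simp only: J_cmult)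
    have "\<bar>J t R (D ?f t)\<bar> \<le> A / R * J t (2*R) (\<lambda>x. N i t x \<bullet> N i t x + N (i+1) t x \<bullet> N (i+1) t x)"
    proof (rule A(2))
      show "bsmooth ?f" by (intro bs_intros)
      show "\<bar>?f t x\<bar> \<le> N i t x \<bullet> N i t x + N (i+1) t x \<bullet> N (i+1) t x" for x
      proof -
        have "\<bar>?f t x\<bar> \<le> norm (N i t x) * norm (N (i+1) t x)" by (rule Cauchy_Schwarz_ineq2)
        also have "\<dots> \<le> (norm (N i t x))\<^sup>2 + (norm (N (i+1) t x))\<^sup>2"
          by (rule mult_le_sum_squares) auto
        finally show ?thesis by (simp add: dot_square_norm)
      qed
    qed (use t R1 in \<open>auto intro!: continuous_intros cont_N\<close>)
    also have "J t (2*R) (\<lambda>x. N i t x \<bullet> N i t x + N (i+1) t x \<bullet> N (i+1) t x) = F i (2*R) t + F (i+1) (2*R) t"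
      unfolding F_def by (intro J_add t0 cont_NN)
    also have "A / R * (F i (2*R) t + F (i+1) (2*R) t) \<le> A / R * ?c"
      by (intro mult_left_mono add_mono F_le_F_lim t) (use A R1 in auto)
    also have "\<dots> \<le> A / sqrt R * ?c"
    proof (intro mult_right_mono divide_left_mono)
      have "sqrt R * 1 \<le> sqrt R * sqrt R" using R1 by (intro mult_left_mono) auto
      then show "sqrt R \<le> R" using R1 by simp
    qed (use A R1 F_lim_nonneg[OF t] in auto)
    finally show "F (i+1) R0 t \<le> sqrt (F_lim i t) * sqrt (F_lim (i+2) t) + A * ?c / sqrt R" using 1 2 by simp
  qed
qed

text \<open>
  Half the total variation of \<open>\<bar>N i\<bar>\<^sup>2\<close> is at most the integral of \<open>\<bar>N i\<bar> \<bar>N (i+1)\<bar>\<close>.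
\<close>

lemma N_sup_le: assumes t: "t > 0" shows "(norm (N i t x))\<^sup>2 \<le> 2 * (sqrt (F_lim i t) * sqrt (F_lim (i+1) t))"
proof -
  have t0: "t \<ge> 0" using t by simp
  have "2 * (N i t x \<bullet> N i t x) \<le> 2 * (sqrt (F_lim i t) * sqrt (F_lim (i+1) t))"
  proof (rule pointwise_le_integral[where h = "\<lambda>t x. N i t x \<bullet> N i t x" and t = t
        and g = "\<lambda>x. N i t x \<bullet> N i t x" and k = "\<lambda>x. 2 * (norm (N i t x) * norm (N (i+1) t x))" and B = "F_lim i t"])
    show "bsmooth (\<lambda>t x. N i t x \<bullet> N i t x)" by (intro bs_intros)
    show "\<bar>D (\<lambda>t x. N i t x \<bullet> N i t x) t x\<bar> \<le> 2 * (norm (N i t x) * norm (N (i+1) t x))" for x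
      using Cauchy_Schwarz_ineq2[of "N i t x" "N (i+1) t x"] by (simp add: D_NN[OF t0] inner_commute)
    show "J t R (\<lambda>x. N i t x \<bullet> N i t x) \<le> F_lim i t" if "R > 0" for R
      using F_le_F_lim[OF t that] by (simp add: F_def)
    show "J t R (\<lambda>x. 2 * (norm (N i t x) * norm (N (i+1) t x))) \<le> 2 * (sqrt (F_lim i t) * sqrt (F_lim (i+1) t))" if "R > 0" for R
      unfolding J_cmult by (intro mult_left_mono J_norm_norm t that) simp
  qed (use t0 in \<open>auto intro!: continuous_intros cont_N\<close>)
  moreover have "0 \<le> N i t x \<bullet> N i t x" by simp
  ultimately have "N i t x \<bullet> N i t x \<le> 2 * (sqrt (F_lim i t) * sqrt (F_lim (i+1) t))" by linarith
  then show ?thesis by (simp add: dot_square_norm)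
qed

text \<open>
  A bound for the \<open>L\<^sup>2\<close> norm of the curvature, at least \<open>1\<close> so that its powers are monotone.
\<close>

definition K0 :: real where "K0 = max 1 (sqrt (2 * E0))"

lemma K0_ge: "K0 \<ge> 1" by (simp add: K0_def)

text \<open>
  Gagliardo-Nirenberg inequalities. Taking \<open>c\<close> as the \<open>4n\<close>-th root of the highest order quantity makes all interpolation
  exponents natural numbers: \<open>c\<^sup>2\<^sup>i\<close> for the \<open>L\<^sup>2\<close> norm of \<open>N i\<close>, and \<open>c\<^sup>2\<^sup>i\<^sup>+\<^sup>1\<close> for its supremum, which is the geometric mean of
  the orders \<open>i\<close> and \<open>i + 1\<close>.
\<close>

lemma F_lim_interpolation:
  assumes t: "t > 0" and n: "n > 0"
  obtains c where "c \<ge> 1" "c ^ (4 * n) = max 1 (F_lim n t)" "\<And>i. i \<le> n \<Longrightarrow> sqrt (F_lim i t) \<le> K0 * c ^ (2 * i)"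
    "\<And>i x. i < n \<Longrightarrow> norm (N i t x) \<le> 2 * K0 * c ^ (2 * i + 1)"
proof -
  define c where "c = root (4 * n) (max 1 (F_lim n t))"
  have c1: "c \<ge> 1" using n unfolding c_def by (simp add: le_max_iff_disj)
  have cn: "c ^ (4 * n) = max 1 (F_lim n t)" unfolding c_def by (rule real_root_pow_pos2) (use n in auto)
  have I: "sqrt (F_lim i t) \<le> K0 * c ^ (2 * i)" if "i \<le> n" for i
  proof -
    have "sqrt (F_lim i t) \<le> K0 * (c\<^sup>2) ^ i"
    proof (rule log_convex_interpolation[of n "\<lambda>i. sqrt (F_lim i t)"])
      show "(sqrt (F_lim (i+1) t))\<^sup>2 \<le> sqrt (F_lim i t) * sqrt (F_lim (i+2) t)" for i
        using F_lim_log_convex[OF t, of i] F_lim_nonneg[OF t] by simp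
      have "F_lim 0 t \<le> 2 * E0" by (rule F_lim_le) (use F0_bound t in auto)
      then show "sqrt (F_lim 0 t) \<le> K0" by (simp add: K0_def le_max_iff_disj)
      have "F_lim n t \<le> (c ^ (2 * n))\<^sup>2" using cn by (simp add: power_mult[symmetric] mult.commute)
      then have "sqrt (F_lim n t) \<le> c ^ (2 * n)" using c1 by (simp add: real_le_lsqrt)
      also have "\<dots> \<le> K0 * c ^ (2 * n)" using mult_right_mono[OF K0_ge, of "c ^ (2 * n)"] c1 by simp
      finally show "sqrt (F_lim n t) \<le> K0 * (c\<^sup>2) ^ n" by (simp add: power_mult)
    qed (use K0_ge c1 that F_lim_nonneg[OF t] in auto)
    then show ?thesis by (simp add: power_mult)
  qed
  have II: "norm (N i t x) \<le> 2 * K0 * c ^ (2 * i + 1)" if "i < n" for i x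
  proof -
    have "(norm (N i t x))\<^sup>2 \<le> 2 * (sqrt (F_lim i t) * sqrt (F_lim (i+1) t))" by (rule N_sup_le[OF t])
    also have "\<dots> \<le> 2 * ((K0 * c ^ (2 * i)) * (K0 * c ^ (2 * (i+1))))"
      by (intro mult_left_mono mult_mono I) (use that K0_ge c1 F_lim_nonneg[OF t] in auto)
    also have "\<dots> = 2 * (K0 * c ^ (2 * i + 1))\<^sup>2" by (simp add: power2_eq_square power_add algebra_simps)
    also have "\<dots> \<le> 4 * (K0 * c ^ (2 * i + 1))\<^sup>2" by (intro mult_right_mono) auto
    also have "\<dots> = (2 * K0 * c ^ (2 * i + 1))\<^sup>2" by (simp add: power2_eq_square)
    finally show ?thesis by (rule power2_le_imp_le) (use K0_ge c1 in auto)
  qed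
  show ?thesis by (rule that[OF c1 cn I II])
qed

text \<open>
  The factor of highest order and \<open>N m\<close> are estimated in \<open>L\<^sup>2\<close>, the others in the supremum norm; the weight forces their order
  to be at most \<open>m + 1\<close>. Each of them costs one extra power of \<open>c\<close>, but having at least three factors in \<open>l\<close> keeps the exponent at
  \<open>4m + 6\<close>, below the exponent \<open>4m + 8\<close> of the good term.
\<close>

lemma mon_interpolation:
  assumes t: "t > 0" and R: "R > 0" and l: "l \<in> monomials (m + 5)"
    and c1: "c \<ge> 1" and I: "\<And>i. i \<le> m + 2 \<Longrightarrow> sqrt (F_lim i t) \<le> K0 * c ^ (2 * i)"
    and II: "\<And>i x. i < m + 2 \<Longrightarrow> norm (N i t x) \<le> 2 * K0 * c ^ (2 * i + 1)"
  shows "J t R (\<lambda>x. mon l t x * norm (N m t x)) \<le> (2 * K0) ^ (m + 7) * c ^ (4 * m + 6)"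
proof -
  have t0: "t \<ge> 0" using t by simp
  have len: "length l \<ge> 3" and w: "sum_list (map Suc l) \<le> m + 5" using l by (auto simp: monomials_def)
  define i where "i = Max (set l)"
  have ne: "set l \<noteq> {}" using len by auto
  have il: "i \<in> set l" unfolding i_def by (rule Max_in) (use ne in auto)
  have im: "i \<le> m + 2" using mem_le_weight[OF il] w len by simp
  define r where "r = remove1 i l"
  have lr: "length r + 1 = length l" using il len by (simp add: r_def length_remove1)
  have wr: "sum_list (map Suc l) = Suc i + sum_list (map Suc r)" unfolding r_def by (rule weight_remove1[OF il])
  have rj: "j < m + 2" if "j \<in> set r" for j
  proof -
    have "j \<in> set l" using that set_remove1_subset[of i l] by (auto simp: r_def)
    then have ji: "j \<le> i" unfolding i_def by (intro Max_ge) auto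
    have "Suc j + (length r - 1) \<le> sum_list (map Suc r)" by (rule mem_le_weight[OF that])
    then show ?thesis using wr w lr len ji by linarith
  qed
  have monr: "mon r t x \<le> (2 * K0) ^ length r * c ^ (2 * sum_list (map Suc r) - length r)" if "\<And>j. j \<in> set r \<Longrightarrow> j < m + 2" for r x
    using that
  proof (induction r)
    case Nil then show ?case by (simp add: mon_def)
  next
    case (Cons j r)
    have "norm (N j t x) * mon r t x \<le> (2 * K0 * c ^ (2 * j + 1)) * ((2 * K0) ^ length r * c ^ (2 * sum_list (map Suc r) - length r))"
      by (intro mult_mono II Cons.IH) (use Cons.prems K0_ge c1 mon_nonneg in auto)
    also have "\<dots> = (2 * K0) ^ length (j # r) * (c ^ (2 * j + 1) * c ^ (2 * sum_list (map Suc r) - length r))"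
      by (simp add: algebra_simps)
    also have "c ^ (2 * j + 1) * c ^ (2 * sum_list (map Suc r) - length r) = c ^ (2 * sum_list (map Suc (j # r)) - length (j # r))"
    proof -
      have "2 * j + 1 + (2 * sum_list (map Suc r) - length r) = 2 * sum_list (map Suc (j # r)) - length (j # r)"
        using length_le_weight[of r] by simp
      then show ?thesis by (simp only: power_add[symmetric])
    qed
    finally show ?case by (simp add: mon_def)
  qed
  let ?M = "(2 * K0) ^ length r * c ^ (2 * sum_list (map Suc r) - length r)"
  have "J t R (\<lambda>x. mon l t x * norm (N m t x)) \<le> J t R (\<lambda>x. ?M * (norm (N i t x) * norm (N m t x)))"
  proof (rule J_mono[OF t0 R])
    fix x
    have "mon l t x * norm (N m t x) = mon r t x * (norm (N i t x) * norm (N m t x))"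
      by (simp add: mon_remove1[OF il] r_def)
    also have "\<dots> \<le> ?M * (norm (N i t x) * norm (N m t x))" by (intro mult_right_mono monr rj) auto
    finally show "mon l t x * norm (N m t x) \<le> ?M * (norm (N i t x) * norm (N m t x))" .
  qed (intro continuous_intros cont_mon cont_N t0)+
  also have "\<dots> = ?M * J t R (\<lambda>x. norm (N i t x) * norm (N m t x))" by (rule J_cmult)
  also have "\<dots> \<le> ?M * ((K0 * c ^ (2 * i)) * (K0 * c ^ (2 * m)))"
  proof (intro mult_left_mono order_trans[OF J_norm_norm[OF t R]] mult_mono I)
  qed (use im K0_ge c1 F_lim_nonneg[OF t] in auto)
  also have "\<dots> = ((2 * K0) ^ length r * K0 ^ 2) * (c ^ (2 * sum_list (map Suc r) - length r) * c ^ (2 * i) * c ^ (2 * m))"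
    unfolding power2_eq_square[of K0] by (simp only: mult_ac)
  also have "\<dots> \<le> (2 * K0) ^ (m + 7) * c ^ (4 * m + 6)"
  proof (intro mult_mono)
    have "(2 * K0) ^ length r * K0 ^ 2 \<le> (2 * K0) ^ length r * (2 * K0) ^ 2"
      using K0_ge by (intro mult_left_mono power_mono) auto
    also have "\<dots> = (2 * K0) ^ (length r + 2)" by (simp only: power_add)
    also have "\<dots> \<le> (2 * K0) ^ (m + 7)"
      using K0_ge length_le_weight[of l] lr w by (intro power_increasing) auto
    finally show "(2 * K0) ^ length r * K0 ^ 2 \<le> (2 * K0) ^ (m + 7)" .
    have "c ^ (2 * sum_list (map Suc r) - length r) * c ^ (2 * i) * c ^ (2 * m) = c ^ (2 * sum_list (map Suc r) - length r + 2 * i + 2 * m)"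
      by (simp add: power_add)
    also have "\<dots> \<le> c ^ (4 * m + 6)"
      using wr w lr len length_le_weight[of r] by (intro power_increasing c1) linarith
    finally show "c ^ (2 * sum_list (map Suc r) - length r) * c ^ (2 * i) * c ^ (2 * m) \<le> c ^ (4 * m + 6)" .
  qed (use K0_ge c1 in auto)
  finally show ?thesis .
qed


lemma nonlinear_le_cubic:
  assumes P: "cubic (m + 5) P"
  shows "\<exists>C\<ge>0. \<forall>t\<ge>0. \<forall>x. 2 * (N m t x \<bullet> P t x) - (N m t x \<bullet> N m t x) * (V t x \<bullet> K t x) \<le> C * (S (m+5) t x * norm (N m t x))"
proof -
  obtain C where C: "C \<ge> 0" "\<And>t x. norm (P t x) \<le> C * S (m+5) t x" using cubic_bound[OF P] by blast
  have "2 * (N m t x \<bullet> P t x) - (N m t x \<bullet> N m t x) * (V t x \<bullet> K t x) \<le> (2 * C + 3) * (S (m+5) t x * norm (N m t x))" if t: "t \<ge> 0" for t x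
  proof -
    let ?a = "\<lambda>j. norm (N j t x)"
    have "N m t x \<bullet> P t x \<le> ?a m * (C * S (m+5) t x)"
      by (rule order_trans[OF norm_cauchy_schwarz]) (rule mult_left_mono[OF C(2)], simp)
    then have 1: "2 * (N m t x \<bullet> P t x) \<le> 2 * C * (S (m+5) t x * ?a m)" by (simp add: mult_ac)
    have mem: "mon l t x \<le> S (m+5) t x" if "l \<in> monomials (m+5)" for l
      unfolding S_def by (rule member_le_sum) (use that finite_monomials mon_nonneg in auto)
    have "V t x \<bullet> K t x = - (N 2 t x \<bullet> N 0 t x) - 1/2 * (N 0 t x \<bullet> N 0 t x) * (N 0 t x \<bullet> N 0 t x) + N 0 t x \<bullet> N 0 t x"
      by (simp add: V_eq[OF t] N_0 inner_add_left inner_diff_left)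
    moreover have "N 2 t x \<bullet> N 0 t x \<le> ?a 2 * ?a 0" by (rule norm_cauchy_schwarz)
    moreover have "0 \<le> N 0 t x \<bullet> N 0 t x" by simp
    moreover have "1/2 * (N 0 t x \<bullet> N 0 t x) * (N 0 t x \<bullet> N 0 t x) \<le> (?a 0 * ?a 0) * (?a 0 * ?a 0)"
    proof -
      have "0 \<le> (?a 0 * ?a 0) * (?a 0 * ?a 0)" by simp
      then show ?thesis by (simp add: dot_square_norm power2_eq_square)
    qed
    ultimately have "- (V t x \<bullet> K t x) \<le> ?a 2 * ?a 0 + (?a 0 * ?a 0) * (?a 0 * ?a 0)" by linarith
    then have "?a m * (- (V t x \<bullet> K t x)) \<le> ?a m * (?a 2 * ?a 0 + (?a 0 * ?a 0) * (?a 0 * ?a 0))" by (intro mult_left_mono) auto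
    \<comment> \<open>The change of the length element contributes monomials of the same weight.\<close>
    also have "\<dots> = mon [m, 2, 0] t x + mon [m, 0, 0, 0, 0] t x" by (simp add: mon_def algebra_simps)
    also have "\<dots> \<le> 2 * S (m+5) t x" using mem[of "[m,2,0]"] mem[of "[m,0,0,0,0]"] by (simp add: monomials_def)
    also have "\<dots> \<le> 3 * S (m+5) t x" using S_nonneg[of "m+5" t x] by simp
    finally have "?a m * (?a m * (- (V t x \<bullet> K t x))) \<le> ?a m * (3 * S (m+5) t x)" by (rule mult_left_mono) simp
    then have "- ((N m t x \<bullet> N m t x) * (V t x \<bullet> K t x)) \<le> 3 * (S (m+5) t x * ?a m)"
      by (simp add: dot_square_norm power2_eq_square algebra_simps)
    then show ?thesis using 1 by (simp add: algebra_simps)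
  qed
  then show ?thesis using C(1) by (intro exI[of _ "2 * C + 3"]) auto
qed

text \<open>
  The power \<open>4m + 6\<close> of \<open>c\<close> is absorbed by \<open>c\<^sup>4\<^sup>m\<^sup>+\<^sup>8\<close>, which is \<open>F_lim (m+2)\<close> unless that is smaller than \<open>1\<close>. Only the constant \<open>B\<close>
  of the boundary term depends on the time interval, and it disappears as \<open>R\<close> grows.
\<close>

lemma F_deriv_quantitative:
  shows "\<exists>C\<ge>0. \<forall>a>0. \<forall>U. \<exists>B. \<forall>t R. a \<le> t \<longrightarrow> t \<le> U \<longrightarrow> R > 0 \<longrightarrow>
    (\<exists>d. ((\<lambda>t. F m R t) has_real_derivative d) (at t within {0..}) \<and>
         d \<le> - 2 * F (m+2) R t + F_lim (m+2) t + C + B / R)"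
proof -
  obtain P where P: "cubic (m + 5) P"
   "\<And>t R. t \<ge> 0 \<Longrightarrow> ((\<lambda>t. F m R t) has_real_derivative
      (- 2 * F (m+2) R t - 2 * F (m+1) R t + J t R (\<lambda>x. 2 * (N m t x \<bullet> P t x) - (N m t x \<bullet> N m t x) * (V t x \<bullet> K t x))
       + J t R (D (G m) t))) (at t within {0..})" using F_deriv[of m] by blast
  obtain C1 where C1: "C1 \<ge> 0" "\<And>t x. t \<ge> 0 \<Longrightarrow> 2 * (N m t x \<bullet> P t x) - (N m t x \<bullet> N m t x) * (V t x \<bullet> K t x) \<le> C1 * (S (m+5) t x * norm (N m t x))"
    using nonlinear_le_cubic[OF P(1)] by blast
  \<comment> \<open>The number of monomials times the bound of \<open>mon_interpolation\<close> for each of them.\<close>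
  define A1 where "A1 = C1 * (real (card (monomials (m+5))) * (2 * K0) ^ (m + 7))"
  have A1: "A1 \<ge> 0" using C1 K0_ge by (simp add: A1_def)
  define C where "C = 1 + A1 * (A1 + 1) ^ (4 * m + 6)"
  have C: "C \<ge> 0" using A1 by (simp add: C_def)
  have main: "\<exists>B. \<forall>t R. a \<le> t \<longrightarrow> t \<le> U \<longrightarrow> R > 0 \<longrightarrow>
    (\<exists>d. ((\<lambda>t. F m R t) has_real_derivative d) (at t within {0..}) \<and>
         d \<le> - 2 * F (m+2) R t + F_lim (m+2) t + C + B / R)" if a: "a > 0" for a U
  proof -
    obtain A where A: "A > 0" "\<And>f g s R. \<lbrakk>bsmooth f; 0 \<le> s; s \<le> U; R > 0; continuous_on UNIV g; \<And>x. \<bar>f s x\<bar> \<le> g x\<rbrakk>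
      \<Longrightarrow> \<bar>J s R (D f s)\<bar> \<le> A / R * J s (2 * R) g" using J_IBP_dominated[of U] by blast
    obtain CF where CF: "CF \<ge> 0" "\<And>j t R. \<lbrakk>j \<le> m + 3; a \<le> t; t \<le> U; R > 0\<rbrakk> \<Longrightarrow> F j R t \<le> CF"
      using F_bounded_positive_time[OF a, of "m+3" U] by blast
    define B where "B = A * (3 * ((m + 4) * CF))"
    have "\<exists>d. ((\<lambda>t. F m R t) has_real_derivative d) (at t within {0..}) \<and>
         d \<le> - 2 * F (m+2) R t + F_lim (m+2) t + C + B / R" if t: "a \<le> t" "t \<le> U" and R: "R > 0" for t R
    proof -
      have tp: "t > 0" and t0: "t \<ge> 0" using t a by auto
      have m2: "m + 2 > 0" by simp
      obtain c where c: "c \<ge> 1" "c ^ (4 * (m+2)) = max 1 (F_lim (m+2) t)" "\<And>i. i \<le> m+2 \<Longrightarrow> sqrt (F_lim i t) \<le> K0 * c ^ (2 * i)"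
         "\<And>i x. i < m+2 \<Longrightarrow> norm (N i t x) \<le> 2 * K0 * c ^ (2 * i + 1)"
        using F_lim_interpolation[OF tp m2] by blast
      let ?L = "\<lambda>x. 2 * (N m t x \<bullet> P t x) - (N m t x \<bullet> N m t x) * (V t x \<bullet> K t x)"
      have cP: "continuous_on UNIV (P t)" by (rule bsmooth_cont_x[OF cubic_bsmooth[OF P(1)] t0])
      have cV: "continuous_on UNIV (V t)" "continuous_on UNIV (K t)" by (intro bsmooth_cont_x bs_intros t0)+
      have cS: "continuous_on UNIV (\<lambda>x. mon l t x * norm (N m t x))" for l by (intro continuous_intros cont_mon cont_N t0)
      have "J t R ?L \<le> J t R (\<lambda>x. C1 * (\<Sum>l\<in>monomials (m+5). mon l t x * norm (N m t x)))"
      proof (rule J_mono[OF t0 R])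
        show "continuous_on UNIV ?L" by (intro continuous_intros cont_N t0 cP cV)
        show "continuous_on UNIV (\<lambda>x. C1 * (\<Sum>l\<in>monomials (m+5). mon l t x * norm (N m t x)))" by (intro continuous_intros cont_mon cont_N t0)
        show "?L x \<le> C1 * (\<Sum>l\<in>monomials (m+5). mon l t x * norm (N m t x))" for x
          using C1(2)[OF t0, of x] by (simp add: S_def sum_distrib_right)
      qed
      also have "\<dots> = C1 * (\<Sum>l\<in>monomials (m+5). J t R (\<lambda>x. mon l t x * norm (N m t x)))"
        unfolding J_cmult by (subst J_sum[OF t0 finite_monomials cS]) simp
      also have "\<dots> \<le> C1 * (real (card (monomials (m+5))) * ((2 * K0) ^ (m + 7) * c ^ (4 * m + 6)))"
        by (intro mult_left_mono C1(1) sum_bounded_above mon_interpolation tp R c)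
      also have "\<dots> = A1 * c ^ (4 * m + 6)" by (simp add: A1_def)
      also have "\<dots> \<le> c ^ (4 * m + 6 + 2) + A1 * (A1 + 1) ^ (4 * m + 6)" by (rule power_absorb[OF A1 c(1)])
      also have "c ^ (4 * m + 6 + 2) = max 1 (F_lim (m+2) t)" using c(2) by (simp add: algebra_simps)
      also have "\<dots> \<le> 1 + F_lim (m+2) t" using F_lim_nonneg[OF tp, of "m+2"] by simp
      finally have L: "J t R ?L \<le> F_lim (m+2) t + C" by (simp add: C_def)
      let ?g = "\<lambda>x. 3 * (\<Sum>j\<le>m+3. N j t x \<bullet> N j t x)"
      have "\<bar>J t R (D (G m) t)\<bar> \<le> A / R * J t (2 * R) ?g"
      proof (rule A(2)[OF bsmooth_G t0 t(2) R])
        show "continuous_on UNIV ?g" by (intro continuous_intros cont_N t0)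
        fix x
        have sm: "N j t x \<bullet> N j t x \<le> (\<Sum>j\<le>m+3. N j t x \<bullet> N j t x)" if "j \<le> m+3" for j
          by (rule member_le_sum) (use that in auto)
        have ii: "2 * \<bar>N i t x \<bullet> N j t x\<bar> \<le> N i t x \<bullet> N i t x + N j t x \<bullet> N j t x" for i j
          using Cauchy_Schwarz_ineq2[of "N i t x" "N j t x"] sum_squares_bound[of "norm (N i t x)" "norm (N j t x)"]
          by (simp add: dot_square_norm)
        have pair: "2 * \<bar>N i t x \<bullet> N j t x\<bar> \<le> (\<Sum>j\<le>m+3. N j t x \<bullet> N j t x)" if "i \<noteq> j" "i \<le> m+3" "j \<le> m+3" for i j
        proof -
          have "(\<Sum>k\<in>{i,j}. N k t x \<bullet> N k t x) \<le> (\<Sum>j\<le>m+3. N j t x \<bullet> N j t x)"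
            by (rule sum_mono2) (use that in auto)
          then show ?thesis using ii[of i j] that(1) by simp
        qed
        have "\<bar>G m t x\<bar> \<le> 2 * \<bar>N (m+1) t x \<bullet> N (m+2) t x\<bar> + 2 * \<bar>N m t x \<bullet> N (m+3) t x\<bar> + 2 * \<bar>N m t x \<bullet> N (m+1) t x\<bar>"
          unfolding G_def by linarith
        also have "\<dots> \<le> ?g x" using pair[of "m+1" "m+2"] pair[of m "m+3"] pair[of m "m+1"] by simp
        finally show "\<bar>G m t x\<bar> \<le> ?g x" .
      qed
      also have "J t (2 * R) ?g = 3 * (\<Sum>j\<le>m+3. F j (2*R) t)"
        unfolding J_cmult F_def by (subst J_sum[OF t0]) (auto intro: cont_NN t0)
      also have "(\<Sum>j\<le>m+3. F j (2*R) t) \<le> (m + 4) * CF"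
      proof -
        have "(\<Sum>j\<le>m+3. F j (2*R) t) \<le> (\<Sum>j\<le>m+3. CF)" by (intro sum_mono CF t) (use R in auto)
        then show ?thesis by (simp add: add.commute)
      qed
      finally have DG: "\<bar>J t R (D (G m) t)\<bar> \<le> B / R" using A R by (simp add: B_def mult_left_mono divide_right_mono)
      let ?d = "- 2 * F (m+2) R t - 2 * F (m+1) R t + J t R ?L + J t R (D (G m) t)"
      have "?d \<le> - 2 * F (m+2) R t + F_lim (m+2) t + C + B / R"
        using L DG F_nonneg[OF t0 R, of "m+1"] by linarith
      then show ?thesis using P(2)[OF t0, of R] by blast
    qed
    then show ?thesis by blast
  qed
  then show ?thesis using C by blast
qed

lemma F_lim_integrable:
  assumes "0 < s" "s \<le> t"
  shows "(\<lambda>\<tau>. F_lim m \<tau>) integrable_on {s..t}" and "(\<lambda>n. integral {s..t} (\<lambda>\<tau>. F m (real (Suc n)) \<tau>)) \<longlonglongrightarrow> integral {s..t} (F_lim m)"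
proof -
  obtain C where C: "\<And>j \<tau> R. \<lbrakk>j \<le> m; s \<le> \<tau>; \<tau> \<le> t; R > 0\<rbrakk> \<Longrightarrow> F j R \<tau> \<le> C"
    using F_bounded_positive_time[OF assms(1), of m t] by blast
  have "F_lim m integrable_on {s..t} \<and> (\<lambda>n. integral {s..t} (\<lambda>\<tau>. F m (real (Suc n)) \<tau>)) \<longlonglongrightarrow> integral {s..t} (F_lim m)"
  proof (rule conjI)
    have i: "(\<lambda>\<tau>. F m (real (Suc n)) \<tau>) integrable_on {s..t}" for n by (rule F_integrable) (use assms in simp)
    have b: "norm (F m (real (Suc n)) \<tau>) \<le> C" if "\<tau> \<in> {s..t}" for n \<tau>
      using C[of m \<tau> "real (Suc n)"] F_nonneg[of \<tau> "real (Suc n)" m] that assms by auto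
    have l: "(\<lambda>n. F m (real (Suc n)) \<tau>) \<longlonglongrightarrow> F_lim m \<tau>" if "\<tau> \<in> {s..t}" for \<tau>
      by (rule F_lim_tendsto) (use that assms in auto)
    show "F_lim m integrable_on {s..t}"
      by (rule dominated_convergence(1)[OF i _ b l]) auto
    show "(\<lambda>n. integral {s..t} (\<lambda>\<tau>. F m (real (Suc n)) \<tau>)) \<longlonglongrightarrow> integral {s..t} (F_lim m)"
      by (rule dominated_convergence(2)[OF i _ b l]) auto
  qed
  then show "(\<lambda>\<tau>. F_lim m \<tau>) integrable_on {s..t}" "(\<lambda>n. integral {s..t} (\<lambda>\<tau>. F m (real (Suc n)) \<tau>)) \<longlonglongrightarrow> integral {s..t} (F_lim m)" by auto
qed

text \<open>
  Dominated convergence in time replaces the cut-off quantities by their limits.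
\<close>

lemma F_lim_damped:
  "\<exists>C\<ge>0. \<forall>s t. 0 < s \<longrightarrow> s \<le> t \<longrightarrow> F_lim m t - F_lim m s \<le> C * (t - s) - integral {s..t} (F_lim (m+2))"
proof -
  obtain C where C: "C \<ge> 0" "\<And>a U. a > 0 \<Longrightarrow> \<exists>B. \<forall>t R. a \<le> t \<longrightarrow> t \<le> U \<longrightarrow> R > 0 \<longrightarrow>
    (\<exists>d. ((\<lambda>t. F m R t) has_real_derivative d) (at t within {0..}) \<and>
         d \<le> - 2 * F (m+2) R t + F_lim (m+2) t + C + B / R)" using F_deriv_quantitative[of m] by blast
  have "F_lim m t - F_lim m s \<le> C * (t - s) - integral {s..t} (F_lim (m+2))" if st: "0 < s" "s \<le> t" for s t
  proof -
    obtain B where B: "\<And>\<tau> R. s \<le> \<tau> \<Longrightarrow> \<tau> \<le> t \<Longrightarrow> R > 0 \<Longrightarrow>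
      (\<exists>d. ((\<lambda>t. F m R t) has_real_derivative d) (at \<tau> within {0..}) \<and>
         d \<le> - 2 * F (m+2) R \<tau> + F_lim (m+2) \<tau> + C + B / R)" using C(2)[OF st(1), of t] by blast
    let ?I = "integral {s..t} (F_lim (m+2))"
    have step: "F m R t - F m R s \<le> - 2 * integral {s..t} (\<lambda>\<tau>. F (m+2) R \<tau>) + ?I + (C + B / R) * (t - s)" if R: "R > 0" for R
    proof -
      have "\<forall>\<tau>. \<exists>d. s \<le> \<tau> \<and> \<tau> \<le> t \<longrightarrow> ((\<lambda>t. F m R t) has_real_derivative d) (at \<tau> within {0..}) \<and>
         d \<le> - 2 * F (m+2) R \<tau> + F_lim (m+2) \<tau> + C + B / R" using B R by blast
      then obtain d where d: "\<And>\<tau>. s \<le> \<tau> \<Longrightarrow> \<tau> \<le> t \<Longrightarrow> ((\<lambda>t. F m R t) has_real_derivative d \<tau>) (at \<tau> within {0..})"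
         "\<And>\<tau>. s \<le> \<tau> \<Longrightarrow> \<tau> \<le> t \<Longrightarrow> d \<tau> \<le> - 2 * F (m+2) R \<tau> + F_lim (m+2) \<tau> + C + B / R" by metis
      have s0: "0 \<le> s" using st by simp
      have i1: "(\<lambda>\<tau>. - 2 * F (m+2) R \<tau>) integrable_on {s..t}" by (intro integrable_on_mult_right F_integrable s0)
      have i2: "F_lim (m+2) integrable_on {s..t}" by (rule F_lim_integrable(1)[OF st])
      have i3: "(\<lambda>\<tau>. C + B / R) integrable_on {s..t}" by (rule integrable_const_ivl)
      have "F m R t - F m R s \<le> integral {s..t} (\<lambda>\<tau>. (- 2 * F (m+2) R \<tau> + F_lim (m+2) \<tau>) + (C + B / R))"
      proof (rule deriv_le_integral[OF s0 st(2) d(1)])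
        show "(\<lambda>\<tau>. (- 2 * F (m+2) R \<tau> + F_lim (m+2) \<tau>) + (C + B / R)) integrable_on {s..t}"
          by (intro integrable_add i1 i2 i3)
      qed (use d(2) in \<open>auto simp: add.assoc\<close>)
      also have "\<dots> = (integral {s..t} (\<lambda>\<tau>. - 2 * F (m+2) R \<tau>) + ?I) + integral {s..t} (\<lambda>\<tau>. C + B / R)"
        unfolding integral_add[OF integrable_add[OF i1 i2] i3] integral_add[OF i1 i2] ..
      also have "\<dots> = - 2 * integral {s..t} (\<lambda>\<tau>. F (m+2) R \<tau>) + ?I + (C + B / R) * (t - s)" using st by simp
      finally show ?thesis .
    qed
    have "F_lim m t - F_lim m s \<le> - 2 * ?I + ?I + (C + 0) * (t - s)"
    proof (rule LIMSEQ_le)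
      show "(\<lambda>n. F m (real (Suc n)) t - F m (real (Suc n)) s) \<longlonglongrightarrow> F_lim m t - F_lim m s"
        by (intro tendsto_diff F_lim_tendsto) (use st in auto)
      have "(\<lambda>n. B / real (Suc n)) \<longlonglongrightarrow> 0" by (rule LIMSEQ_Suc[OF lim_const_over_n])
      then show "(\<lambda>n. - 2 * integral {s..t} (\<lambda>\<tau>. F (m+2) (real (Suc n)) \<tau>) + ?I + (C + B / real (Suc n)) * (t - s)) \<longlonglongrightarrow> - 2 * ?I + ?I + (C + 0) * (t - s)"
        by (intro tendsto_intros F_lim_integrable(2)[OF st])
      show "\<exists>n0. \<forall>n\<ge>n0. F m (real (Suc n)) t - F m (real (Suc n)) s \<le> - 2 * integral {s..t} (\<lambda>\<tau>. F (m+2) (real (Suc n)) \<tau>) + ?I + (C + B / real (Suc n)) * (t - s)"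
        using step by (intro exI[of _ 0] allI impI) simp
    qed
    then show ?thesis by simp
  qed
  then show ?thesis using C(1) by blast
qed

lemma F_lim_le_higher: assumes t: "t > 0" shows "F_lim m t \<le> K0\<^sup>2 * (1 + F_lim (m+2) t)"
proof -
  have m2: "m + 2 > 0" by simp
  obtain c where c: "c \<ge> 1" "c ^ (4 * (m+2)) = max 1 (F_lim (m+2) t)" "\<And>i. i \<le> m+2 \<Longrightarrow> sqrt (F_lim i t) \<le> K0 * c ^ (2 * i)"
     "\<And>i x. i < m+2 \<Longrightarrow> norm (N i t x) \<le> 2 * K0 * c ^ (2 * i + 1)"
    using F_lim_interpolation[OF t m2] by blast
  have "(sqrt (F_lim m t))\<^sup>2 \<le> (K0 * c ^ (2 * m))\<^sup>2" by (intro power_mono c) (use F_lim_nonneg[OF t] in auto)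
  then have "F_lim m t \<le> K0\<^sup>2 * c ^ (4 * m)" using F_lim_nonneg[OF t, of m] by (simp add: power_mult_distrib power_mult[symmetric] mult.commute)
  also have "\<dots> \<le> K0\<^sup>2 * c ^ (4 * (m+2))" by (intro mult_left_mono power_increasing c) auto
  also have "\<dots> \<le> K0\<^sup>2 * (1 + F_lim (m+2) t)" unfolding c(2) using F_lim_nonneg[OF t, of "m+2"] by (intro mult_left_mono) auto
  finally show ?thesis .
qed

text \<open>
  By interpolation the damping by \<open>F_lim (m+2)\<close> is at least a multiple of \<open>F_lim m\<close> up to a constant.
\<close>

theorem F_lim_uniform_bound: "\<exists>B. \<forall>t\<ge>1. F_lim m t \<le> B"
proof -
  obtain C where C: "C \<ge> 0" "\<And>s t. 0 < s \<Longrightarrow> s \<le> t \<Longrightarrow> F_lim m t - F_lim m s \<le> C * (t - s) - integral {s..t} (F_lim (m+2))"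
    using F_lim_damped[of m] by blast
  \<comment> \<open>The factor lost in \<open>F_lim_le_higher\<close>.\<close>
  define k where "k = 1 / K0\<^sup>2"
  have K: "K0\<^sup>2 \<ge> 1" using K0_ge by (simp add: one_le_power)
  have "0 < K0\<^sup>2" using K by linarith
  then have k: "0 < k" "k \<le> 1" using K by (simp_all add: k_def)
  show ?thesis
  proof (rule bounded_of_damped_inequality[of "C + 1" k])
    fix s t :: real assume st: "1 \<le> s" "s \<le> t"
    then have s0: "0 < s" by simp
    show i: "F_lim m integrable_on {s..t}" by (rule F_lim_integrable(1)[OF s0 st(2)])
    have "integral {s..t} (\<lambda>\<tau>. k * F_lim m \<tau> - 1) \<le> integral {s..t} (F_lim (m+2))"
    proof (rule integral_le)
      show "(\<lambda>\<tau>. k * F_lim m \<tau> - 1) integrable_on {s..t}" by (intro integrable_diff integrable_on_mult_right i integrable_const_ivl)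
      show "F_lim (m+2) integrable_on {s..t}" by (rule F_lim_integrable(1)[OF s0 st(2)])
      fix \<tau> assume "\<tau> \<in> {s..t}"
      then have "F_lim m \<tau> \<le> K0\<^sup>2 * (1 + F_lim (m+2) \<tau>)" using s0 by (intro F_lim_le_higher) auto
      then have "k * F_lim m \<tau> \<le> k * (K0\<^sup>2 * (1 + F_lim (m+2) \<tau>))" using k by (intro mult_left_mono) auto
      also have "\<dots> = 1 + F_lim (m+2) \<tau>" using \<open>0 < K0\<^sup>2\<close> by (simp add: k_def)
      finally show "k * F_lim m \<tau> - 1 \<le> F_lim (m+2) \<tau>" by simp
    qed
    also have "integral {s..t} (\<lambda>\<tau>. k * F_lim m \<tau> - 1) = k * integral {s..t} (F_lim m) - (t - s)"
      using st by (subst integral_diff[OF integrable_on_mult_right[OF i] integrable_const_ivl]) simp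
    finally show "F_lim m t - F_lim m s \<le> (C + 1) * (t - s) - k * integral {s..t} (F_lim m)"
      using C(2)[OF s0 st(2)] by (simp add: algebra_simps)
  next
    show "0 \<le> F_lim m t" if "1 \<le> t" for t using that by (intro F_lim_nonneg) simp
  qed (use C k in auto)
qed

theorem N_uniform_bound: "\<exists>B\<ge>0. \<forall>t\<ge>1. \<forall>x. norm (N m t x) \<le> B"
proof -
  obtain B1 B2 where B: "\<And>t. t \<ge> 1 \<Longrightarrow> F_lim m t \<le> B1" "\<And>t. t \<ge> 1 \<Longrightarrow> F_lim (m+1) t \<le> B2"
    using F_lim_uniform_bound by metis
  let ?B = "2 * (sqrt B1 * sqrt B2)"
  have B0: "0 \<le> B1" "0 \<le> B2" using B[of 1] F_lim_nonneg[of 1 m] F_lim_nonneg[of 1 "m+1"] by auto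
  have "norm (N m t x) \<le> sqrt ?B" if "t \<ge> 1" for t x
  proof (rule real_le_rsqrt)
    have t: "t > 0" using that by simp
    have "(norm (N m t x))\<^sup>2 \<le> 2 * (sqrt (F_lim m t) * sqrt (F_lim (m+1) t))" by (rule N_sup_le[OF t])
    also have "\<dots> \<le> ?B" by (intro mult_left_mono mult_mono real_sqrt_le_mono B that) (use B0 F_lim_nonneg[OF t] in auto)
    finally show "(norm (N m t x))\<^sup>2 \<le> ?B" .
  qed
  then show ?thesis using B0 by (intro exI[of _ "sqrt ?B"]) auto
qed

end

section \<open>Decay of the velocity\<close>

text \<open>
  On an interval of length \<open>\<surd>\<epsilon>\<close> the function stays above \<open>y t - C \<surd>\<epsilon>\<close>, so a larger value at \<open>t\<close> would make the integral exceed \<open>\<epsilon>\<close>.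
\<close>

lemma small_of_integral_small:
  fixes y :: "real \<Rightarrow> real"
  assumes C: "C \<ge> 0" and \<epsilon>: "\<epsilon> > 0" and t: "0 \<le> t"
    and d: "\<And>s. t \<le> s \<Longrightarrow> (y has_real_derivative y' s) (at s within {0..})" "\<And>s. t \<le> s \<Longrightarrow> \<bar>y' s\<bar> \<le> C"
    and I: "integral {t..t + sqrt \<epsilon>} y \<le> \<epsilon>"
  shows "y t \<le> (1 + C) * sqrt \<epsilon>"
proof -
  have h: "sqrt \<epsilon> > 0" using \<epsilon> by simp
  have low: "y t - C * sqrt \<epsilon> \<le> y s" if s: "t \<le> s" "s \<le> t + sqrt \<epsilon>" for s
  proof -
    have "(\<lambda>u. - y u) s - (\<lambda>u. - y u) t \<le> integral {t..s} (\<lambda>u. C)"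
    proof (rule deriv_le_integral[OF t s(1), of _ "\<lambda>u. - y' u"])
      fix u assume "t \<le> u" "u \<le> s"
      then show "((\<lambda>u. - y u) has_real_derivative - y' u) (at u within {0..})" "- y' u \<le> C"
        using d[of u] by (auto intro: DERIV_minus)
    qed auto
    also have "\<dots> = C * (s - t)" using s by simp
    also have "\<dots> \<le> C * sqrt \<epsilon>" using s C by (intro mult_left_mono) auto
    finally show ?thesis by simp
  qed
  have i: "y integrable_on {t..t + sqrt \<epsilon>}"
  proof (rule integrable_continuous_real)
    have "continuous_on {t..} y"
    proof (rule DERIV_continuous_on)
      fix s assume "s \<in> {t..}"
      then show "(y has_real_derivative y' s) (at s within {t..})" using d(1)[of s] t by (auto intro: DERIV_subset)
    qed
    then show "continuous_on {t..t + sqrt \<epsilon>} y" by (rule continuous_on_subset) auto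
  qed
  have "integral {t..t + sqrt \<epsilon>} (\<lambda>_. y t - C * sqrt \<epsilon>) \<le> integral {t..t + sqrt \<epsilon>} y"
    by (rule integral_le) (use i low in auto)
  then have "sqrt \<epsilon> * (y t - C * sqrt \<epsilon>) \<le> \<epsilon>" using I h by simp
  also have e2: "\<epsilon> = sqrt \<epsilon> * sqrt \<epsilon>" using \<epsilon> by simp
  finally have "y t - C * sqrt \<epsilon> \<le> sqrt \<epsilon>" by (rule mult_left_le_imp_le[OF _ h])
  then show ?thesis by (simp add: algebra_simps)
qed

context finite_energy_flow
begin

text \<open>
  Pointwise domination by finitely many \<open>N i\<close>, uniformly for \<open>t \<ge> 1\<close>. Such fields are bounded and square integrable along the
  curve, uniformly in time.
\<close>

definition curvature_dominated :: "(real \<Rightarrow> real \<Rightarrow> 'a) \<Rightarrow> bool" where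
  "curvature_dominated f \<longleftrightarrow> (\<exists>C\<ge>0. \<exists>k. \<forall>t\<ge>1. \<forall>x. norm (f t x) \<le> C * (\<Sum>i\<le>k. norm (N i t x)))"

lemma curvature_dominatedI: "C \<ge> 0 \<Longrightarrow> (\<And>t x. t \<ge> 1 \<Longrightarrow> norm (f t x) \<le> C * (\<Sum>i\<le>k. norm (N i t x))) \<Longrightarrow> curvature_dominated f"
  unfolding curvature_dominated_def by blast

lemma sum_N_mono: "k \<le> k' \<Longrightarrow> (\<Sum>i\<le>k. norm (N i t x)) \<le> (\<Sum>i\<le>k'. norm (N i t x))"
  by (rule sum_mono2) auto

lemma curvature_dominated_N: "curvature_dominated (N i)"
proof (rule curvature_dominatedI[of 1 _ i])
  show "norm (N i t x) \<le> 1 * (\<Sum>j\<le>i. norm (N j t x))" for t x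
    unfolding mult_1 by (rule member_le_sum) auto
qed simp

lemma curvature_dominated_add: assumes "curvature_dominated f" "curvature_dominated g" shows "curvature_dominated (\<lambda>t x. f t x + g t x)"
proof -
  obtain C k where f: "C \<ge> 0" "\<And>t x. t \<ge> 1 \<Longrightarrow> norm (f t x) \<le> C * (\<Sum>i\<le>k. norm (N i t x))" using assms(1) unfolding curvature_dominated_def by blast
  obtain D l where g: "D \<ge> 0" "\<And>t x. t \<ge> 1 \<Longrightarrow> norm (g t x) \<le> D * (\<Sum>i\<le>l. norm (N i t x))" using assms(2) unfolding curvature_dominated_def by blast
  show ?thesis
  proof (rule curvature_dominatedI[of "C + D" _ "max k l"])
    fix t x :: real assume t: "t \<ge> 1"
    have "norm (f t x + g t x) \<le> norm (f t x) + norm (g t x)" by (rule norm_triangle_ineq)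
    also have "\<dots> \<le> C * (\<Sum>i\<le>max k l. norm (N i t x)) + D * (\<Sum>i\<le>max k l. norm (N i t x))"
      by (intro add_mono order_trans[OF f(2)[OF t]] order_trans[OF g(2)[OF t]] mult_left_mono sum_N_mono f g) auto
    finally show "norm (f t x + g t x) \<le> (C + D) * (\<Sum>i\<le>max k l. norm (N i t x))" by (simp add: algebra_simps)
  qed (use f g in simp)
qed

lemma curvature_dominated_scale:
  assumes "curvature_dominated f" "\<exists>B. \<forall>t\<ge>1. \<forall>x. \<bar>a t x\<bar> \<le> B"
  shows "curvature_dominated (\<lambda>t x. a t x *\<^sub>R f t x)"
proof -
  obtain C k where f: "C \<ge> 0" "\<And>t x. t \<ge> 1 \<Longrightarrow> norm (f t x) \<le> C * (\<Sum>i\<le>k. norm (N i t x))" using assms(1) unfolding curvature_dominated_def by blast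
  obtain B where B: "\<And>t x. t \<ge> 1 \<Longrightarrow> \<bar>a t x\<bar> \<le> B" using assms(2) by blast
  have B0: "B \<ge> 0" using B[of 1 0] by simp
  show ?thesis
  proof (rule curvature_dominatedI[of "B * C" _ k])
    fix t x :: real assume t: "t \<ge> 1"
    show "norm (a t x *\<^sub>R f t x) \<le> B * C * (\<Sum>i\<le>k. norm (N i t x))"
      unfolding norm_scaleR mult.assoc by (intro mult_mono B f t B0) auto
  qed (use B0 f in simp)
qed

lemma curvature_dominated_cscale: "curvature_dominated f \<Longrightarrow> curvature_dominated (\<lambda>t x. c *\<^sub>R f t x)"
  by (rule curvature_dominated_scale) auto

lemma curvature_dominated_diff: "curvature_dominated f \<Longrightarrow> curvature_dominated g \<Longrightarrow> curvature_dominated (\<lambda>t x. f t x - g t x)"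
  using curvature_dominated_add[OF _ curvature_dominated_cscale, of f g "-1"] by simp

lemma curvature_dominated_cong: "(\<And>t x. t \<ge> 1 \<Longrightarrow> f t x = g t x) \<Longrightarrow> curvature_dominated g \<Longrightarrow> curvature_dominated f"
  unfolding curvature_dominated_def by auto

lemma N_uniform_bound_upto: "\<exists>B\<ge>1. \<forall>j\<le>k. \<forall>t\<ge>1. \<forall>x. norm (N j t x) \<le> B"
proof (induction k)
  case 0
  obtain B where "\<forall>t\<ge>1. \<forall>x. norm (N 0 t x) \<le> B" using N_uniform_bound by blast
  then show ?case by (intro exI[of _ "max 1 B"]) (auto simp: le_max_iff_disj)
next
  case (Suc k)
  then obtain B where B: "B \<ge> 1" "\<forall>j\<le>k. \<forall>t\<ge>1. \<forall>x. norm (N j t x) \<le> B" by blast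
  obtain B' where B': "\<forall>t\<ge>1. \<forall>x. norm (N (Suc k) t x) \<le> B'" using N_uniform_bound by blast
  show ?case using B B' by (intro exI[of _ "max B B'"]) (auto simp: le_max_iff_disj le_Suc_eq)
qed

lemma curvature_dominated_bounded: assumes "curvature_dominated f" shows "\<exists>B\<ge>0. \<forall>t\<ge>1. \<forall>x. norm (f t x) \<le> B"
proof -
  obtain C k where f: "C \<ge> 0" "\<And>t x. t \<ge> 1 \<Longrightarrow> norm (f t x) \<le> C * (\<Sum>i\<le>k. norm (N i t x))" using assms unfolding curvature_dominated_def by blast
  obtain B where B: "B \<ge> 1" "\<And>j t x. j \<le> k \<Longrightarrow> t \<ge> 1 \<Longrightarrow> norm (N j t x) \<le> B" using N_uniform_bound_upto[of k] by blast
  have "norm (f t x) \<le> C * (\<Sum>i\<le>k. B)" if "t \<ge> 1" for t x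
    by (rule order_trans[OF f(2)[OF that]]) (intro mult_left_mono sum_mono f B that, simp)
  moreover have "0 \<le> C * (\<Sum>i\<le>k. B)" using f B by simp
  ultimately show ?thesis by blast
qed

lemma curvature_dominated_inner_bounded: assumes "curvature_dominated f" "curvature_dominated g" shows "\<exists>B. \<forall>t\<ge>1. \<forall>x. \<bar>f t x \<bullet> g t x\<bar> \<le> B"
proof -
  obtain A B where A: "A \<ge> 0" "\<And>t x. t \<ge> 1 \<Longrightarrow> norm (f t x) \<le> A" and B: "B \<ge> 0" "\<And>t x. t \<ge> 1 \<Longrightarrow> norm (g t x) \<le> B"
    using curvature_dominated_bounded[OF assms(1)] curvature_dominated_bounded[OF assms(2)] by blast
  have "\<bar>f t x \<bullet> g t x\<bar> \<le> A * B" if "t \<ge> 1" for t x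
    by (rule order_trans[OF Cauchy_Schwarz_ineq2]) (intro mult_mono A B that, simp)
  then show ?thesis by blast
qed

lemma curvature_dominated_cubic: assumes "cubic (m + 5) P" shows "curvature_dominated P"
proof -
  obtain C where C: "C \<ge> 0" "\<And>t x. norm (P t x) \<le> C * S (m+5) t x" using cubic_bound[OF assms] by blast
  obtain B where B: "B \<ge> 1" "\<And>j t x. j \<le> m+2 \<Longrightarrow> t \<ge> 1 \<Longrightarrow> norm (N j t x) \<le> B" using N_uniform_bound_upto[of "m+2"] by blast
  let ?n = "real (card (monomials (m+5)))"
  show ?thesis
  proof (rule curvature_dominatedI[of "C * (?n * B ^ (m+5))" _ "m+2"])
    fix t x :: real assume t: "t \<ge> 1"
    have "S (m+5) t x \<le> ?n * (B ^ (m + 5) * (\<Sum>j\<le>m+2. norm (N j t x)))"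
      unfolding S_def by (rule sum_bounded_above) (rule mon_le_linear[OF B(1) B(2)[OF _ t]])
    then have "C * S (m+5) t x \<le> C * (?n * (B ^ (m + 5) * (\<Sum>j\<le>m+2. norm (N j t x))))"
      by (rule mult_left_mono[OF _ C(1)])
    then show "norm (P t x) \<le> C * (?n * B ^ (m+5)) * (\<Sum>j\<le>m+2. norm (N j t x))"
      using C(2)[of t x] by (simp add: algebra_simps)
  qed (use C B in simp)
qed

lemma curvature_dominated_Nt_N: "curvature_dominated (Nt (N m))"
proof -
  obtain P where P: "cubic (m + 5) P" "\<And>t x. t \<ge> 0 \<Longrightarrow> Nt (N m) t x = - N (m + 4) t x + N (m + 2) t x + P t x"
    using evolution_N[of m] by blast
  have "curvature_dominated (\<lambda>t x. ((-1) *\<^sub>R N (m + 4) t x + N (m + 2) t x) + P t x)"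
    by (intro curvature_dominated_add curvature_dominated_cscale curvature_dominated_N curvature_dominated_cubic[OF P(1)])
  then show ?thesis by (rule curvature_dominated_cong[rotated]) (simp add: P(2))
qed

lemma curvature_dominated_V: "curvature_dominated V"
proof -
  have "curvature_dominated (\<lambda>t x. ((-1) *\<^sub>R N 2 t x - (1/2) *\<^sub>R ((N 0 t x \<bullet> N 0 t x) *\<^sub>R N 0 t x)) + N 0 t x)"
    by (intro curvature_dominated_add curvature_dominated_diff curvature_dominated_cscale curvature_dominated_scale curvature_dominated_inner_bounded curvature_dominated_N)
  then show ?thesis by (rule curvature_dominated_cong[rotated]) (simp add: V_eq)
qed

lemma Dt_diff: "bsmooth f \<Longrightarrow> bsmooth g \<Longrightarrow> t \<ge> 0 \<Longrightarrow> Dt (\<lambda>t x. f t x - g t x) t x = Dt f t x - Dt g t x"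
  by (intro Dt_eqI has_vector_derivative_diff bsmooth_deriv)

lemma curvature_dominated_Nt_V: "curvature_dominated (Nt V)"
proof -
  let ?q = "\<lambda>t x. (1/2 * (N 0 t x \<bullet> N 0 t x)) *\<^sub>R N 0 t x"
  have eq: "Nt V t x = (Nt (N 0) t x - Nt (N 2) t x) - ((N 0 t x \<bullet> Nt (N 0) t x) *\<^sub>R N 0 t x + (1/2) *\<^sub>R ((N 0 t x \<bullet> N 0 t x) *\<^sub>R Nt (N 0) t x))"
    if t: "t \<ge> 0" for t x
  proof -
    have n0: "bsmooth (N 0)" "normal_field (N 0)" by (rule bsmooth_N, rule normal_N)
    have "Dt V t x = Dt (\<lambda>t x. (N 0 t x - N 2 t x) - ?q t x) t x"
      by (rule Dt_cong[OF _ t smooth_t]) (simp add: V_eq)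
    also have "\<dots> = (Dt (N 0) t x - Dt (N 2) t x) - Dt ?q t x"
      by (subst Dt_diff Dt_diff, (intro bs_intros t)+)+ simp
    also have "Dt ?q t x = (1/2 * (N 0 t x \<bullet> N 0 t x)) *\<^sub>R Dt (N 0) t x + Dt (\<lambda>t x. 1/2 * (N 0 t x \<bullet> N 0 t x)) t x *\<^sub>R N 0 t x"
      by (rule Dt_scaleR) (intro bs_intros t)+
    also have "Dt (\<lambda>t x. 1/2 * (N 0 t x \<bullet> N 0 t x)) t x = 1/2 * (N 0 t x \<bullet> Dt (N 0) t x + Dt (N 0) t x \<bullet> N 0 t x)"
      by (intro Dt_eqI t has_vector_derivative_mult_right bounded_bilinear.has_vector_derivative[OF bounded_bilinear_inner] bsmooth_deriv bsmooth_N)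
    also have "\<dots> = N 0 t x \<bullet> Nt (N 0) t x"
      using Dt_normal[OF n0 t] n0(2) t by (simp add: inner_commute inner_diff_right normal_field_def)
    finally show ?thesis unfolding Nt_def
      by (simp add: perp_add perp_diff perp_scaleR perp_normal[OF normal_N t])
  qed
  have "curvature_dominated (\<lambda>t x. (Nt (N 0) t x - Nt (N 2) t x) - ((N 0 t x \<bullet> Nt (N 0) t x) *\<^sub>R N 0 t x + (1/2) *\<^sub>R ((N 0 t x \<bullet> N 0 t x) *\<^sub>R Nt (N 0) t x)))"
    by (intro curvature_dominated_add curvature_dominated_diff curvature_dominated_cscale curvature_dominated_scale curvature_dominated_inner_bounded curvature_dominated_N curvature_dominated_Nt_N)
  then show ?thesis by (rule curvature_dominated_cong[rotated]) (simp add: eq)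
qed

lemma F_uniform: "\<exists>B. \<forall>t\<ge>1. \<forall>R>0. F m R t \<le> B"
proof -
  obtain B where "\<forall>t\<ge>1. F_lim m t \<le> B" using F_lim_uniform_bound by blast
  then have "F m R t \<le> B" if "t \<ge> 1" "R > 0" for t R
    using F_le_F_lim[of t R m] that by force
  then show ?thesis by blast
qed

lemma curvature_dominated_J:
  assumes "curvature_dominated f" "bsmooth f"
  shows "\<exists>B\<ge>0. \<forall>t\<ge>1. \<forall>R>0. J t R (\<lambda>x. f t x \<bullet> f t x) \<le> B"
proof -
  obtain C k where f: "C \<ge> 0" "\<And>t x. t \<ge> 1 \<Longrightarrow> norm (f t x) \<le> C * (\<Sum>i\<le>k. norm (N i t x))" using assms(1) unfolding curvature_dominated_def by blast
  have "\<exists>B. \<forall>i. \<forall>t\<ge>1. \<forall>R>0. F i R t \<le> B i" using F_uniform by metis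
  then obtain B where B: "\<And>i t R. t \<ge> 1 \<Longrightarrow> R > 0 \<Longrightarrow> F i R t \<le> B i" by blast
  let ?c = "C\<^sup>2 * (k + 1)"
  have "J t R (\<lambda>x. f t x \<bullet> f t x) \<le> ?c * (\<Sum>i\<le>k. B i)" if t: "t \<ge> 1" and R: "R > 0" for t R
  proof -
    have t0: "t \<ge> 0" using t by simp
    have "J t R (\<lambda>x. f t x \<bullet> f t x) \<le> J t R (\<lambda>x. ?c * (\<Sum>i\<le>k. N i t x \<bullet> N i t x))"
    proof (rule J_mono[OF t0 R])
      fix x
      have "(norm (f t x))\<^sup>2 \<le> (C * (\<Sum>i\<le>k. norm (N i t x)))\<^sup>2" by (intro power_mono f(2) t) auto
      also have "\<dots> = C\<^sup>2 * (\<Sum>i\<le>k. norm (N i t x))\<^sup>2" by (simp add: power_mult_distrib)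
      also have "\<dots> \<le> C\<^sup>2 * ((\<Sum>i\<le>k. (norm (N i t x))\<^sup>2) * card {..k})"
        by (intro mult_left_mono sum_squared_le_sum_of_squares) auto
      finally show "f t x \<bullet> f t x \<le> ?c * (\<Sum>i\<le>k. N i t x \<bullet> N i t x)"
        by (simp add: dot_square_norm algebra_simps)
    qed (intro continuous_intros bsmooth_cont_x assms(2) bsmooth_N t0)+
    also have "\<dots> = ?c * (\<Sum>i\<le>k. F i R t)"
      unfolding J_cmult F_def by (subst J_sum[OF t0]) (auto intro: cont_NN t0)
    also have "\<dots> \<le> ?c * (\<Sum>i\<le>k. B i)" by (intro mult_left_mono sum_mono B t R) auto
    finally show ?thesis .
  qed
  then show ?thesis by (intro exI[of _ "max 0 (?c * (\<Sum>i\<le>k. B i))"]) (auto simp: le_max_iff_disj)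
qed

definition Y :: "real \<Rightarrow> real \<Rightarrow> real" where "Y R t = J t R (\<lambda>x. V t x \<bullet> V t x)"

text \<open>
  Both \<open>V\<close> and \<open>\<nabla>\<^sub>tV\<close> are dominated by curvature derivatives, so the integral of \<open>\<bar>V\<bar>\<^sup>2\<close> is Lipschitz in time with a constant
  that does not depend on \<open>R\<close>.
\<close>

lemma Y_deriv_bound:
  "\<exists>C\<ge>0. \<forall>t\<ge>1. \<forall>R>0. \<exists>d. ((\<lambda>t. Y R t) has_real_derivative d) (at t within {0..}) \<and> \<bar>d\<bar> \<le> C"
proof -
  have bN: "bsmooth (Nt V)" by (intro bs_intros)
  obtain B1 where B1: "\<And>t R. t \<ge> 1 \<Longrightarrow> R > 0 \<Longrightarrow> J t R (\<lambda>x. V t x \<bullet> V t x) \<le> B1" "B1 \<ge> 0" using curvature_dominated_J[OF curvature_dominated_V smooth_t] by blast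
  obtain B2 where B2: "\<And>t R. t \<ge> 1 \<Longrightarrow> R > 0 \<Longrightarrow> J t R (\<lambda>x. Nt V t x \<bullet> Nt V t x) \<le> B2" "B2 \<ge> 0" using curvature_dominated_J[OF curvature_dominated_Nt_V bN] by blast
  have "curvature_dominated K" using curvature_dominated_N[of 0] by (simp add: N_0)
  then obtain B3 where B3: "\<And>t x. t \<ge> 1 \<Longrightarrow> \<bar>V t x \<bullet> K t x\<bar> \<le> B3" using curvature_dominated_inner_bounded[OF curvature_dominated_V] by blast
  have B30: "B3 \<ge> 0" using B3[of 1 0] by simp
  have "\<exists>d. ((\<lambda>t. Y R t) has_real_derivative d) (at t within {0..}) \<and> \<bar>d\<bar> \<le> (1 + B3) * B1 + B2" if t: "t \<ge> 1" and R: "R > 0" for t R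
  proof -
    have t0: "t \<ge> 0" using t by simp
    let ?L = "\<lambda>x. 2 * (V t x \<bullet> Nt V t x) - (V t x \<bullet> V t x) * (V t x \<bullet> K t x)"
    let ?M = "\<lambda>x. (1 + B3) * (V t x \<bullet> V t x) + Nt V t x \<bullet> Nt V t x"
    have c: "continuous_on UNIV (V t)" "continuous_on UNIV (Nt V t)" "continuous_on UNIV (K t)" by (intro bsmooth_cont_x bs_intros t0)+
    have pt: "\<bar>?L x\<bar> \<le> ?M x" for x
    proof -
      have "2 * \<bar>V t x \<bullet> Nt V t x\<bar> \<le> V t x \<bullet> V t x + Nt V t x \<bullet> Nt V t x"
        using Cauchy_Schwarz_ineq2[of "V t x" "Nt V t x"] sum_squares_bound[of "norm (V t x)" "norm (Nt V t x)"]
        by (simp add: dot_square_norm)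
      moreover have "\<bar>(V t x \<bullet> V t x) * (V t x \<bullet> K t x)\<bar> \<le> (V t x \<bullet> V t x) * B3"
        unfolding abs_mult using B3[OF t, of x] by (simp add: mult_left_mono)
      moreover have "?M x = (V t x \<bullet> V t x + Nt V t x \<bullet> Nt V t x) + (V t x \<bullet> V t x) * B3" by (simp add: algebra_simps)
      ultimately show ?thesis by linarith
    qed
    have JM: "J t R ?M = (1 + B3) * J t R (\<lambda>x. V t x \<bullet> V t x) + J t R (\<lambda>x. Nt V t x \<bullet> Nt V t x)"
      by (subst J_add, (intro t0 continuous_intros c)+) (simp add: J_cmult)
    have "J t R ?M \<le> (1 + B3) * B1 + B2"
      unfolding JM by (intro add_mono mult_left_mono B1 B2 t R) (use B30 in simp)
    moreover have "J t R ?L \<le> J t R ?M"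
      by (rule J_mono[OF t0 R]) (use pt in \<open>auto intro!: continuous_intros c simp: abs_le_iff\<close>)
    moreover have "J t R (\<lambda>x. (-1) * ?L x) \<le> J t R ?M"
      by (rule J_mono[OF t0 R]) (use pt in \<open>auto intro!: continuous_intros c simp: abs_le_iff\<close>)
    then have "- J t R ?L \<le> J t R ?M" by (simp only: J_cmult)
    ultimately have "\<bar>J t R ?L\<bar> \<le> (1 + B3) * B1 + B2" by linarith
    moreover have "((\<lambda>t. Y R t) has_real_derivative J t R ?L) (at t within {0..})"
      unfolding Y_def by (rule J_normal_deriv[OF smooth_t normal_V t0])
    ultimately show ?thesis by blast
  qed
  moreover have "(1 + B3) * B1 + B2 \<ge> 0" using B1 B2 B30 by simp
  ultimately show ?thesis by blast
qed

text \<open>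
  The energy converges, so the dissipation over a short interval at a late time is small; \<open>small_of_integral_small\<close> applies.
\<close>

theorem velocity_tends_to_zero:
  assumes "\<delta> > 0" shows "\<exists>t0\<ge>1. \<forall>t\<ge>t0. \<forall>R>0. J t R (\<lambda>x. V t x \<bullet> V t x) \<le> \<delta>"
proof -
  obtain C where C: "C \<ge> 0" "\<And>t R. t \<ge> 1 \<Longrightarrow> R > 0 \<Longrightarrow> \<exists>d. ((\<lambda>t. Y R t) has_real_derivative d) (at t within {0..}) \<and> \<bar>d\<bar> \<le> C"
    using Y_deriv_bound by blast
  \<comment> \<open>Chosen so that \<open>small_of_integral_small\<close> returns exactly \<open>\<delta>\<close>.\<close>
  define \<epsilon> where "\<epsilon> = (\<delta> / (1 + C))\<^sup>2"
  have \<epsilon>: "\<epsilon> > 0" "(1 + C) * sqrt \<epsilon> = \<delta>" using assms C by (auto simp: \<epsilon>_def)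
  define L where "L = (INF t\<in>{1..}. E_lim t)"
  have bd: "bdd_below (E_lim ` {1..})" by (intro bdd_belowI2[of _ 0] E_lim_nonneg) auto
  have "\<exists>t0\<in>{1..}. E_lim t0 < L + \<epsilon>"
    using cINF_less_iff[of "{1..}" E_lim "L + \<epsilon>"] bd \<epsilon>(1) by (simp add: L_def)
  then obtain t0 where t0: "t0 \<ge> 1" "E_lim t0 < L + \<epsilon>" by auto
  have "J t R (\<lambda>x. V t x \<bullet> V t x) \<le> \<delta>" if t: "t \<ge> t0" and R: "R > 0" for t R
  proof -
    have "\<forall>s. \<exists>d. t \<le> s \<longrightarrow> ((\<lambda>t. Y R t) has_real_derivative d) (at s within {0..}) \<and> \<bar>d\<bar> \<le> C"
    proof
      fix s show "\<exists>d. t \<le> s \<longrightarrow> ((\<lambda>t. Y R t) has_real_derivative d) (at s within {0..}) \<and> \<bar>d\<bar> \<le> C"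
      proof (cases "t \<le> s")
        case True
        then have "s \<ge> 1" using t t0 by simp
        then show ?thesis using C(2) R by blast
      qed auto
    qed
    then obtain d where d: "\<And>s. t \<le> s \<Longrightarrow> ((\<lambda>t. Y R t) has_real_derivative d s) (at s within {0..})" "\<And>s. t \<le> s \<Longrightarrow> \<bar>d s\<bar> \<le> C"
      by metis
    have tt: "0 \<le> t" "t \<le> t + sqrt \<epsilon>" "t + sqrt \<epsilon> \<in> {1..}"
    proof -
      have "sqrt \<epsilon> > 0" using \<epsilon>(1) by simp
      then show "0 \<le> t" "t \<le> t + sqrt \<epsilon>" "t + sqrt \<epsilon> \<in> {1..}" using t t0(1) unfolding atLeast_iff by linarith+
    qed
    have "E_lim (t + sqrt \<epsilon>) + integral {t..t + sqrt \<epsilon>} (\<lambda>t. Y R t) \<le> E_lim t"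
      unfolding Y_def by (rule energy_dissipation[OF tt(1,2) R])
    moreover have "L \<le> E_lim (t + sqrt \<epsilon>)" unfolding L_def by (rule cINF_lower[OF bd tt(3)])
    moreover have "E_lim t \<le> E_lim t0" by (rule E_lim_antimono) (use t t0 in auto)
    ultimately have I: "integral {t..t + sqrt \<epsilon>} (\<lambda>t. Y R t) \<le> \<epsilon>" using t0 by linarith
    have "Y R t \<le> (1 + C) * sqrt \<epsilon>"
      by (rule small_of_integral_small[where y = "Y R" and y' = d, OF C(1) \<epsilon>(1) tt(1) d(1) d(2) I])
    then show ?thesis using \<epsilon>(2) by (simp add: Y_def)
  qed
  then show ?thesis using t0 by blast
qed


text \<open>
  The flow equation is a conservation law, \<open>V = - \<partial>\<^sub>sW\<close>; on a stationary curve \<open>W\<close> is the constant Noether current of translations,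
  normalized to vanish at infinity. It is \<open>\<partial>\<^sub>s\<kappa> + 3/2 \<bar>\<kappa>\<bar>\<^sup>2 T - (T - e)\<close>, written with \<open>\<nabla>\<^sub>s\<kappa>\<close>.
\<close>

definition W :: "real \<Rightarrow> real \<Rightarrow> 'a" where
  "W t x = (N 1 t x - Te t x) + (1/2 * (K t x \<bullet> K t x)) *\<^sub>R T t x"

lemma bsmooth_W: "bsmooth W"
  unfolding W_def[abs_def] by (intro bs_intros bsmooth_Te)

lemma D_Te: "t \<ge> 0 \<Longrightarrow> D Te t x = K t x"
  unfolding Te_def[abs_def] by (subst D_diff) (auto simp: K_eq intro: bs_intros)

lemma D_K: assumes t: "t \<ge> 0" shows "D K t x = N 1 t x - (K t x \<bullet> K t x) *\<^sub>R T t x"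
  using D_normal(2)[OF bsmooth_K normal_K t, of x] by (simp add: N_Suc N_0)

lemma D_W: assumes t: "t \<ge> 0" shows "D W t x = - V t x"
proof -
  have "D (\<lambda>t x. 1/2 * (K t x \<bullet> K t x)) t x = 1/2 * D (\<lambda>t x. K t x \<bullet> K t x) t x"
    using D_cscale[OF bsmooth_inner[OF bsmooth_K bsmooth_K] t, of "1/2" x] by simp
  also have "\<dots> = N 1 t x \<bullet> K t x"
    by (simp add: D_inner_normal bsmooth_K normal_K t N_Suc N_0 inner_commute)
  finally have 1: "D (\<lambda>t x. 1/2 * (K t x \<bullet> K t x)) t x = N 1 t x \<bullet> K t x" .
  have "D W t x = D (\<lambda>t x. N 1 t x - Te t x) t x + D (\<lambda>t x. (1/2 * (K t x \<bullet> K t x)) *\<^sub>R T t x) t x"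
    unfolding W_def[abs_def] by (rule D_add) (intro bs_intros bsmooth_Te t)+
  also have "D (\<lambda>t x. N 1 t x - Te t x) t x = D (N 1) t x - K t x"
    by (subst D_diff) (auto simp: D_Te t intro: bs_intros bsmooth_Te)
  also have "D (\<lambda>t x. (1/2 * (K t x \<bullet> K t x)) *\<^sub>R T t x) t x = (1/2 * (K t x \<bullet> K t x)) *\<^sub>R K t x + (N 1 t x \<bullet> K t x) *\<^sub>R T t x"
    using D_scaleR[OF _ bsmooth_T t, of "\<lambda>t x. 1/2 * (K t x \<bullet> K t x)" x, OF bsmooth_mult[OF bsmooth_const bsmooth_inner[OF bsmooth_K bsmooth_K]]]
    unfolding 1 K_eq[symmetric] .
  also have "D (N 1) t x = N 2 t x - (N 1 t x \<bullet> K t x) *\<^sub>R T t x"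
    using D_normal(2)[OF bsmooth_N normal_N t, of 1 x] by (simp add: N_Suc numeral_2_eq_2)
  finally show ?thesis by (simp add: V_eq[OF t] N_0)
qed

lemma J_Te_le: assumes "t \<ge> 0" "R > 0" shows "J t R (\<lambda>x. Te t x \<bullet> Te t x) \<le> 2 * E0"
  using Te_le_E[OF assms] E_le_E_lim[OF assms] E_lim_le_E0[OF assms(1)] by linarith

lemma W_J: "\<exists>B\<ge>0. \<forall>t\<ge>1. \<forall>R>0. J t R (\<lambda>x. W t x \<bullet> W t x) \<le> B"
proof -
  obtain B1 where B1: "\<And>t R. t \<ge> 1 \<Longrightarrow> R > 0 \<Longrightarrow> J t R (\<lambda>x. N 1 t x \<bullet> N 1 t x) \<le> B1" using curvature_dominated_J[OF curvature_dominated_N bsmooth_N] by blast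
  obtain B2 where B2: "B2 \<ge> 0" "\<And>t x. t \<ge> 1 \<Longrightarrow> norm (N 0 t x) \<le> B2" using N_uniform_bound by blast
  let ?B = "3 * B1 + 3 * (2 * E0) + 3 * B2\<^sup>2 * (2 * E0)"
  have "J t R (\<lambda>x. W t x \<bullet> W t x) \<le> ?B" if t: "t \<ge> 1" and R: "R > 0" for t R
  proof -
    have t0: "t \<ge> 0" using t by simp
    let ?M = "\<lambda>x. (3 * (N 1 t x \<bullet> N 1 t x) + 3 * (Te t x \<bullet> Te t x)) + 3 * B2\<^sup>2 * (N 0 t x \<bullet> N 0 t x)"
    have "J t R (\<lambda>x. W t x \<bullet> W t x) \<le> J t R ?M"
    proof (rule J_mono[OF t0 R])
      fix x
      define a b c where "a = norm (N 1 t x)" and "b = norm (Te t x)" and "c = norm (N 0 t x)"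
      have "norm (W t x) \<le> (a + b) + 1/2 * c\<^sup>2"
      proof -
        have "norm (W t x) \<le> norm (N 1 t x - Te t x) + norm ((1/2 * (K t x \<bullet> K t x)) *\<^sub>R T t x)"
          unfolding W_def by (rule norm_triangle_ineq)
        also have "norm (N 1 t x - Te t x) \<le> a + b" unfolding a_def b_def by (rule norm_triangle_ineq4)
        also have "norm ((1/2 * (K t x \<bullet> K t x)) *\<^sub>R T t x) = 1/2 * c\<^sup>2"
          by (simp add: c_def N_0 dot_square_norm norm_T[OF t0])
        finally show ?thesis by simp
      qed
      also have "1/2 * c\<^sup>2 \<le> B2 * c"
      proof -
        have "c * c \<le> B2 * c" using B2(2)[OF t, of x] by (intro mult_right_mono) (auto simp: c_def)
        moreover have "0 \<le> B2 * c" using B2 by (simp add: c_def)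
        ultimately show ?thesis by (simp add: power2_eq_square)
      qed
      finally have "norm (W t x) \<le> a + b + B2 * c" by simp
      then have "(norm (W t x))\<^sup>2 \<le> (a + b + B2 * c)\<^sup>2" by (intro power_mono) auto
      also have "\<dots> \<le> 3 * a\<^sup>2 + 3 * b\<^sup>2 + 3 * (B2 * c)\<^sup>2"
        using sum_squares_bound[of a b] sum_squares_bound[of a "B2 * c"] sum_squares_bound[of b "B2 * c"]
        by (simp add: power2_eq_square algebra_simps)
      finally show "W t x \<bullet> W t x \<le> ?M x" by (simp add: dot_square_norm a_def b_def c_def power_mult_distrib)
    qed (intro continuous_intros bsmooth_cont_x bsmooth_W bsmooth_Te bsmooth_N t0)+
    also have "\<dots> = (3 * J t R (\<lambda>x. N 1 t x \<bullet> N 1 t x) + 3 * J t R (\<lambda>x. Te t x \<bullet> Te t x)) + 3 * B2\<^sup>2 * F 0 R t"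
      by (subst J_add, (intro t0 continuous_intros bsmooth_cont_x bsmooth_Te bsmooth_N)+)+ (simp add: J_cmult F_def)
    also have "\<dots> \<le> ?B"
      by (intro add_mono mult_left_mono B1 J_Te_le F0_bound t t0 R) auto
    finally show ?thesis .
  qed
  then show ?thesis by (intro exI[of _ "max 0 ?B"]) (auto simp: le_max_iff_disj)
qed

text \<open>
  Half the total variation of \<open>\<bar>W\<bar>\<^sup>2\<close> is at most the product of the \<open>L\<^sup>2\<close> norms of \<open>W\<close>, which is bounded, and of \<open>V\<close>.
\<close>

theorem W_tends_to_zero:
  assumes "\<epsilon> > 0" shows "\<exists>t0\<ge>1. \<forall>t\<ge>t0. \<forall>x. norm (W t x) \<le> \<epsilon>"
proof -
  obtain B where B: "B \<ge> 0" "\<And>t R. t \<ge> 1 \<Longrightarrow> R > 0 \<Longrightarrow> J t R (\<lambda>x. W t x \<bullet> W t x) \<le> B" using W_J by blast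
  \<comment> \<open>Fourth power, since \<open>\<bar>W\<bar>\<^sup>2\<close> is bounded by the square root of \<open>B \<delta>\<close>.\<close>
  define \<delta> where "\<delta> = \<epsilon> ^ 4 / (B + 1)"
  have \<delta>: "\<delta> > 0" "(B + 1) * \<delta> = \<epsilon> ^ 4" using assms B by (auto simp: \<delta>_def)
  obtain t0 where t0: "t0 \<ge> 1" "\<And>t R. t \<ge> t0 \<Longrightarrow> R > 0 \<Longrightarrow> J t R (\<lambda>x. V t x \<bullet> V t x) \<le> \<delta>"
    using velocity_tends_to_zero[OF \<delta>(1)] by blast
  have "norm (W t x) \<le> \<epsilon>" if t: "t \<ge> t0" for t x
  proof -
    have t1: "t \<ge> 1" and tp: "t \<ge> 0" using t t0 by auto
    have c: "continuous_on UNIV (V t)" "continuous_on UNIV (W t)" by (intro bsmooth_cont_x bs_intros bsmooth_W tp)+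
    have "2 * (W t x \<bullet> W t x) \<le> 2 * (sqrt B * sqrt \<delta>)"
    proof (rule pointwise_le_integral[where h = "\<lambda>t x. W t x \<bullet> W t x" and t = t
        and g = "\<lambda>x. W t x \<bullet> W t x" and k = "\<lambda>x. 2 * (norm (W t x) * norm (V t x))" and B = B])
      show "bsmooth (\<lambda>t x. W t x \<bullet> W t x)" by (intro bs_intros bsmooth_W)
      show "\<bar>D (\<lambda>t x. W t x \<bullet> W t x) t x\<bar> \<le> 2 * (norm (W t x) * norm (V t x))" for x
        unfolding D_inner[OF bsmooth_W bsmooth_W tp] D_W[OF tp]
        using Cauchy_Schwarz_ineq2[of "W t x" "V t x"] by (simp add: inner_commute)
      show "J t R (\<lambda>x. W t x \<bullet> W t x) \<le> B" if "R > 0" for R by (rule B(2)[OF t1 that])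
      show "J t R (\<lambda>x. 2 * (norm (W t x) * norm (V t x))) \<le> 2 * (sqrt B * sqrt \<delta>)" if R: "R > 0" for R
      proof -
        have "J t R (\<lambda>x. norm (W t x) * norm (V t x)) \<le> sqrt (J t R (\<lambda>x. (norm (W t x))\<^sup>2)) * sqrt (J t R (\<lambda>x. (norm (V t x))\<^sup>2))"
          by (rule order_trans[OF abs_ge_self J_cauchy_schwarz[OF tp R continuous_on_norm[OF c(2)] continuous_on_norm[OF c(1)]]])
        also have "\<dots> \<le> sqrt B * sqrt \<delta>"
        proof (intro mult_mono real_sqrt_le_mono real_sqrt_ge_zero B)
          show "J t R (\<lambda>x. (norm (W t x))\<^sup>2) \<le> B" using B(2)[OF t1 R] by (simp add: dot_square_norm)
          show "J t R (\<lambda>x. (norm (V t x))\<^sup>2) \<le> \<delta>" using t0(2)[OF t R] by (simp add: dot_square_norm)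
          show "0 \<le> J t R (\<lambda>x. (norm (V t x))\<^sup>2)" by (intro J_nonneg tp R continuous_intros c) simp
        qed
        finally show ?thesis unfolding J_cmult by simp
      qed
    qed (use tp c in \<open>auto intro!: continuous_intros\<close>)
    then have "(norm (W t x))\<^sup>2 \<le> sqrt (B * \<delta>)" by (simp add: dot_square_norm real_sqrt_mult)
    also have "\<dots> \<le> sqrt (\<epsilon> ^ 4)" unfolding \<delta>(2)[symmetric] using \<delta>(1) by (intro real_sqrt_le_mono mult_right_mono) auto
    also have "\<dots> = \<epsilon>\<^sup>2"
    proof -
      have "\<epsilon> ^ 4 = (\<epsilon>\<^sup>2)\<^sup>2" by (simp add: power_mult[symmetric])
      then show ?thesis by (simp only: real_sqrt_abs abs_power2)
    qed
    finally show ?thesis by (rule power2_le_imp_le) (use assms in simp)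
  qed
  then show ?thesis using t0 by blast
qed

end

section \<open>Decay of the tangent angle\<close>

text \<open>
  Over a step \<open>h\<close> the increment of \<open>g\<close>, of size at most \<open>2\<epsilon>\<close>, differs from \<open>h g' s\<close> by a term of order \<open>B h\<^sup>2\<close>.
\<close>

lemma landau_pointwise:
  fixes g g' g'' :: "real \<Rightarrow> 'b::real_normed_vector"
  assumes d1: "\<And>s. (g has_vector_derivative g' s) (at s)" and d2: "\<And>s. (g' has_vector_derivative g'' s) (at s)"
    and g: "\<And>s. norm (g s) \<le> \<epsilon>" and g2: "\<And>s. norm (g'' s) \<le> B" and h: "h > 0"
  shows "norm (g' s) \<le> 2 * \<epsilon> / h + 3 * B * h"
proof -
  let ?S = "{s..s+h}"
  have seg: "closed_segment s x \<subseteq> ?S" if "x \<in> ?S" for x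
    using that by (auto simp: closed_segment_eq_real_ivl)
  have B0: "B \<ge> 0" using g2[of 0] norm_ge_zero order_trans by blast
  have dg: "norm (g' x - g' s) \<le> 3 * B * h" if x: "x \<in> ?S" for x
  proof -
    have "norm (g' x - g' s - (x - s) *\<^sub>R g'' s) \<le> norm (x - s) * (2 * B)"
    proof (rule vector_differentiable_bound_linearization[OF _ seg[OF x]])
      show "(g' has_vector_derivative g'' y) (at y within ?S)" for y by (rule has_vector_derivative_at_within[OF d2])
      show "norm (g'' y - g'' s) \<le> 2 * B" for y
        using norm_triangle_ineq4[of "g'' y" "g'' s"] g2[of y] g2[of s] by linarith
    qed (use h in simp)
    moreover have "norm ((x - s) *\<^sub>R g'' s) \<le> norm (x - s) * B"
      unfolding norm_scaleR using mult_left_mono[OF g2[of s], of "\<bar>x - s\<bar>"] by simp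
    moreover have "norm (g' x - g' s) \<le> norm (g' x - g' s - (x - s) *\<^sub>R g'' s) + norm ((x - s) *\<^sub>R g'' s)"
      using norm_triangle_ineq[of "g' x - g' s - (x - s) *\<^sub>R g'' s" "(x - s) *\<^sub>R g'' s"] by simp
    ultimately have "norm (g' x - g' s) \<le> norm (x - s) * (3 * B)" by (simp add: algebra_simps)
    also have "\<dots> \<le> h * (3 * B)" using x B0 by (intro mult_right_mono) auto
    finally show ?thesis by (simp add: mult_ac)
  qed
  have e: "s + h \<in> ?S" using h by simp
  have "norm (g (s+h) - g s - (s + h - s) *\<^sub>R g' s) \<le> norm (s + h - s) * (3 * B * h)"
    by (rule vector_differentiable_bound_linearization[OF has_vector_derivative_at_within[OF d1] seg[OF e] dg]) (use h in auto)
  then have 1: "norm (g (s+h) - g s - h *\<^sub>R g' s) \<le> h * (3 * B * h)" using h by simp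
  have "h *\<^sub>R g' s = (g (s+h) - g s) - (g (s+h) - g s - h *\<^sub>R g' s)" by simp
  then have "norm (h *\<^sub>R g' s) \<le> norm (g (s+h) - g s) + norm (g (s+h) - g s - h *\<^sub>R g' s)"
    by (metis norm_triangle_ineq4)
  also have "\<dots> \<le> 2 * \<epsilon> + h * (3 * B * h)"
    using 1 norm_triangle_ineq4[of "g (s+h)" "g s"] g[of s] g[of "s+h"] by linarith
  finally have "h * norm (g' s) \<le> 2 * \<epsilon> + h * (3 * B * h)" using h by simp
  then show ?thesis using h by (simp add: field_simps)
qed

context bounded_flow
begin

definition arcparam :: "real \<Rightarrow> real \<Rightarrow> real" where "arcparam t = inv (arclength (\<gamma> t))"

lemma arclength_deriv:
  assumes t: "t \<ge> 0" shows "(arclength (\<gamma> t) has_real_derivative speed t x) (at x)"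
proof -
  let ?a = "min 0 x - 1" and ?b = "max 0 x + 1"
  have "((\<lambda>u. LBINT y=ereal 0..ereal u. speed t y) has_vector_derivative speed t x) (at x within {?a..?b})"
    by (rule interval_integral_FTC2) (auto intro: cont_speed t)
  moreover have "at x within {?a..?b} = at x" by (rule at_within_interior) auto
  moreover have "arclength (\<gamma> t) = (\<lambda>u. LBINT y=ereal 0..ereal u. speed t y)"
    by (simp add: arclength_def speed_def partial_x_def fun_eq_iff)
  ultimately show ?thesis by (simp add: has_real_derivative_iff_has_vector_derivative)
qed

lemma arclength_bij: assumes t: "t \<ge> 0" shows "bij (arclength (\<gamma> t))"
proof -
  let ?L = "arclength (\<gamma> t)"
  obtain c where c: "c > 0" "\<And>s x. 0 \<le> s \<Longrightarrow> s \<le> t \<Longrightarrow> c \<le> speed s x" using speed_bound_below[of t] by blast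
  have inc: "c * (b - a) \<le> ?L b - ?L a" if "a \<le> b" for a b
  proof -
    have "(\<lambda>x. ?L x - c * x) a \<le> (\<lambda>x. ?L x - c * x) b"
    proof (rule DERIV_nonneg_imp_nondecreasing[OF that])
      fix x
      have "((\<lambda>x. ?L x - c * x) has_real_derivative speed t x - c * 1) (at x)"
        by (intro DERIV_diff arclength_deriv t DERIV_cmult DERIV_ident)
      then show "\<exists>y. ((\<lambda>x. ?L x - c * x) has_real_derivative y) (at x) \<and> 0 \<le> y" using c(2)[OF t order_refl, of x] by force
    qed
    then show ?thesis by (simp add: algebra_simps)
  qed
  have "inj ?L"
  proof (rule injI)
    fix x y assume e: "?L x = ?L y"
    have "c * (max x y - min x y) \<le> ?L (max x y) - ?L (min x y)" by (rule inc) simp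
    also have "\<dots> = 0" using e by (simp add: max_def min_def)
    finally have "max x y - min x y \<le> 0" using c by (simp add: mult_le_0_iff)
    then show "x = y" by (simp add: max_def min_def split: if_splits)
  qed
  moreover have "surj ?L"
    unfolding surj_def
  proof (rule allI)
    fix z
    define M where "M = (\<bar>z\<bar> + \<bar>?L 0\<bar>) / c"
    have M: "M \<ge> 0" "c * M = \<bar>z\<bar> + \<bar>?L 0\<bar>" using c by (auto simp: M_def)
    have "c * (M - 0) \<le> ?L M - ?L 0" "c * (0 - (-M)) \<le> ?L 0 - ?L (-M)" using inc[of 0 M] inc[of "-M" 0] M(1) by simp_all
    then have "?L (-M) \<le> z" "z \<le> ?L M" using M by auto
    moreover have "continuous_on {-M..M} ?L"
      by (rule DERIV_continuous_on[of _ _ "speed t"]) (auto intro: has_field_derivative_at_within arclength_deriv t)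
    ultimately show "\<exists>x. z = ?L x" using IVT'[of ?L "-M" z M] M by auto
  qed
  ultimately show ?thesis by (simp add: bij_def)
qed

lemma arcparam_inverse: assumes "t \<ge> 0" shows "arclength (\<gamma> t) (arcparam t s) = s" "arcparam t (arclength (\<gamma> t) x) = x"
  using arclength_bij[OF assms] by (auto simp: arcparam_def bij_def surj_f_inv_f)

lemma arcparam_deriv:
  assumes t: "t \<ge> 0" shows "(arcparam t has_real_derivative 1 / speed t (arcparam t s)) (at s)"
proof -
  have cont: "isCont (arcparam t) s"
    using isCont_inverse_function[of 1 "arcparam t s" "arcparam t" "arclength (\<gamma> t)"] arcparam_inverse[OF t]
      DERIV_isCont[OF arclength_deriv[OF t]] by simp
  have "DERIV (arcparam t) s :> inverse (speed t (arcparam t s))"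
    by (rule DERIV_inverse_function[OF arclength_deriv[OF t] _ _ _ _ cont, of "s - 1" "s + 1"])
      (use speed_pos[OF t] arcparam_inverse[OF t] in \<open>auto simp: less_imp_neq[symmetric]\<close>)
  then show ?thesis by (simp add: inverse_eq_divide)
qed

lemma reparam_chain:
  assumes t: "t \<ge> 0" and f: "(f has_vector_derivative f') (at (arcparam t s))"
  shows "((\<lambda>s. f (arcparam t s)) has_vector_derivative (1 / speed t (arcparam t s)) *\<^sub>R f') (at s)"
  using vector_diff_chain_at[OF arcparam_deriv[OF t, unfolded has_real_derivative_iff_has_vector_derivative] f]
  by (simp add: o_def)

lemma reparam_deriv:
  assumes "bsmooth f" "t \<ge> 0"
  shows "((\<lambda>s. f t (arcparam t s)) has_vector_derivative D f t (arcparam t s)) (at s)"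
  using reparam_chain[OF assms(2) bsmooth_deriv(2)[OF assms]] by (simp add: D_eq)

lemma reparam_\<gamma>_deriv:
  assumes "t \<ge> 0"
  shows "((\<lambda>s. \<gamma> t (arcparam t s)) has_vector_derivative T t (arcparam t s)) (at s)"
  using reparam_chain[OF assms deriv_x[OF assms]] by (simp add: T_eq)

lemma bsmooth_Dn: "bsmooth f \<Longrightarrow> bsmooth ((D ^^ m) f)"
  by (induction m) (auto intro: bsmooth_D)

definition unif_zero :: "(real \<Rightarrow> real \<Rightarrow> 'b::real_normed_vector) \<Rightarrow> bool" where
  "unif_zero f \<longleftrightarrow> (\<forall>\<eta>>0. \<exists>t0\<ge>1. \<forall>t\<ge>t0. \<forall>x. norm (f t x) \<le> \<eta>)"

text \<open>
  Interpolation: in the arclength parameter \<open>f1\<close> is the derivative of \<open>f\<close>, and its own derivative is bounded.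
\<close>

lemma unif_zero_D:
  assumes f: "bsmooth f" and f1: "bsmooth f1" and D: "\<And>t x. t \<ge> 0 \<Longrightarrow> D f t x = f1 t x"
    and z: "unif_zero f" and B: "\<exists>B. \<forall>t\<ge>1. \<forall>x. norm (D f1 t x) \<le> B"
  shows "unif_zero f1"
  unfolding unif_zero_def
proof (intro allI impI)
  fix \<eta> :: real assume \<eta>: "\<eta> > 0"
  obtain B0 where B0: "\<And>t x. t \<ge> 1 \<Longrightarrow> norm (D f1 t x) \<le> B0" using B by blast
  define B1 where "B1 = \<bar>B0\<bar> + 1"
  have "norm (D f1 t x) \<le> B1" if "t \<ge> 1" for t x using B0[OF that, of x] unfolding B1_def by linarith
  then have B1: "B1 > 0" "\<And>t x. t \<ge> 1 \<Longrightarrow> norm (D f1 t x) \<le> B1" by (auto simp: B1_def)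
  \<comment> \<open>The step balances the two terms of \<open>landau_pointwise\<close>: each is at most \<open>\<eta>/2\<close>.\<close>
  define h where "h = \<eta> / (6 * B1)"
  have h: "h > 0" "3 * B1 * h = \<eta> / 2" using \<eta> B1 by (auto simp: h_def)
  have "\<eta> * h / 4 > 0" using \<eta> h by simp
  then obtain t0 where t0: "t0 \<ge> 1" "\<And>t x. t \<ge> t0 \<Longrightarrow> norm (f t x) \<le> \<eta> * h / 4" using z unfolding unif_zero_def by blast
  have "norm (f1 t x) \<le> \<eta>" if t: "t \<ge> t0" for t x
  proof -
    have t1: "t \<ge> 1" "t \<ge> 0" using t t0 by auto
    let ?s = "arclength (\<gamma> t) x"
    have d1: "((\<lambda>s. f t (arcparam t s)) has_vector_derivative f1 t (arcparam t s)) (at s)" for s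
      using reparam_deriv[OF f t1(2), of s] by (simp add: D[OF t1(2)])
    have "norm (f1 t (arcparam t ?s)) \<le> 2 * (\<eta> * h / 4) / h + 3 * B1 * h"
      by (rule landau_pointwise[OF d1 reparam_deriv[OF f1 t1(2)] t0(2)[OF t] B1(2)[OF t1(1)] h(1)])
    also have "\<dots> = \<eta>" using h by simp
    finally show ?thesis by (simp add: arcparam_inverse[OF t1(2)])
  qed
  then show "\<exists>t0\<ge>1. \<forall>t\<ge>t0. \<forall>x. norm (f1 t x) \<le> \<eta>" using t0 by blast
qed

text \<open>
  Differentiating along the curve in the ambient space creates tangential components. This class contains \<open>T\<close> as well,
  and it is closed under \<open>\<partial>\<^sub>s\<close>.
\<close>

inductive geometric :: "(real \<Rightarrow> real \<Rightarrow> 'a) \<Rightarrow> bool" where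
  geometric_T: "geometric T"
| geometric_N: "geometric (N i)"
| geometric_mult: "geometric f \<Longrightarrow> geometric g \<Longrightarrow> geometric h \<Longrightarrow> geometric (\<lambda>t x. (f t x \<bullet> g t x) *\<^sub>R h t x)"
| geometric_add: "geometric f \<Longrightarrow> geometric g \<Longrightarrow> geometric (\<lambda>t x. f t x + g t x)"
| geometric_scale: "geometric f \<Longrightarrow> geometric (\<lambda>t x. c *\<^sub>R f t x)"

lemma geometric_bsmooth: "geometric f \<Longrightarrow> bsmooth f"
  by (induction rule: geometric.induct) (intro bs_intros; assumption)+

lemma geometric_D: "geometric f \<Longrightarrow> \<exists>g. geometric g \<and> (\<forall>t\<ge>0. \<forall>x. D f t x = g t x)"
proof (induction rule: geometric.induct)
  case geometric_T
  then show ?case using geometric_N[of 0] by (intro exI[of _ "N 0"]) (simp add: N_0 K_eq)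
next
  case (geometric_N i)
  let ?g = "\<lambda>t x. N (Suc i) t x + (-1) *\<^sub>R ((N i t x \<bullet> N 0 t x) *\<^sub>R T t x)"
  have "geometric ?g" by (intro geometric.intros)
  moreover have "D (N i) t x = ?g t x" if "t \<ge> 0" for t x
    using D_normal(2)[OF bsmooth_N normal_N that, of i x] by (simp add: N_Suc N_0)
  ultimately show ?case by blast
next
  case (geometric_mult f g h)
  then obtain f' g' h' where d: "geometric f'" "\<forall>t\<ge>0. \<forall>x. D f t x = f' t x" "geometric g'" "\<forall>t\<ge>0. \<forall>x. D g t x = g' t x"
    "geometric h'" "\<forall>t\<ge>0. \<forall>x. D h t x = h' t x" by blast
  let ?g = "\<lambda>t x. (f t x \<bullet> g t x) *\<^sub>R h' t x + ((f t x \<bullet> g' t x) *\<^sub>R h t x + (f' t x \<bullet> g t x) *\<^sub>R h t x)"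
  have b: "bsmooth f" "bsmooth g" "bsmooth h" using geometric_mult.hyps geometric_bsmooth by auto
  have "geometric ?g"
    by (rule geometric.geometric_add[OF geometric.geometric_mult[OF geometric_mult.hyps(1,2) d(5)]
        geometric.geometric_add[OF geometric.geometric_mult[OF geometric_mult.hyps(1) d(3) geometric_mult.hyps(3)] geometric.geometric_mult[OF d(1) geometric_mult.hyps(2,3)]]])
  moreover have "D (\<lambda>t x. (f t x \<bullet> g t x) *\<^sub>R h t x) t x = ?g t x" if t: "t \<ge> 0" for t x
    unfolding D_scaleR[OF bsmooth_inner[OF b(1,2)] b(3) t] D_inner[OF b(1,2) t] using d t by (simp add: scaleR_add_left)
  ultimately show ?case by blast
next
  case (geometric_add f g)
  then obtain f' g' where d: "geometric f'" "\<forall>t\<ge>0. \<forall>x. D f t x = f' t x" "geometric g'" "\<forall>t\<ge>0. \<forall>x. D g t x = g' t x" by blast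
  have "D (\<lambda>t x. f t x + g t x) t x = f' t x + g' t x" if t: "t \<ge> 0" for t x
    using D_add[OF geometric_bsmooth[OF geometric_add.hyps(1)] geometric_bsmooth[OF geometric_add.hyps(2)] t] d t by simp
  then show ?case using geometric.geometric_add[OF d(1,3)] by blast
next
  case (geometric_scale f c)
  then obtain f' where d: "geometric f'" "\<forall>t\<ge>0. \<forall>x. D f t x = f' t x" by blast
  have "D (\<lambda>t x. c *\<^sub>R f t x) t x = c *\<^sub>R f' t x" if t: "t \<ge> 0" for t x
    using D_cscale[OF geometric_bsmooth[OF geometric_scale.hyps(1)] t] d t by simp
  then show ?case using geometric.geometric_scale[OF d(1)] by blast
qed

lemma geometric_Dn: "\<exists>g. geometric g \<and> (\<forall>t\<ge>0. \<forall>x. (D ^^ m) K t x = g t x)"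
proof (induction m)
  case 0 then show ?case using geometric_N[of 0] by (intro exI[of _ "N 0"]) (simp add: N_0)
next
  case (Suc m)
  then obtain g where g: "geometric g" "\<forall>t\<ge>0. \<forall>x. (D ^^ m) K t x = g t x" by blast
  obtain g' where g': "geometric g'" "\<forall>t\<ge>0. \<forall>x. D g t x = g' t x" using geometric_D[OF g(1)] by blast
  have "(D ^^ Suc m) K t x = g' t x" if t: "t \<ge> 0" for t x
  proof -
    have "(D ^^ Suc m) K t x = D g t x" using g(2) t by (auto intro!: D_cong)
    then show ?thesis using g' t by simp
  qed
  then show ?case using g' by blast
qed

end

context finite_energy_flow
begin

lemma geometric_bounded: "geometric f \<Longrightarrow> \<exists>B. \<forall>t\<ge>1. \<forall>x. norm (f t x) \<le> B"
proof (induction rule: geometric.induct)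
  case geometric_T
  then show ?case using norm_T by (intro exI[of _ 1]) auto
next
  case (geometric_N i) then show ?case using N_uniform_bound by blast
next
  case (geometric_mult f g h)
  then obtain A B C where b: "\<forall>t\<ge>1. \<forall>x. norm (f t x) \<le> A" "\<forall>t\<ge>1. \<forall>x. norm (g t x) \<le> B" "\<forall>t\<ge>1. \<forall>x. norm (h t x) \<le> C" by blast
  have "norm ((f t x \<bullet> g t x) *\<^sub>R h t x) \<le> (A * B) * C" if t: "t \<ge> 1" for t x
  proof -
    have n: "norm (f t x) \<le> A" "norm (g t x) \<le> B" "norm (h t x) \<le> C" using b t by auto
    then have nn: "0 \<le> A" "0 \<le> B" "0 \<le> C" using norm_ge_zero order_trans by blast+
    have "\<bar>f t x \<bullet> g t x\<bar> \<le> A * B" by (rule order_trans[OF Cauchy_Schwarz_ineq2]) (intro mult_mono n nn, simp)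
    then show ?thesis unfolding norm_scaleR by (intro mult_mono n) (use nn in auto)
  qed
  then show ?case by blast
next
  case (geometric_add f g)
  then obtain A B where b: "\<forall>t\<ge>1. \<forall>x. norm (f t x) \<le> A" "\<forall>t\<ge>1. \<forall>x. norm (g t x) \<le> B" by blast
  then have "norm (f t x + g t x) \<le> A + B" if t: "t \<ge> 1" for t x
    using t by (intro norm_triangle_le add_mono) auto
  then show ?case by blast
next
  case (geometric_scale f c)
  then obtain A where b: "\<forall>t\<ge>1. \<forall>x. norm (f t x) \<le> A" by blast
  then have "norm (c *\<^sub>R f t x) \<le> \<bar>c\<bar> * A" if t: "t \<ge> 1" for t x
    using t by (simp add: mult_left_mono)
  then show ?case by blast
qed

lemma Dn_K_bounded: "\<exists>B. \<forall>t\<ge>1. \<forall>x. norm ((D ^^ m) K t x) \<le> B"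
proof -
  obtain g where g: "geometric g" "\<forall>t\<ge>0. \<forall>x. (D ^^ m) K t x = g t x" using geometric_Dn by blast
  then show ?thesis using geometric_bounded[OF g(1)] by simp
qed


text \<open>
  As \<open>\<kappa>\<close> is normal, \<open>e\<close> may be replaced by its normal part, whose square is \<open>1 - \<langle>T, e\<rangle>\<^sup>2\<close>.
\<close>

lemma K_e_le:
  assumes t: "t \<ge> 0" shows "(K t x \<bullet> e)\<^sup>2 \<le> (K t x \<bullet> K t x) * (1 - (T t x \<bullet> e)\<^sup>2)"
proof -
  let ?u = "T t x \<bullet> e"
  let ?w = "e - ?u *\<^sub>R T t x"
  have "K t x \<bullet> e = K t x \<bullet> ?w" using normal_K t by (simp add: inner_diff_right normal_field_def)
  then have "(K t x \<bullet> e)\<^sup>2 \<le> (K t x \<bullet> K t x) * (?w \<bullet> ?w)" using Cauchy_Schwarz_ineq[of "K t x" ?w] by simp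
  also have "?w \<bullet> ?w = 1 - ?u\<^sup>2"
    using T_T[OF t, of x] e_e by (simp add: inner_diff_left inner_diff_right inner_commute power2_eq_square)
  finally show ?thesis .
qed

text \<open>
  With \<open>u = \<langle>T, e\<rangle>\<close>, the function \<open>\<psi> = \<surd>((1 + u)/2)\<close> has derivative at most \<open>\<bar>\<kappa>\<bar> \<bar>T - e\<bar> / 4\<close>, which is at most a quarter of the energy
  density. It equals \<open>1\<close> at both ends of the curve, so \<open>1 - \<psi>\<close> is at most half of a quarter of the energy.
\<close>

theorem angle_bound:
  assumes E8: "E0 < 8" and t: "t \<ge> 0"
  shows "(1 - E0 / 8)\<^sup>2 \<le> (1 + T t x \<bullet> e) / 2"
proof (rule field_le_epsilon)
  fix \<eta> :: real assume \<eta>: "\<eta> > 0"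
  \<comment> \<open>The shift by \<open>\<eta>\<close> makes the square root smooth where \<open>T = - e\<close>.\<close>
  define q where "q = (\<lambda>t x. 1/2 * (T t x \<bullet> e) + (1/2 + \<eta>))"
  define \<psi> where "\<psi> = (\<lambda>t x. q t x * (1 / sqrt (q t x)))"
  have bq: "bsmooth q" unfolding q_def by (intro bs_intros)
  have q\<eta>: "\<eta> \<le> q t x" if "t \<ge> 0" for t x using T_e_le(2)[OF that, of x] by (simp add: q_def)
  have "\<exists>c>0. \<forall>t\<in>{0..U}. \<forall>x. c \<le> q t x" for U by (rule exI[of _ \<eta>]) (use \<eta> q\<eta> in auto)
  then have "bsmooth (\<lambda>t x. 1 / sqrt (q t x))" unfolding bsmooth_def using Ck_bounded_inverse_sqrt[OF bq] by blast
  then have b\<psi>: "bsmooth \<psi>" unfolding \<psi>_def by (intro bsmooth_mult bq)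
  have \<psi>: "\<psi> t x = sqrt (q t x)" "\<psi> t x > 0" "\<psi> t x * \<psi> t x = q t x" if "t \<ge> 0" for t x
    using q\<eta>[OF that, of x] \<eta> by (auto simp: \<psi>_def real_div_sqrt)
  have D\<psi>: "\<bar>D \<psi> t x\<bar> \<le> 1/4 * dens t x" for x
  proof -
    have "D (\<lambda>t x. \<psi> t x * \<psi> t x) t x = D q t x" by (rule D_cong) (rule \<psi>(3)[OF t])
    moreover have "D q t x = 1/2 * (K t x \<bullet> e)"
    proof -
      have "D q t x = D (\<lambda>t x. 1/2 * (T t x \<bullet> e)) t x + D (\<lambda>t x. 1/2 + \<eta>) t x"
        unfolding q_def by (rule D_add) (intro bs_intros t)+
      also have "D (\<lambda>t x. 1/2 * (T t x \<bullet> e)) t x = 1/2 * D (\<lambda>t x. T t x \<bullet> e) t x"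
        using D_cscale[OF bsmooth_inner[OF bsmooth_T bsmooth_const] t, of "1/2"] by simp
      also have "D (\<lambda>t x. T t x \<bullet> e) t x = K t x \<bullet> e"
        using D_inner[OF bsmooth_T bsmooth_const t] by (simp add: K_eq)
      finally show ?thesis by simp
    qed
    ultimately have 1: "\<psi> t x * D \<psi> t x = 1/4 * (K t x \<bullet> e)" using D_mult[OF b\<psi> b\<psi> t, of x] by simp
    let ?u = "T t x \<bullet> e"
    have "(K t x \<bullet> e)\<^sup>2 \<le> (K t x \<bullet> K t x) * ((1 - ?u) * (1 + ?u))"
      using K_e_le[OF t, of x] by (simp add: power2_eq_square algebra_simps)
    also have "(1 - ?u) * (1 + ?u) \<le> (1 - ?u) * (2 * (\<psi> t x * \<psi> t x))"
      using T_e_le(1)[OF t, of x] \<eta> by (intro mult_left_mono) (auto simp: \<psi>(3)[OF t] q_def)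
    also have "(1 - ?u) * (2 * (\<psi> t x * \<psi> t x)) = (Te t x \<bullet> Te t x) * (\<psi> t x)\<^sup>2"
      by (simp add: Te_Te[OF t] power2_eq_square)
    finally have "(K t x \<bullet> e)\<^sup>2 \<le> (norm (K t x) * norm (Te t x) * \<psi> t x)\<^sup>2"
      by (simp add: mult_left_mono power_mult_distrib dot_square_norm mult.assoc)
    then have "\<bar>K t x \<bullet> e\<bar> \<le> norm (K t x) * norm (Te t x) * \<psi> t x"
      by (rule abs_le_square_iff[THEN iffD2, THEN order_trans]) (use \<psi>(2)[OF t, of x] in simp)
    moreover have "2 * (norm (K t x) * norm (Te t x)) \<le> K t x \<bullet> K t x + Te t x \<bullet> Te t x"
      using sum_squares_bound[of "norm (K t x)" "norm (Te t x)"] by (simp add: dot_square_norm)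
    then have "norm (K t x) * norm (Te t x) \<le> dens t x" by (simp add: dens_def Te_Te[OF t])
    then have "norm (K t x) * norm (Te t x) * \<psi> t x \<le> dens t x * \<psi> t x" using \<psi>(2)[OF t, of x] by (intro mult_right_mono) auto
    ultimately have "\<bar>\<psi> t x * D \<psi> t x\<bar> \<le> (1/4 * dens t x) * \<psi> t x" unfolding 1 by (simp add: abs_mult)
    then have "\<bar>D \<psi> t x\<bar> * \<psi> t x \<le> (1/4 * dens t x) * \<psi> t x" using \<psi>(2)[OF t, of x] by (simp add: abs_mult mult.commute)
    then show ?thesis using \<psi>(2)[OF t, of x] by (rule mult_right_le_imp_le)
  qed
  let ?c = "sqrt (1 + \<eta>)"
  have c1: "?c \<ge> 1" using \<eta> by simp
  have "2 * (?c - \<psi> t x) \<le> 1/4 * E0"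
  proof (rule pointwise_le_integral[where h = "\<lambda>t x. ?c - \<psi> t x" and t = t and g = "dens t" and k = "\<lambda>x. 1/4 * dens t x" and B = E0])
    show "bsmooth (\<lambda>t x. ?c - \<psi> t x)" by (intro bs_intros b\<psi>)
    show "continuous_on UNIV (dens t)" by (rule bsmooth_cont_x[OF bsmooth_dens t])
    then show "continuous_on UNIV (\<lambda>x. 1/4 * dens t x)" by (intro continuous_intros)
    show "\<bar>?c - \<psi> t x\<bar> \<le> dens t x" for x
    proof -
      let ?u = "T t x \<bullet> e"
      have "q t x \<le> 1 + \<eta>" using T_e_le(1)[OF t, of x] by (simp add: q_def)
      then have p0: "0 \<le> ?c - \<psi> t x" unfolding \<psi>(1)[OF t] by simp
      have "1 \<le> ?c + \<psi> t x" using c1 \<psi>(2)[OF t, of x] by linarith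
      then have "(?c - \<psi> t x) * 1 \<le> (?c - \<psi> t x) * (?c + \<psi> t x)"
        using p0 by (intro mult_left_mono)
      also have "\<dots> = ?c * ?c - \<psi> t x * \<psi> t x" by (simp add: algebra_simps)
      also have "\<dots> = 1/2 * (1 - ?u)" unfolding \<psi>(3)[OF t] using \<eta> by (simp add: q_def)
      also have "\<dots> \<le> 1/2 * (K t x \<bullet> K t x) + (1 - ?u)"
      proof -
        have half: "1/2 * a \<le> 1/2 * b + a" if "0 \<le> a" "0 \<le> b" for a b :: real using that by simp
        have "0 \<le> 1 - ?u" using T_e_le(1)[OF t, of x] by simp
        then show ?thesis by (rule half[OF _ inner_ge_zero])
      qed
      finally show ?thesis using p0 by (simp add: dens_def)
    qed
    show "\<bar>D (\<lambda>t x. ?c - \<psi> t x) t x\<bar> \<le> 1/4 * dens t x" for x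
      using D\<psi>[of x] D_diff[OF bsmooth_const b\<psi> t, of ?c x] by simp
    have JE: "J t R (dens t) \<le> E0" if "R > 0" for R
      using E_le_E_lim[OF t that] E_lim_le_E0[OF t] by (simp add: E_def)
    then show "J t R (dens t) \<le> E0" if "R > 0" for R using that .
    show "J t R (\<lambda>x. 1/4 * dens t x) \<le> 1/4 * E0" if "R > 0" for R unfolding J_cmult using JE[OF that] by simp
  qed (rule t)
  moreover have "1 - b / 8 \<le> p" if "2 * (c - p) \<le> 1/4 * b" "1 \<le> c" for b c p :: real
    using that by (simp add: field_simps)
  ultimately have "1 - E0 / 8 \<le> \<psi> t x" using c1 by blast
  then have "(1 - E0 / 8)\<^sup>2 \<le> (\<psi> t x)\<^sup>2" using E8 by (intro power_mono) auto
  also have "\<dots> = q t x" by (simp add: power2_eq_square \<psi>(3)[OF t])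
  finally show "(1 - E0 / 8)\<^sup>2 \<le> (1 + T t x \<bullet> e) / 2 + \<eta>" by (simp add: q_def add_divide_distrib)
qed

text \<open>
  Instead of a maximum of \<open>v = 1 - \<langle>T, e\<rangle>\<close>, a maximum of \<open>v\<close> times the cut-off is used, which exists by compactness. There
  \<open>v' = - \<langle>\<kappa>, e\<rangle>\<close> is balanced by the slope of the cut-off and hence of order \<open>1/R\<close>.
\<close>

lemma approximate_critical_point:
  assumes t: "t \<ge> 0" and pos: "0 < 1 - T t x0 \<bullet> e" and \<epsilon>: "\<epsilon> > 0"
  shows "\<exists>x. (1 - T t x0 \<bullet> e) / 2 \<le> 1 - T t x \<bullet> e \<and> \<bar>K t x \<bullet> e\<bar> \<le> \<epsilon>"
proof -
  define v where "v = (\<lambda>x. 1 - T t x \<bullet> e)"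
  define m where "m = v x0"
  have m: "m > 0" using pos by (simp add: m_def v_def)
  have v: "0 \<le> v x" "v x \<le> 2" for x using T_e_le[OF t, of x] by (auto simp: v_def)
  obtain c where c: "c > 0" "\<And>s x. 0 \<le> s \<Longrightarrow> s \<le> t \<Longrightarrow> c \<le> speed s x" using speed_bound_below[of t] by blast
  \<comment> \<open>\<open>R \<ge> 2 \<bar>x0\<bar>\<close> keeps the cut-off at \<open>x0\<close> above \<open>1/2\<close>; the last summand makes its slope small enough.\<close>
  define R where "R = 2 * \<bar>x0\<bar> + 1 + 16 / (c * m * \<epsilon>)"
  have q: "16 / (c * m * \<epsilon>) > 0" using c m \<epsilon> by simp
  then have R: "R > 0" "R \<ge> 2 * \<bar>x0\<bar>" "R \<ge> 16 / (c * m * \<epsilon>)"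
    unfolding R_def using abs_ge_zero[of x0] by linarith+
  let ?cut = "\<lambda>x. 1 - (x / R)\<^sup>2"
  let ?\<phi> = "\<lambda>x. ?cut x * v x"
  have dv: "(v has_real_derivative - (K t x \<bullet> e) * speed t x) (at x)" for x
  proof -
    have "((\<lambda>x. 1 - T t x \<bullet> e) has_vector_derivative 0 - Dx T t x \<bullet> e) (at x)"
      by (intro has_vector_derivative_diff has_vector_derivative_const bounded_linear.has_vector_derivative[OF bounded_linear_inner_left]
          bsmooth_deriv(2) bsmooth_T t)
    moreover have "Dx T t x = speed t x *\<^sub>R K t x" using speed_pos[OF t, of x] by (simp add: K_eq D_eq)
    ultimately show ?thesis by (simp add: v_def has_real_derivative_iff_has_vector_derivative mult.commute)
  qed
  have d\<phi>: "(?\<phi> has_real_derivative (?cut x * (- (K t x \<bullet> e) * speed t x) + (- 2 * x / R\<^sup>2) * v x)) (at x)" for x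
  proof -
    from DERIV_mult[OF cut_has_real_derivative[OF R(1)] dv] show ?thesis by (simp add: algebra_simps)
  qed
  have "continuous_on {-R..R} ?\<phi>"
    by (rule DERIV_continuous_on) (rule has_field_derivative_at_within[OF d\<phi>])
  then obtain x where x: "x \<in> {-R..R}" "\<And>y. y \<in> {-R..R} \<Longrightarrow> ?\<phi> y \<le> ?\<phi> x"
    using continuous_attains_sup[of "{-R..R}" ?\<phi>] R by auto
  have "\<bar>x0 / R\<bar> \<le> 1/2" using R by (auto simp: abs_le_iff field_simps)
  then have "\<bar>x0 / R\<bar>\<^sup>2 \<le> (1/2)\<^sup>2" by (intro power_mono) auto
  then have "(x0 / R)\<^sup>2 \<le> (1/2)\<^sup>2" by (simp only: power2_abs)
  moreover have "(1/2 :: real)\<^sup>2 = 1/4" by (simp add: power2_eq_square)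
  ultimately have "1/2 \<le> ?cut x0" by linarith
  then have "1/2 * m \<le> ?cut x0 * m" using m by (intro mult_right_mono) auto
  also have "?cut x0 * m = ?\<phi> x0" by (simp add: m_def)
  also have "\<dots> \<le> ?\<phi> x" using R by (intro x(2)) (auto simp: abs_le_iff)
  finally have \<phi>m: "m / 2 \<le> ?\<phi> x" by simp
  have cut1: "0 \<le> ?cut x" "?cut x \<le> 1" using cut_nonneg[OF R(1) x(1)] by auto
  have "?\<phi> x \<le> 1 * v x" using cut1 v by (intro mult_right_mono) auto
  then have vx: "m / 2 \<le> v x" using \<phi>m by simp
  have "?\<phi> x \<le> ?cut x * 2" using cut1 v by (intro mult_left_mono) auto
  then have cutx: "m / 4 \<le> ?cut x" using \<phi>m by simp
  have "x \<noteq> R" "x \<noteq> - R" using cutx m R by auto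
  then have xi: "-R < x" "x < R" using x by auto
  have "?cut x * (- (K t x \<bullet> e) * speed t x) + (- 2 * x / R\<^sup>2) * v x = 0"
  proof (rule DERIV_local_max[OF d\<phi>])
    show "0 < min (R - x) (x + R)" using xi by simp
    show "\<forall>y. \<bar>x - y\<bar> < min (R - x) (x + R) \<longrightarrow> ?\<phi> y \<le> ?\<phi> x" using x(2) by (auto simp: abs_less_iff)
  qed
  then have e1: "?cut x * ((K t x \<bullet> e) * speed t x) = (- 2 * x / R\<^sup>2) * v x" by (simp add: algebra_simps)
  have "\<bar>(- 2 * x / R\<^sup>2) * v x\<bar> \<le> (2 / R) * 2"
    by (rule order_trans[OF cut_slope_mult_le[OF R(1) x(1)]]) (intro mult_left_mono, use v R in auto)
  then have up: "?cut x * (\<bar>K t x \<bullet> e\<bar> * speed t x) \<le> 4 / R"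
    unfolding e1[symmetric] using cut1 speed_pos[OF t, of x] by (simp add: abs_mult)
  have "(m / 4) * (\<bar>K t x \<bullet> e\<bar> * c) \<le> ?cut x * (\<bar>K t x \<bullet> e\<bar> * speed t x)"
    by (intro mult_mono cutx mult_left_mono c t) (use cut1 c in auto)
  then have "(m / 4) * (\<bar>K t x \<bullet> e\<bar> * c) \<le> 4 / R" using up by linarith
  also have "4 / R \<le> 4 / (16 / (c * m * \<epsilon>))" 
    by (rule divide_left_mono[OF R(3) _ mult_pos_pos[OF R(1) q]]) simp
  also have "\<dots> = (m / 4) * (\<epsilon> * c)" by simp
  finally have "\<bar>K t x \<bullet> e\<bar> \<le> \<epsilon>" using m c by simp
  then show ?thesis using vx by (auto simp: v_def m_def)
qed


text \<open>
  \<open>f\<close> is the squared volume of the parallelepiped spanned by \<open>\<kappa>\<close>, \<open>T\<close>, \<open>e\<close> at \<open>x1\<close>. Pairing \<open>\<kappa> \<and> T\<close> with the fixed bivector \<open>p \<and> q\<close>, the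
  values of \<open>\<kappa>\<close> and \<open>T\<close> at \<open>x1\<close> projected orthogonally to \<open>e\<close>, gives a function \<open>\<omega>\<close> with \<open>\<omega> x1 = f\<close> and derivative
  \<open>\<langle>W \<and> T, p \<and> q\<rangle>\<close>, of size \<open>\<epsilon>\<close>. As \<open>\<omega>\<close> is square integrable, \<open>\<omega>\<^sup>3\<close> has total variation of size \<open>\<epsilon>\<close>.
\<close>

lemma planarity_bound:
  assumes t: "t \<ge> 1" and B: "B \<ge> 1" "\<And>x. norm (K t x) \<le> B" and \<epsilon>: "\<epsilon> \<ge> 0" "\<And>x. norm (W t x) \<le> \<epsilon>"
    and f: "f = (K t x1 \<bullet> K t x1) * (1 - (T t x1 \<bullet> e)\<^sup>2) - (K t x1 \<bullet> e)\<^sup>2"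
  shows "2 * f ^ 3 \<le> 3 * (8 * B)\<^sup>2 * (8 * B * \<epsilon>) * (2 * E0)"
proof -
  have t0: "t \<ge> 0" using t by simp
  define p where "p = K t x1 - (K t x1 \<bullet> e) *\<^sub>R e"
  define q where "q = T t x1 - (T t x1 \<bullet> e) *\<^sub>R e"
  have pe: "p \<bullet> e = 0" "q \<bullet> e = 0" by (simp_all add: p_def q_def inner_diff_left e_e)
  have np: "norm p \<le> 2 * B"
  proof -
    have "norm p \<le> norm (K t x1) + \<bar>K t x1 \<bullet> e\<bar>" unfolding p_def using norm_triangle_ineq4[of "K t x1" "(K t x1 \<bullet> e) *\<^sub>R e"] norm_e by simp
    also have "\<bar>K t x1 \<bullet> e\<bar> \<le> norm (K t x1)" using Cauchy_Schwarz_ineq2[of "K t x1" e] norm_e by simp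
    finally show ?thesis using B(2)[of x1] by simp
  qed
  have nq: "norm q \<le> 2"
  proof -
    have "norm q \<le> norm (T t x1) + \<bar>T t x1 \<bullet> e\<bar>" unfolding q_def using norm_triangle_ineq4[of "T t x1" "(T t x1 \<bullet> e) *\<^sub>R e"] norm_e by simp
    then show ?thesis using T_e_le[OF t0, of x1] norm_T[OF t0, of x1] by simp
  qed
  define \<omega> where "\<omega> = (\<lambda>t x. (K t x \<bullet> p) * (T t x \<bullet> q) - (K t x \<bullet> q) * (T t x \<bullet> p))"
  have b\<omega>: "bsmooth \<omega>" unfolding \<omega>_def by (intro bs_intros)
  have wedge: "\<bar>(a \<bullet> p) * (b \<bullet> q) - (a \<bullet> q) * (b \<bullet> p)\<bar> \<le> 8 * B * (norm a * norm b)" for a b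
  proof -
    have pq: "norm p * norm q \<le> (2 * B) * 2" by (intro mult_mono np nq) (use B in auto)
    have "\<bar>(a \<bullet> p) * (b \<bullet> q)\<bar> \<le> (norm a * norm p) * (norm b * norm q)" "\<bar>(a \<bullet> q) * (b \<bullet> p)\<bar> \<le> (norm a * norm q) * (norm b * norm p)"
      unfolding abs_mult by (intro mult_mono Cauchy_Schwarz_ineq2; simp)+
    then have "\<bar>(a \<bullet> p) * (b \<bullet> q) - (a \<bullet> q) * (b \<bullet> p)\<bar> \<le> 2 * ((norm a * norm b) * (norm p * norm q))"
      by (simp add: algebra_simps)
    also have "\<dots> \<le> 2 * ((norm a * norm b) * ((2 * B) * 2))" by (intro mult_left_mono pq) auto
    finally show ?thesis by (simp add: algebra_simps)
  qed
  have \<omega>K: "\<bar>\<omega> t x\<bar> \<le> 8 * B * norm (K t x)" for x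
    using wedge[of "K t x" "T t x"] by (simp add: \<omega>_def norm_T[OF t0])
  have D\<omega>: "\<bar>D \<omega> t x\<bar> \<le> 8 * B * \<epsilon>" for x
  proof -
    have Dc: "D (\<lambda>t x. g t x \<bullet> r) t x = D g t x \<bullet> r" if "bsmooth g" for g :: "real \<Rightarrow> real \<Rightarrow> 'a" and r
      using D_inner[OF that bsmooth_const t0, of r x] by simp
    have "D \<omega> t x = D (\<lambda>t x. (K t x \<bullet> p) * (T t x \<bullet> q)) t x - D (\<lambda>t x. (K t x \<bullet> q) * (T t x \<bullet> p)) t x"
      unfolding \<omega>_def by (rule D_diff) (intro bs_intros t0)+
    also have "\<dots> = (D K t x \<bullet> p) * (T t x \<bullet> q) - (D K t x \<bullet> q) * (T t x \<bullet> p)"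
      by (subst D_mult D_mult, (intro bs_intros t0)+)+ (simp add: Dc bsmooth_K bsmooth_T K_eq[symmetric])
    finally have 1: "D \<omega> t x = (D K t x \<bullet> p) * (T t x \<bullet> q) - (D K t x \<bullet> q) * (T t x \<bullet> p)" .
    have 2: "D K t x \<bullet> r = W t x \<bullet> r + (1 - 3/2 * (K t x \<bullet> K t x)) * (T t x \<bullet> r)" if "r \<bullet> e = 0" for r
      using that by (simp add: D_K[OF t0] W_def Te_def inner_diff_left inner_add_left inner_commute[of e] algebra_simps)
    have "D \<omega> t x = (W t x \<bullet> p) * (T t x \<bullet> q) - (W t x \<bullet> q) * (T t x \<bullet> p)"
      unfolding 1 2[OF pe(1)] 2[OF pe(2)] by (simp add: algebra_simps)
    then have "\<bar>D \<omega> t x\<bar> \<le> 8 * B * (norm (W t x) * norm (T t x))" using wedge[of "W t x" "T t x"] by simp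
    also have "\<dots> \<le> 8 * B * (\<epsilon> * 1)" by (intro mult_left_mono mult_mono \<epsilon>) (use B norm_T[OF t0] \<epsilon> in auto)
    finally show ?thesis by simp
  qed
  let ?B = "8 * B"
  have \<omega>1: "\<omega> t x1 = f"
  proof -
    have 1: "K t x1 \<bullet> p = K t x1 \<bullet> K t x1 - (K t x1 \<bullet> e)\<^sup>2" by (simp add: p_def inner_diff_right power2_eq_square)
    have 2: "T t x1 \<bullet> q = 1 - (T t x1 \<bullet> e)\<^sup>2" by (simp add: q_def inner_diff_right power2_eq_square T_T[OF t0])
    have 3: "K t x1 \<bullet> q = - (T t x1 \<bullet> e) * (K t x1 \<bullet> e)" using normal_K t0 by (simp add: q_def inner_diff_right normal_field_def)
    have 4: "T t x1 \<bullet> p = - (K t x1 \<bullet> e) * (T t x1 \<bullet> e)" using normal_K t0 by (simp add: p_def inner_diff_right normal_field_def inner_commute[of "T t x1" "K t x1"])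
    show ?thesis unfolding \<omega>_def f 1 2 3 4 by (simp add: power2_eq_square algebra_simps)
  qed
  have "2 * (\<omega> t x1 * \<omega> t x1 * \<omega> t x1) \<le> 3 * ?B\<^sup>2 * (?B * \<epsilon>) * (2 * E0)"
  proof (rule pointwise_le_integral[where h = "\<lambda>t x. \<omega> t x * \<omega> t x * \<omega> t x" and t = t and g = "\<lambda>x. ?B ^ 3 * B * (K t x \<bullet> K t x)"
        and k = "\<lambda>x. 3 * ?B\<^sup>2 * (?B * \<epsilon>) * (K t x \<bullet> K t x)" and B = "?B ^ 3 * B * (2 * E0)"])
    show "bsmooth (\<lambda>t x. \<omega> t x * \<omega> t x * \<omega> t x)" by (intro bsmooth_mult b\<omega>)
    have cK: "continuous_on UNIV (K t)" by (rule bsmooth_cont_x[OF bsmooth_K t0])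
    show "continuous_on UNIV (\<lambda>x. ?B ^ 3 * B * (K t x \<bullet> K t x))" "continuous_on UNIV (\<lambda>x. 3 * ?B\<^sup>2 * (?B * \<epsilon>) * (K t x \<bullet> K t x))"
      by (intro continuous_intros cK)+
    have \<omega>2: "\<omega> t x * \<omega> t x \<le> ?B\<^sup>2 * (K t x \<bullet> K t x)" for x
    proof -
      have "\<bar>\<omega> t x\<bar>\<^sup>2 \<le> (?B * norm (K t x))\<^sup>2" by (intro power_mono \<omega>K) simp
      then show ?thesis by (simp add: power2_eq_square dot_square_norm algebra_simps)
    qed
    show "\<bar>\<omega> t x * \<omega> t x * \<omega> t x\<bar> \<le> ?B ^ 3 * B * (K t x \<bullet> K t x)" for x
    proof -
      have "\<bar>\<omega> t x\<bar> \<le> ?B * B" by (rule order_trans[OF \<omega>K mult_left_mono[OF B(2)]]) (use B in simp)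
      then have "(\<omega> t x * \<omega> t x) * \<bar>\<omega> t x\<bar> \<le> (?B\<^sup>2 * (K t x \<bullet> K t x)) * (?B * B)"
        by (intro mult_mono \<omega>2) auto
      then show ?thesis by (simp add: abs_mult power2_eq_square power3_eq_cube algebra_simps)
    qed
    show "\<bar>D (\<lambda>t x. \<omega> t x * \<omega> t x * \<omega> t x) t x\<bar> \<le> 3 * ?B\<^sup>2 * (?B * \<epsilon>) * (K t x \<bullet> K t x)" for x
    proof -
      have "D (\<lambda>t x. \<omega> t x * \<omega> t x * \<omega> t x) t x = 3 * ((\<omega> t x * \<omega> t x) * D \<omega> t x)"
        unfolding D_mult[OF bsmooth_mult[OF b\<omega> b\<omega>] b\<omega> t0] D_mult[OF b\<omega> b\<omega> t0] by (simp add: algebra_simps)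
      then have "\<bar>D (\<lambda>t x. \<omega> t x * \<omega> t x * \<omega> t x) t x\<bar> = 3 * ((\<omega> t x * \<omega> t x) * \<bar>D \<omega> t x\<bar>)" by (simp add: abs_mult)
      also have "\<dots> \<le> 3 * ((?B\<^sup>2 * (K t x \<bullet> K t x)) * (?B * \<epsilon>))" by (intro mult_left_mono mult_mono \<omega>2 D\<omega>) auto
      finally show ?thesis by (simp add: algebra_simps)
    qed
    have JK: "J t R (\<lambda>x. K t x \<bullet> K t x) \<le> 2 * E0" if "R > 0" for R using F0_bound[OF t0 that] by (simp add: F_def N_0)
    show "J t R (\<lambda>x. ?B ^ 3 * B * (K t x \<bullet> K t x)) \<le> ?B ^ 3 * B * (2 * E0)" if "R > 0" for R
      unfolding J_cmult by (intro mult_left_mono JK that) (use B in auto)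
    show "J t R (\<lambda>x. 3 * ?B\<^sup>2 * (?B * \<epsilon>) * (K t x \<bullet> K t x)) \<le> 3 * ?B\<^sup>2 * (?B * \<epsilon>) * (2 * E0)" if "R > 0" for R
      unfolding J_cmult by (intro mult_left_mono JK that) (use B \<epsilon> in auto)
  qed (rule t0)
  then show ?thesis by (simp add: \<omega>1 power3_eq_cube)
qed

text \<open>
  At an approximate critical point \<open>x\<close> with \<open>v\<close> at least \<open>\<beta>\<close>, the bound \<open>angle_bound\<close> gives \<open>1 - u\<^sup>2 \<ge> 2 d \<beta>\<close> and \<open>\<langle>W, T\<rangle>\<close> small gives
  \<open>\<bar>\<kappa>\<bar>\<^sup>2 \<ge> \<beta>\<close>. Then \<open>\<bar>\<kappa>\<bar>\<^sup>2 (1 - u\<^sup>2)\<close> is bounded below, which contradicts \<open>planarity_bound\<close>.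
\<close>

theorem tangent_tends_to_e:
  assumes E8: "E0 < 8" and \<eta>: "\<eta> > 0"
  shows "\<exists>t0\<ge>1. \<forall>t\<ge>t0. \<forall>x. 1 - T t x \<bullet> e \<le> \<eta>"
proof -
  have E00: "E0 \<ge> 0" using E_lim_0 E_lim_nonneg[of 0] by simp
  define d where "d = (1 - E0 / 8)\<^sup>2"
  have d: "d > 0" using E8 by (simp add: d_def)
  obtain B0 where B0: "\<And>t x. t \<ge> 1 \<Longrightarrow> norm (N 0 t x) \<le> B0" using N_uniform_bound by blast
  define B where "B = max 1 B0"
  have B: "B \<ge> 1" "\<And>t x. t \<ge> 1 \<Longrightarrow> norm (K t x) \<le> B" using B0 by (auto simp: B_def N_0 le_max_iff_disj)
  define \<beta> where "\<beta> = \<eta> / 2"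
  define a where "a = \<beta>\<^sup>2 * d"
  have \<beta>: "\<beta> > 0" and a: "a > 0" using \<eta> d by (auto simp: \<beta>_def a_def)
  define C where "C = 3 * (8 * B)\<^sup>2 * (8 * B) * (2 * E0)"
  have C: "C \<ge> 0" using B E00 by (simp add: C_def)
  \<comment> \<open>The bounds \<open>\<beta>/2\<close> and \<open>a\<close> serve the two lower estimates below; the last one contradicts \<open>2 f\<^sup>3 \<le> C \<epsilon>\<close> when \<open>f \<ge> a\<close>.\<close>
  define \<epsilon> where "\<epsilon> = min (min (\<beta> / 2) 1) (min a (a ^ 3 / (C + 1)))"
  have "\<epsilon> > 0" using \<beta> a C by (simp add: \<epsilon>_def)
  moreover have "\<epsilon> \<le> \<beta> / 2" "\<epsilon> \<le> 1" "\<epsilon> \<le> a" "\<epsilon> \<le> a ^ 3 / (C + 1)"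
    unfolding \<epsilon>_def by (rule min.coboundedI1 min.coboundedI2, rule min.cobounded1 min.cobounded2)+
  ultimately have \<epsilon>: "\<epsilon> > 0" "\<epsilon> \<le> \<beta> / 2" "\<epsilon> \<le> 1" "\<epsilon> \<le> a" "\<epsilon> \<le> a ^ 3 / (C + 1)" by auto
  obtain t0 where t0: "t0 \<ge> 1" "\<And>t x. t \<ge> t0 \<Longrightarrow> norm (W t x) \<le> \<epsilon>" using W_tends_to_zero[OF \<epsilon>(1)] by blast
  have "1 - T t x0 \<bullet> e \<le> \<eta>" if t: "t \<ge> t0" for t x0
  proof (rule ccontr)
    assume "\<not> 1 - T t x0 \<bullet> e \<le> \<eta>"
    then have big: "1 - T t x0 \<bullet> e > \<eta>" by simp
    have t1: "t \<ge> 1" "t \<ge> 0" using t t0 by auto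
    have pos: "0 < 1 - T t x0 \<bullet> e" using big \<eta> by linarith
    obtain x where x: "(1 - T t x0 \<bullet> e) / 2 \<le> 1 - T t x \<bullet> e" "\<bar>K t x \<bullet> e\<bar> \<le> \<epsilon>"
      using approximate_critical_point[OF t1(2) pos \<epsilon>(1)] by blast
    define u where "u = T t x \<bullet> e"
    define v where "v = 1 - u"
    have v: "\<beta> \<le> v" using x(1) big by (simp add: v_def u_def \<beta>_def)
    have u2: "2 * d \<le> 1 + u" using angle_bound[OF E8 t1(2), of x] by (simp add: d_def u_def)
    define f where "f = (K t x \<bullet> K t x) * (1 - u\<^sup>2) - (K t x \<bullet> e)\<^sup>2"
    have f3: "2 * f ^ 3 \<le> C * \<epsilon>"
      using planarity_bound[OF t1(1) B(1) B(2)[OF t1(1)] less_imp_le[OF \<epsilon>(1)] t0(2)[OF t] f_def[unfolded u_def]]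
      by (simp add: C_def algebra_simps)
    have "W t x \<bullet> T t x = 1/2 * (K t x \<bullet> K t x) - v"
      using normal_N t1(2) by (simp add: W_def Te_def inner_add_left inner_diff_left normal_field_def T_T v_def u_def inner_commute[of e])
    moreover have "\<bar>W t x \<bullet> T t x\<bar> \<le> \<epsilon>"
      using Cauchy_Schwarz_ineq2[of "W t x" "T t x"] t0(2)[OF t, of x] norm_T[OF t1(2), of x] by simp
    ultimately have KK: "\<beta> \<le> K t x \<bullet> K t x" using v \<epsilon>(2) by linarith
    have "\<beta> * (2 * d) \<le> v * (1 + u)" using v u2 \<beta> d by (intro mult_mono) auto
    also have "v * (1 + u) = 1 - u\<^sup>2" by (simp add: v_def power2_eq_square algebra_simps)
    finally have "\<beta> * (\<beta> * (2 * d)) \<le> (K t x \<bullet> K t x) * (1 - u\<^sup>2)"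
      using KK \<beta> d by (intro mult_mono) auto
    then have 1: "2 * a \<le> (K t x \<bullet> K t x) * (1 - u\<^sup>2)" by (simp add: a_def power2_eq_square algebra_simps)
    have "(K t x \<bullet> e)\<^sup>2 = \<bar>K t x \<bullet> e\<bar> * \<bar>K t x \<bullet> e\<bar>" by (simp add: power2_eq_square)
    also have "\<dots> \<le> \<epsilon> * 1" using x(2) \<epsilon> by (intro mult_mono) auto
    finally have "(K t x \<bullet> e)\<^sup>2 \<le> a" using \<epsilon>(4) by simp
    then have "a \<le> f" using 1 by (simp add: f_def)
    then have "a ^ 3 \<le> f ^ 3" using a by (intro power_mono) auto
    moreover have "C * \<epsilon> \<le> a ^ 3"
    proof -
      have "C * \<epsilon> \<le> (C + 1) * \<epsilon>" using \<epsilon>(1) by (intro mult_right_mono) auto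
      also have "\<dots> \<le> (C + 1) * (a ^ 3 / (C + 1))" using C by (intro mult_left_mono \<epsilon>) auto
      finally show ?thesis using C by simp
    qed
    moreover have "a ^ 3 > 0" using a by simp
    ultimately show False using f3 by linarith
  qed
  then show ?thesis using t0 by blast
qed

theorem unif_zero_Te: assumes E8: "E0 < 8" shows "unif_zero Te"
  unfolding unif_zero_def
proof (intro allI impI)
  fix \<eta> :: real assume \<eta>: "\<eta> > 0"
  then have "\<eta>\<^sup>2 / 2 > 0" by simp
  then obtain t0 where t0: "t0 \<ge> 1" "\<And>t x. t \<ge> t0 \<Longrightarrow> 1 - T t x \<bullet> e \<le> \<eta>\<^sup>2 / 2" using tangent_tends_to_e[OF E8] by blast
  have "norm (Te t x) \<le> \<eta>" if t: "t \<ge> t0" for t x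
  proof (rule power2_le_imp_le)
    have "Te t x \<bullet> Te t x = 2 * (1 - T t x \<bullet> e)" using t t0 by (intro Te_Te) simp
    then show "(norm (Te t x))\<^sup>2 \<le> \<eta>\<^sup>2" using t0(2)[OF t, of x] by (simp add: dot_square_norm)
  qed (use \<eta> in simp)
  then show "\<exists>t0\<ge>1. \<forall>t\<ge>t0. \<forall>x. norm (Te t x) \<le> \<eta>" using t0 by blast
qed

theorem unif_zero_Dn_K: assumes E8: "E0 < 8" shows "unif_zero ((D ^^ m) K)"
proof (induction m)
  case 0
  have "unif_zero K"
    by (rule unif_zero_D[OF bsmooth_Te bsmooth_K D_Te unif_zero_Te[OF E8]]) (use Dn_K_bounded[of "Suc 0"] in simp_all)
  then show ?case by simp
next
  case (Suc m)
  show ?case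
    by (rule unif_zero_D[OF bsmooth_Dn[OF bsmooth_K] bsmooth_Dn[OF bsmooth_K] _ Suc])
       (use Dn_K_bounded[of "Suc (Suc m)"] in simp_all)
qed

end

section \<open>Convergence to the line\<close>

lemma SUP_ennreal_tendsto_0:
  fixes f :: "real \<Rightarrow> 'b \<Rightarrow> 'c::real_normed_vector"
  assumes "\<And>\<eta>. \<eta> > 0 \<Longrightarrow> \<exists>t0. \<forall>t\<ge>t0. \<forall>x. norm (f t x) \<le> \<eta>"
  shows "((\<lambda>t. SUP x. ennreal (norm (f t x))) \<longlongrightarrow> 0) at_top"
proof (rule order_tendstoI)
  fix a :: ennreal assume "0 < a"
  then obtain b where b: "0 < b" "b < a" using dense by blast
  then obtain r where r: "b = ennreal r" "r \<ge> 0" by (cases b) auto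
  then have "r > 0" using b by auto
  then obtain t0 where t0: "\<forall>t\<ge>t0. \<forall>x. norm (f t x) \<le> r" using assms by blast
  have "(SUP x. ennreal (norm (f t x))) < a" if "t \<ge> t0" for t
  proof -
    have "(SUP x. ennreal (norm (f t x))) \<le> ennreal r" using t0 that by (intro SUP_least ennreal_leI) auto
    then show ?thesis using b r by simp
  qed
  then show "\<forall>\<^sub>F t in at_top. (SUP x. ennreal (norm (f t x))) < a"
    using eventually_at_top_linorder by blast
qed simp

text \<open>
  Iterated derivatives are read off from an explicit sequence of functions, each the derivative of the previous one.
\<close>

lemma vderiv_tower:
  assumes "\<And>j s. (h j has_vector_derivative h (Suc j) s) (at s)"
  shows "(vderiv ^^ j) (h 0) = h j"
proof (induction j)
  case (Suc j)
  have "(vderiv ^^ Suc j) (h 0) = vderiv (h j)" by (simp add: Suc)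
  also have "\<dots> = h (Suc j)" by (rule ext) (rule vderiv_eqI[OF assms])
  finally show ?case .
qed simp

lemma C_k_tower:
  assumes "\<And>j s. (h j has_vector_derivative h (Suc j) s) (at s)"
  shows "C_k m (h 0)"
  unfolding C_k_def vderiv_tower[of h, OF assms]
  using assms by (auto simp: differentiable_on_def continuous_on_eq_continuous_at
      intro: differentiableI_vector has_vector_derivative_continuous)

lemma has_vector_derivative_shift:
  assumes "(g has_vector_derivative d) (at (s + c))"
  shows "((\<lambda>s. g (s + c)) has_vector_derivative d) (at s)"
proof -
  have "((\<lambda>s. s + c) has_vector_derivative 1) (at s)" by (auto intro!: derivative_eq_intros)
  from vector_diff_chain_at[OF this assms] show ?thesis by (simp add: o_def)
qed

lemma energy_ge_integral:
  fixes g :: "real \<Rightarrow> real"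
  assumes c: "continuous_on UNIV g" and nn: "\<And>x. 0 \<le> g x"
  shows "ennreal (integral {a..b} g) \<le> (\<integral>\<^sup>+ x. ennreal (g x) \<partial>lborel)"
proof -
  let ?h = "\<lambda>x. if x \<in> {a..b} then g x else 0"
  have "(g has_integral integral {a..b} g) {a..b}"
    by (intro integrable_integral integrable_continuous_real continuous_on_subset[OF c]) auto
  then have I: "(?h has_integral integral {a..b} g) UNIV" by (simp only: has_integral_restrict_UNIV)
  have "g \<in> borel_measurable borel" using c by (rule borel_measurable_continuous_onI)
  then have "?h \<in> borel_measurable borel" by measurable
  then have "(\<integral>\<^sup>+ x. ennreal (?h x) \<partial>lborel) = ennreal (integral {a..b} g)"
    using nn by (intro nn_integral_has_integral_lborel[OF _ _ I]) auto
  then have "ennreal (integral {a..b} g) = (\<integral>\<^sup>+ x. ennreal (?h x) \<partial>lborel)" by simp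
  also have "\<dots> \<le> (\<integral>\<^sup>+ x. ennreal (g x) \<partial>lborel)" using nn by (intro nn_integral_mono) (auto intro: ennreal_leI)
  finally show ?thesis .
qed

lemma (in bounded_flow) initial_energy_bound:
  assumes e: "norm e = 1" and E: "energy e (\<gamma> 0) = ennreal E0" "E0 \<ge> 0" and R: "R > 0"
  shows "J 0 R (\<lambda>x. 1/2 * (K 0 x \<bullet> K 0 x) + (1 - T 0 x \<bullet> e)) \<le> E0"
proof -
  let ?d = "\<lambda>x. 1/2 * (K 0 x \<bullet> K 0 x) + (1 - T 0 x \<bullet> e)"
  let ?g = "\<lambda>x. ?d x * speed 0 x"
  have e1: "e \<bullet> e = 1" using e by (simp add: norm_eq_sqrt_inner)
  have d: "?d x = 1/2 * (norm (curvature (\<gamma> 0) x))\<^sup>2 + 1/2 * (norm (tangent (\<gamma> 0) x - e))\<^sup>2" for x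
  proof -
    have "(norm (T 0 x - e))\<^sup>2 = 2 * (1 - T 0 x \<bullet> e)"
      unfolding dot_square_norm[symmetric] by (simp add: inner_diff_left inner_diff_right T_T e1 inner_commute)
    then show ?thesis by (simp add: K_def T_def dot_square_norm)
  qed
  have d0: "0 \<le> ?d x" for x unfolding d by simp
  have cd: "continuous_on A ?d" for A by (intro continuous_intros bsmooth_cont_x bsmooth_K bsmooth_T) auto
  have cg: "continuous_on UNIV ?g" by (intro continuous_on_mult cd cont_speed) simp
  have g0: "0 \<le> ?g x" for x by (intro mult_nonneg_nonneg d0 less_imp_le[OF speed_pos]) simp
  have "energy e (\<gamma> 0) = (\<integral>\<^sup>+ x. ennreal (?g x) \<partial>lborel)"
    unfolding energy_def d by (simp add: speed_def partial_x_def)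
  then have "ennreal (integral {-R..R} ?g) \<le> ennreal E0"
    using energy_ge_integral[OF cg g0, of "-R" R] E by simp
  then have "integral {-R..R} ?g \<le> E0" using E(2) by (simp add: ennreal_le_iff)
  moreover have "J 0 R ?d \<le> integral {-R..R} ?g"
    unfolding J_def
  proof (rule integral_le)
    show "(\<lambda>x. (1 - (x / R)\<^sup>2) * ?d x * speed 0 x) integrable_on {-R..R}" by (rule J_integrable[OF order_refl cd])
    show "?g integrable_on {-R..R}" by (intro integrable_continuous_real continuous_on_subset[OF cg]) simp
    fix x
    have "(1 - (x / R)\<^sup>2) * ?g x \<le> 1 * ?g x" by (intro mult_right_mono g0) simp
    then show "(1 - (x / R)\<^sup>2) * ?d x * speed 0 x \<le> ?g x" by (simp add: mult.assoc)
  qed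
  ultimately show ?thesis by simp
qed

context finite_energy_flow
begin

text \<open>
  The derivatives \<open>\<partial>\<^sub>s\<^sup>j T\<close>, which are the derivatives of order \<open>j + 1\<close> of the curve in its arclength parameter.
\<close>

definition Z :: "nat \<Rightarrow> real \<Rightarrow> real \<Rightarrow> 'a" where
  "Z j = (case j of 0 \<Rightarrow> T | Suc i \<Rightarrow> (D ^^ i) K)"

lemma Z_simps: "Z 0 = T" "Z (Suc i) = (D ^^ i) K" by (simp_all add: Z_def)

lemma bsmooth_Z: "bsmooth (Z j)"
  by (cases j) (simp_all add: Z_simps bsmooth_T bsmooth_Dn bsmooth_K)

lemma D_Z: "D (Z j) = Z (Suc j)"
  by (cases j) (simp_all add: Z_simps K_eq)

lemma arc_deriv_Dn: "(arc_deriv (\<gamma> t) ^^ m) (curvature (\<gamma> t)) = (D ^^ m) K t"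
  by (induction m) (simp_all add: K_def D_def)

definition curve :: "real \<Rightarrow> real \<Rightarrow> nat \<Rightarrow> real \<Rightarrow> 'a" where
  "curve t c j = (case j of 0 \<Rightarrow> (\<lambda>s. canonical_reparam (\<gamma> t) (s + c) - canonical_reparam (\<gamma> t) c)
     | Suc i \<Rightarrow> (\<lambda>s. Z i t (arcparam t (s + c))))"

lemma curve_tower: assumes t: "t \<ge> 0" shows "(curve t c j has_vector_derivative curve t c (Suc j) s) (at s)"
proof (cases j)
  case 0
  have "((\<lambda>s. \<gamma> t (arcparam t (s + c)) - \<gamma> t (arcparam t c)) has_vector_derivative T t (arcparam t (s + c)) - 0) (at s)"
    by (intro has_vector_derivative_diff has_vector_derivative_const has_vector_derivative_shift[OF reparam_\<gamma>_deriv[OF t]])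
  then show ?thesis by (simp add: 0 curve_def canonical_reparam_def arcparam_def Z_simps)
next
  case (Suc i)
  show ?thesis using has_vector_derivative_shift[OF reparam_deriv[OF bsmooth_Z[of i] t], where s = s and c = c] by (simp add: Suc curve_def D_Z)
qed

definition line :: "nat \<Rightarrow> real \<Rightarrow> 'a" where
  "line j = (case j of 0 \<Rightarrow> (\<lambda>s. s *\<^sub>R e) | Suc i \<Rightarrow> (case i of 0 \<Rightarrow> (\<lambda>s. e) | Suc _ \<Rightarrow> (\<lambda>s. 0)))"

lemma line_tower: "(line j has_vector_derivative line (Suc j) s) (at s)"
  by (auto simp: line_def split: nat.splits intro!: derivative_eq_intros)

text \<open>
  The derivatives of positive order converge uniformly on the whole line; integrating the first one from the base point gives
  convergence of the curves on compact sets.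
\<close>

lemma curve_close:
  assumes E8: "E0 < 8" and K: "compact Kc"
  shows "uniform_limit Kc (\<lambda>t. curve t (\<sigma> t) j) (line j) at_top"
  unfolding uniform_limit_iff
proof (intro allI impI)
  fix \<epsilon> :: real assume \<epsilon>: "\<epsilon> > 0"
  obtain M where M: "M > 0" "\<And>s. s \<in> Kc \<Longrightarrow> \<bar>s\<bar> \<le> M"
    using compact_imp_bounded[OF K] unfolding bounded_pos by auto
  have "\<exists>t0\<ge>1. \<forall>t\<ge>t0. \<forall>s\<in>Kc. dist (curve t (\<sigma> t) j s) (line j s) < \<epsilon>"
  proof (cases "j \<le> 1")
    case True
    define \<eta> where "\<eta> = min (\<epsilon> / 2) (\<epsilon> / (6 * M))"
    have \<eta>: "\<eta> > 0" "\<eta> \<le> \<epsilon> / 2" "\<eta> \<le> \<epsilon> / (6 * M)" using \<epsilon> M by (auto simp: \<eta>_def)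
    obtain t0 where t0: "t0 \<ge> 1" "\<And>t x. t \<ge> t0 \<Longrightarrow> norm (Te t x) \<le> \<eta>"
      using unif_zero_Te[OF E8] \<eta>(1) unfolding unif_zero_def by blast
    have "dist (curve t (\<sigma> t) j s) (line j s) < \<epsilon>" if t: "t \<ge> t0" and s: "s \<in> Kc" for t s
    proof -
      have t1: "t \<ge> 0" using t t0 by simp
      have d1: "norm (curve t (\<sigma> t) 1 s - line 1 s) \<le> \<eta>" for s
        using t0(2)[OF t, of "arcparam t (s + \<sigma> t)"] by (simp add: curve_def line_def Z_simps Te_def)
      show ?thesis
      proof (cases j)
        case 0
        let ?g = "\<lambda>s. curve t (\<sigma> t) 0 s - line 0 s"
        have "norm (?g s - ?g 0 - (s - 0) *\<^sub>R (curve t (\<sigma> t) 1 0 - line 1 0)) \<le> norm (s - 0) * (2 * \<eta>)"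
        proof (rule vector_differentiable_bound_linearization[where S = UNIV])
          show "(?g has_vector_derivative curve t (\<sigma> t) 1 x - line 1 x) (at x within UNIV)" for x
            using has_vector_derivative_diff[OF curve_tower[OF t1, of "\<sigma> t" 0 x] line_tower[of 0 x]] by simp
          show "norm ((curve t (\<sigma> t) 1 x - line 1 x) - (curve t (\<sigma> t) 1 0 - line 1 0)) \<le> 2 * \<eta>" for x
            using norm_triangle_ineq4[of "curve t (\<sigma> t) 1 x - line 1 x" "curve t (\<sigma> t) 1 0 - line 1 0"] d1[of x] d1[of 0] by linarith
        qed auto
        moreover have "?g 0 = 0" by (simp add: curve_def line_def)
        moreover have "norm ((s - 0) *\<^sub>R (curve t (\<sigma> t) 1 0 - line 1 0)) \<le> \<bar>s\<bar> * \<eta>"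
          unfolding norm_scaleR using mult_left_mono[OF d1[of 0], of "\<bar>s\<bar>"] by simp
        moreover have "norm (?g s) \<le> norm (?g s - (s - 0) *\<^sub>R (curve t (\<sigma> t) 1 0 - line 1 0)) + norm ((s - 0) *\<^sub>R (curve t (\<sigma> t) 1 0 - line 1 0))"
          using norm_triangle_ineq[of "?g s - (s - 0) *\<^sub>R (curve t (\<sigma> t) 1 0 - line 1 0)" "(s - 0) *\<^sub>R (curve t (\<sigma> t) 1 0 - line 1 0)"] by simp
        ultimately have "norm (?g s) \<le> \<bar>s\<bar> * (3 * \<eta>)" by (simp add: algebra_simps)
        also have "\<dots> \<le> M * (3 * (\<epsilon> / (6 * M)))" by (intro mult_mono M s mult_left_mono \<eta>) (use M \<eta> in auto)
        also have "\<dots> < \<epsilon>" using M \<epsilon> by simp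
        finally show ?thesis by (simp add: 0 dist_norm)
      next
        case (Suc i)
        then have "j = 1" using True by simp
        then show ?thesis using d1[of s] \<eta>(2) \<epsilon> by (simp add: dist_norm)
      qed
    qed
    then show ?thesis using t0 by blast
  next
    case False
    then obtain i where i: "j = Suc (Suc i)" by (metis One_nat_def Suc_le_mono le0 not0_implies_Suc)
    obtain t0 where t0: "t0 \<ge> 1" "\<And>t x. t \<ge> t0 \<Longrightarrow> norm ((D ^^ i) K t x) \<le> \<epsilon> / 2"
      using unif_zero_Dn_K[OF E8, of i] \<epsilon> unfolding unif_zero_def by (metis half_gt_zero)
    have "dist (curve t (\<sigma> t) j s) (line j s) < \<epsilon>" if t: "t \<ge> t0" for t s
      using t0(2)[OF t, of "arcparam t (s + \<sigma> t)"] \<epsilon> by (simp add: i curve_def line_def Z_simps)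
    then show ?thesis using t0 by blast
  qed
  then show "\<forall>\<^sub>F t in at_top. \<forall>s\<in>Kc. dist (curve t (\<sigma> t) j s) (line j s) < \<epsilon>"
    using eventually_at_top_linorder by blast
qed

theorem convergence_to_line:
  assumes E8: "E0 < 8"
  shows "((\<lambda>t. SUP x. ennreal (norm (tangent (\<gamma> t) x - e))) \<longlongrightarrow> 0) at_top"
    and "((\<lambda>t. SUP x. ennreal (norm ((arc_deriv (\<gamma> t) ^^ m) (curvature (\<gamma> t)) x))) \<longlongrightarrow> 0) at_top"
    and "C_k_loc_tendsto m (\<lambda>t s. canonical_reparam (\<gamma> t) (s + \<sigma> t) - canonical_reparam (\<gamma> t) (\<sigma> t)) (\<lambda>s. s *\<^sub>R e) at_top"
proof -
  show "((\<lambda>t. SUP x. ennreal (norm (tangent (\<gamma> t) x - e))) \<longlongrightarrow> 0) at_top"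
    by (rule SUP_ennreal_tendsto_0) (use unif_zero_Te[OF E8] in \<open>auto simp: unif_zero_def Te_def T_def\<close>)
  show "((\<lambda>t. SUP x. ennreal (norm ((arc_deriv (\<gamma> t) ^^ m) (curvature (\<gamma> t)) x))) \<longlongrightarrow> 0) at_top"
    unfolding arc_deriv_Dn
  proof (rule SUP_ennreal_tendsto_0)
    fix \<eta> :: real assume "\<eta> > 0"
    then show "\<exists>t0. \<forall>t\<ge>t0. \<forall>x. norm ((D ^^ m) K t x) \<le> \<eta>"
      using unif_zero_Dn_K[OF E8, of m] unfolding unif_zero_def by blast
  qed
  have c0: "(\<lambda>s. canonical_reparam (\<gamma> t) (s + \<sigma> t) - canonical_reparam (\<gamma> t) (\<sigma> t)) = curve t (\<sigma> t) 0" for t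
    by (simp add: curve_def)
  have l0: "(\<lambda>s. s *\<^sub>R e) = line 0" by (simp add: line_def)
  show "C_k_loc_tendsto m (\<lambda>t s. canonical_reparam (\<gamma> t) (s + \<sigma> t) - canonical_reparam (\<gamma> t) (\<sigma> t)) (\<lambda>s. s *\<^sub>R e) at_top"
    unfolding C_k_loc_tendsto_def c0 l0
  proof (intro conjI allI impI)
    show "C_k m (line 0)" by (rule C_k_tower[of line, OF line_tower])
    show "\<forall>\<^sub>F t in at_top. C_k m (curve t (\<sigma> t) 0)"
      using eventually_ge_at_top[of 0] by eventually_elim (rule C_k_tower[of "curve _ _", OF curve_tower])
    fix Kc :: "real set" and j assume K: "compact Kc" and "j \<le> m"
    have ev: "\<forall>\<^sub>F t in at_top. \<forall>s\<in>Kc. (vderiv ^^ j) (curve t (\<sigma> t) 0) s = curve t (\<sigma> t) j s"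
      using eventually_ge_at_top[of 0]
    proof eventually_elim
      case (elim t)
      show ?case unfolding vderiv_tower[of "curve t (\<sigma> t)", OF curve_tower[OF elim]] by simp
    qed
    have l: "(vderiv ^^ j) (line 0) = line j" by (rule vderiv_tower[of line, OF line_tower])
    show "uniform_limit Kc (\<lambda>t. (vderiv ^^ j) (curve t (\<sigma> t) 0)) ((vderiv ^^ j) (line 0)) at_top"
      unfolding l using uniform_limit_cong[OF ev, of "line j" "line j"] curve_close[OF E8 K, of \<sigma> j] by simp
  qed
qed

end

theorem corollary2p10:
  fixes k :: "'n::finite"
    and \<gamma>\<^sub>0 :: "real \<Rightarrow> real ^ 'n"
    and \<gamma> :: "real \<Rightarrow> real \<Rightarrow> real ^ 'n"
  assumes "CARD('n) \<ge> 2"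
    and "homogeneous_C_inf \<gamma>\<^sub>0"
    and "(INF x. norm (vderiv \<gamma>\<^sub>0 x)) > 0"
    and "energy (axis k 1) \<gamma>\<^sub>0 < 8"
    and "elastic_flow \<gamma>\<^sub>0 \<gamma>"
  shows "((\<lambda>t. SUP x. ennreal (norm (tangent (\<gamma> t) x - axis k 1))) \<longlongrightarrow> 0) at_top
    \<and> (\<forall>m. ((\<lambda>t. SUP x. ennreal (norm ((arc_deriv (\<gamma> t) ^^ m) (curvature (\<gamma> t)) x))) \<longlongrightarrow> 0) at_top)
    \<and> (\<forall>(\<sigma> :: real \<Rightarrow> real) m.
         C_k_loc_tendsto m
           (\<lambda>t s. canonical_reparam (\<gamma> t) (s + \<sigma> t) - canonical_reparam (\<gamma> t) (\<sigma> t))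
           (\<lambda>s. s *\<^sub>R axis k 1) at_top)"
proof -
  interpret bounded_flow \<gamma> by (rule elastic_flow_bounded_flow[OF assms(2,5)])
  define E0 where "E0 = enn2real (energy (axis k 1) \<gamma>\<^sub>0)"
  have fin: "energy (axis k 1) \<gamma>\<^sub>0 \<noteq> top" using assms(4) by auto
  have \<gamma>0: "\<gamma> 0 = \<gamma>\<^sub>0" using assms(5) by (simp add: elastic_flow_def)
  have E: "energy (axis k 1) (\<gamma> 0) = ennreal E0" "E0 \<ge> 0" using fin by (auto simp: E0_def \<gamma>0 less_top)
  have "ennreal E0 < ennreal 8" using assms(4) E(1) by (simp add: \<gamma>0)
  then have E8: "E0 < 8" by (simp add: ennreal_less_iff E(2))
  have e: "norm (axis k 1 :: real ^ 'n) = 1" by simp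
  interpret finite_energy_flow \<gamma> "axis k 1" E0
    by unfold_locales (use e initial_energy_bound[OF e E] in auto)
  show ?thesis using convergence_to_line[OF E8] by blast
qed

end
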